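(* Every complete class of valuated matroids is closed under taking contraction, truncation, induction by bipartite graphs, induction by directed networks, and valuated matroid union. Furthermore, the valuated gammoids form the smallest (nonempty) complete class; hence they are contained in all (nonempty) complete classes.
   Context: All ground sets are finite; a maximum over the empty set is $-\infty$. Valuated matroid of rank $d$ on $V$: a function $f\colon\binom{V}{d}\to\mathbb{R}\cup\{-\infty\}$, with nonempty effective domain $\mathrm{dom}(f)=\{X: f(X)>-\infty\}$, such that for all $X,Y\in\binom{V}{d}$ and $i\in X\setminus Y$, $f(X)+f(Y)\le\max_{j\in Y\setminus X}\{f(X-i+j)+f(Y+i-j)\}$. The set $\mathrm{dom}(f)$ is the set of bases of a matroid; "independent" and "full rank" refer to this matroid. Classes of valuated matroids are understood up to relabelling of ground sets. Operations on a valuated matroid $f$ of rank $d$ on $V$: - Restriction (deletion): if $V\setminus Y$ has full rank, $f\setminus Y=f|(V\setminus Y)$ is $f$ restricted to $\binom{V\setminus Y}{d}$; otherwise the deletion is the function attaining only $-\infty$. - Contraction: if $Y$ is independent, $(f/Y)(X)=f(X\cup Y)$ for $X\in\binom{V\setminus Y}{d-|Y|}$; otherwise the contraction is the function attaining only $-\infty$. - Dual: $f^*(X)=f(V\setminus X)$ for $X\in\binom{V}{|V|-d}$. - Truncation: $f^{(1)}(X)=\max_{v\in V\setminus X}f(X\cup v)$ for $X\in\binom{V}{d-1}$. - Principal extension by $w\in(\mathbb{R}\cup\{-\infty\})^V$: the function $f^w$ on $\binom{V\cup\{p\}}{d}$, $p$ a new element, with $f^w(X)=f(X)$ for $X\in\binom{V}{d}$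 and $f^w(X\cup p)=\max_{v\in V\setminus X}(f(X\cup v)+w_v)$ for $X\in\binom{V}{d-1}$. - Valuated matroid union of $f_1,f_2$ of ranks $d_1,d_2$ on $V_1,V_2$ (not necessarily disjoint): $(f_1\vee f_2)(X)=\max\{f_1(Y)+f_2(X\setminus Y): Y\subseteq X,\ Y\in\binom{V_1}{d_1},\ X\setminus Y\in\binom{V_2}{d_2}\}$ for $X\in\binom{V_1\cup V_2}{d_1+d_2}$. If $V_1\cap V_2=\emptyset$ this is the direct sum $f_1\oplus f_2$. - Induction by a directed network: let $N=(T,A)$ be a directed graph with arc weights $c\in\mathbb{R}^A$, let $V,U\subseteq T$ be two nonempty subsets of nodes, and let $g$ be a valuated matroid on $U$ of rank $d$. The induction of $g$ by $N$ is the function on $\binom{V}{d}$ that maps $X$ to the maximum of $\sum_{a\in\mathcal{P}}c(a)+g(Y)$ over all sets $\mathcal{P}$ of node-disjoint paths in $N$ from $X$ to a set $Y\in\binom{U}{d}$ with $\partial_V(\mathcal{P})=X$ and $\partial_U(\mathcal{P})=Y$, where $\partial_Z(\mathcal{P})$ denotes the set of nodes in $Z$ incident to the subgraph formed by $\mathcal{P}$ (the value is $-\infty$ if there is none). Induction by a bipartite graph $G=(V,U;E)$ is the special case where the network is bipartite with the edges directed from $V$ to $U$ (so the paths form a matching). Closure under an operation means that the result belongs to the class whenever it has nonempty effective domain. A class (a subset of the set of valuated matroids) is complete if it is closed under restriction, duals, direct sum and principal extension. Valuated gammoids: the contractions of those valuated matroids that arise by induction via a bipartite graph from a trivially valuated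 free matroid, i.e. from the function on the subsets of size $|U|$ of a finite set $U$ taking the value $0$ on $U$. Thus a valuated gammoid $f$ on $V$ of rank $d$ is given by a finite set $W$ disjoint from $V$ and a bipartite graph $G=(V\cup W,U;E)$ with weights $c\in\mathbb{R}^E$ and $|U|=d+|W|$, where $f(X)$ is the maximum weight of a matching of $G$ whose endpoints in $V\cup W$ are exactly $X\cup W$ and which covers all of $U$ ($-\infty$ if there is none).
   Formalization: For arbitrary arc weights, closure under induction by directed networks fails; it is shown for networks in which no directed cycle with at least two nodes that avoids V and U has positive total weight (acyclic and bipartite networks are all included). *)

theory Defs
  imports "HOL-Library.Extended_Real" "HOL-Library.Infinite_Typeclass"
begin

(* A function on the d-element subsets of V with values in the reals together with -\<infinity>,
   stored as (V, d, f).  So that equality of triples is equality of such functions, all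
   operations below return -\<infinity> on sets that are not d-element subsets of V.
   Maxima are written as suprema in ereal: Sup {} = -\<infinity>, and only finite sets occur. *)

datatype 'a setfun = Setfun (ground: "'a set") (rnk: nat) (val: "'a set \<Rightarrow> ereal")

definition ksubsets :: "'a set \<Rightarrow> nat \<Rightarrow> 'a set set" where
  "ksubsets V d = {X. X \<subseteq> V \<and> card X = d}"

definition eff_dom :: "'a setfun \<Rightarrow> 'a set set" where
  "eff_dom f = {X \<in> ksubsets (ground f) (rnk f). val f X > -\<infinity>}"

definition valuated_matroid :: "'a setfun \<Rightarrow> bool" where
  "valuated_matroid f \<longleftrightarrow>
     finite (ground f) \<and>
     (\<forall>X. val f X \<noteq> \<infinity>) \<and>
     (\<forall>X. X \<notin> ksubsets (ground f) (rnk f) \<longrightarrow> val f X = -\<infinity>) \<and>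
     eff_dom f \<noteq> {} \<and>
     (\<forall>X \<in> ksubsets (ground f) (rnk f). \<forall>Y \<in> ksubsets (ground f) (rnk f). \<forall>i \<in> X - Y.
        val f X + val f Y \<le>
          (SUP j \<in> Y - X. val f (insert j (X - {i})) + val f (insert i (Y - {j}))))"

definition indep_set :: "'a setfun \<Rightarrow> 'a set \<Rightarrow> bool" where
  "indep_set f Y \<longleftrightarrow> (\<exists>B \<in> eff_dom f. Y \<subseteq> B)"

definition full_rank :: "'a setfun \<Rightarrow> 'a set \<Rightarrow> bool" where
  "full_rank f S \<longleftrightarrow> (\<exists>B \<in> eff_dom f. B \<subseteq> S)"


definition deletion :: "'a setfun \<Rightarrow> 'a set \<Rightarrow> 'a setfun" where
  "deletion f Y = Setfun (ground f - Y) (rnk f)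
     (\<lambda>X. if full_rank f (ground f - Y) \<and> X \<in> ksubsets (ground f - Y) (rnk f)
          then val f X else -\<infinity>)"

(* card X + card Y = rnk f instead of card X = rnk f - card Y: the subtraction on nat truncates *)
definition contraction :: "'a setfun \<Rightarrow> 'a set \<Rightarrow> 'a setfun" where
  "contraction f Y = Setfun (ground f - Y) (rnk f - card Y)
     (\<lambda>X. if indep_set f Y \<and> X \<subseteq> ground f - Y \<and> card X + card Y = rnk f
          then val f (X \<union> Y) else -\<infinity>)"

definition dual :: "'a setfun \<Rightarrow> 'a setfun" where
  "dual f = Setfun (ground f) (card (ground f) - rnk f)
     (\<lambda>X. if X \<in> ksubsets (ground f) (card (ground f) - rnk f)
          then val f (ground f - X) else -\<infinity>)"

(* for rank 0 the truncation is -\<infinity> everywhere *)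
definition truncation :: "'a setfun \<Rightarrow> 'a setfun" where
  "truncation f = Setfun (ground f) (rnk f - 1)
     (\<lambda>X. if X \<subseteq> ground f \<and> card X + 1 = rnk f
          then (SUP v \<in> ground f - X. val f (insert v X)) else -\<infinity>)"

(* intended for p not in ground f *)
definition principal_extension :: "'a setfun \<Rightarrow> 'a \<Rightarrow> ('a \<Rightarrow> ereal) \<Rightarrow> 'a setfun" where
  "principal_extension f p w = Setfun (insert p (ground f)) (rnk f)
     (\<lambda>Z. if Z \<in> ksubsets (insert p (ground f)) (rnk f)
          then (if p \<in> Z
                then (SUP v \<in> ground f - (Z - {p}). val f (insert v (Z - {p})) + w v)
                else val f Z)
          else -\<infinity>)"

(* the ground sets need not be disjoint; when they are, this is the direct sum *)
definition vunion :: "'a setfun \<Rightarrow> 'a setfun \<Rightarrow> 'a setfun" where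
  "vunion f1 f2 = Setfun (ground f1 \<union> ground f2) (rnk f1 + rnk f2)
     (\<lambda>X. if X \<in> ksubsets (ground f1 \<union> ground f2) (rnk f1 + rnk f2)
          then Sup {val f1 Y + val f2 (X - Y) | Y.
                      Y \<subseteq> X \<and> Y \<in> ksubsets (ground f1) (rnk f1)
                        \<and> X - Y \<in> ksubsets (ground f2) (rnk f2)}
          else -\<infinity>)"

(* transport along a map that is injective on the ground set *)
definition relabel :: "('a \<Rightarrow> 'a) \<Rightarrow> 'a setfun \<Rightarrow> 'a setfun" where
  "relabel \<phi> f = Setfun (\<phi> ` ground f) (rnk f)
     (\<lambda>X. if X \<subseteq> \<phi> ` ground f then val f {v \<in> ground f. \<phi> v \<in> X} else -\<infinity>)"


definition directed_network :: "'a set \<Rightarrow> ('a \<times> 'a) set \<Rightarrow> 'a set \<Rightarrow> 'a set \<Rightarrow> bool" where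
  "directed_network T A V U \<longleftrightarrow>
     finite T \<and> A \<subseteq> T \<times> T \<and> V \<subseteq> T \<and> U \<subseteq> T \<and> V \<noteq> {} \<and> U \<noteq> {}"

(* a path is the list of its nodes; a single node is a path without arcs *)
definition dpath :: "'a set \<Rightarrow> ('a \<times> 'a) set \<Rightarrow> 'a list \<Rightarrow> bool" where
  "dpath T A p \<longleftrightarrow>
     p \<noteq> [] \<and> set p \<subseteq> T \<and> distinct p \<and> successively (\<lambda>x y. (x, y) \<in> A) p"

definition path_arcs :: "'a list \<Rightarrow> ('a \<times> 'a) set" where
  "path_arcs p = set (zip p (tl p))"

(* Node-disjoint paths from X to Y: the initial nodes are exactly X and the terminal nodes
   exactly Y, so by disjointness every node of X starts its own path.  The last two conditions
   are \<partial>_V(P) = X and \<partial>_U(P) = Y: no further node of V or U is met. *)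
definition linking ::
  "'a set \<Rightarrow> ('a \<times> 'a) set \<Rightarrow> 'a set \<Rightarrow> 'a set \<Rightarrow> 'a list set \<Rightarrow> 'a set \<Rightarrow> 'a set \<Rightarrow> bool" where
  "linking T A V U P X Y \<longleftrightarrow>
     (\<forall>p \<in> P. dpath T A p) \<and>
     (\<forall>p \<in> P. \<forall>q \<in> P. p \<noteq> q \<longrightarrow> set p \<inter> set q = {}) \<and>
     hd ` P = X \<and> last ` P = Y \<and>
     V \<inter> (\<Union>p \<in> P. set p) = X \<and> U \<inter> (\<Union>p \<in> P. set p) = Y"

definition network_induction ::
  "'a set \<Rightarrow> ('a \<times> 'a) set \<Rightarrow> ('a \<times> 'a \<Rightarrow> real) \<Rightarrow> 'a set \<Rightarrow> 'a setfun \<Rightarrow> 'a setfun" where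
  "network_induction T A c V g = Setfun V (rnk g)
     (\<lambda>X. if X \<in> ksubsets V (rnk g)
          then Sup {ereal (\<Sum>a \<in> (\<Union>p \<in> P. path_arcs p). c a) + val g Y | P Y.
                      Y \<in> ksubsets (ground g) (rnk g) \<and> linking T A V (ground g) P X Y}
          else -\<infinity>)"

(* Longest node-disjoint paths do not induce a valuated matroid in general if the arc weights
   have positive directed cycles.  Loops and cycles through V or U are never used by a linking
   and are therefore not restricted. *)
definition no_positive_cycle ::
  "'a set \<Rightarrow> ('a \<times> 'a) set \<Rightarrow> ('a \<times> 'a \<Rightarrow> real) \<Rightarrow> 'a set \<Rightarrow> 'a set \<Rightarrow> bool" where
  "no_positive_cycle T A c V U \<longleftrightarrow>
     (\<forall>p. dpath T A p \<and> length p \<ge> 2 \<and> (last p, hd p) \<in> A \<and> set p \<inter> (V \<union> U) = {} \<longrightarrow>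
        (\<Sum>a \<in> path_arcs p. c a) + c (last p, hd p) \<le> 0)"

definition bipartite_graph :: "'a set \<Rightarrow> 'a set \<Rightarrow> ('a \<times> 'a) set \<Rightarrow> bool" where
  "bipartite_graph V U E \<longleftrightarrow>
     V \<inter> U = {} \<and> E \<subseteq> V \<times> U \<and> directed_network (V \<union> U) E V U"

definition bipartite_induction ::
  "'a set \<Rightarrow> ('a \<times> 'a) set \<Rightarrow> ('a \<times> 'a \<Rightarrow> real) \<Rightarrow> 'a setfun \<Rightarrow> 'a setfun" where
  "bipartite_induction V E c g = network_induction (V \<union> ground g) E c V g"


definition free_vm :: "'a set \<Rightarrow> 'a setfun" where
  "free_vm U = Setfun U (card U) (\<lambda>X. if X = U then 0 else -\<infinity>)"

(* All sets live in one infinite type, so a contracted set W and the other side U of the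
   bipartite graph can always be chosen inside that type. *)
definition valuated_gammoids :: "'a::infinite setfun set" where
  "valuated_gammoids =
     {contraction (bipartite_induction V' E c (free_vm U)) W | V' U E c W.
        bipartite_graph V' U E \<and> W \<subseteq> V' \<and>
        eff_dom (contraction (bipartite_induction V' E c (free_vm U)) W) \<noteq> {}}"


(* a set of valuated matroids on finite subsets of a fixed infinite type, up to relabelling *)
definition vm_class :: "'a::infinite setfun set \<Rightarrow> bool" where
  "vm_class C \<longleftrightarrow>
     (\<forall>f \<in> C. valuated_matroid f) \<and>
     (\<forall>f \<in> C. \<forall>\<phi>. inj_on \<phi> (ground f) \<longrightarrow> relabel \<phi> f \<in> C)"

definition closed_restriction :: "'a::infinite setfun set \<Rightarrow> bool" where
  "closed_restriction C \<longleftrightarrow>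
     (\<forall>f \<in> C. \<forall>Y \<subseteq> ground f. eff_dom (deletion f Y) \<noteq> {} \<longrightarrow> deletion f Y \<in> C)"

definition closed_dual :: "'a::infinite setfun set \<Rightarrow> bool" where
  "closed_dual C \<longleftrightarrow> (\<forall>f \<in> C. eff_dom (dual f) \<noteq> {} \<longrightarrow> dual f \<in> C)"

definition closed_direct_sum :: "'a::infinite setfun set \<Rightarrow> bool" where
  "closed_direct_sum C \<longleftrightarrow>
     (\<forall>f \<in> C. \<forall>g \<in> C. ground f \<inter> ground g = {} \<and> eff_dom (vunion f g) \<noteq> {} \<longrightarrow> vunion f g \<in> C)"

definition closed_principal_extension :: "'a::infinite setfun set \<Rightarrow> bool" where
  "closed_principal_extension C \<longleftrightarrow>
     (\<forall>f \<in> C. \<forall>p w. p \<notin> ground f \<and> (\<forall>v \<in> ground f. w v \<noteq> \<infinity>) \<and>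
        eff_dom (principal_extension f p w) \<noteq> {} \<longrightarrow> principal_extension f p w \<in> C)"

definition complete_class :: "'a::infinite setfun set \<Rightarrow> bool" where
  "complete_class C \<longleftrightarrow>
     vm_class C \<and> closed_restriction C \<and> closed_dual C \<and> closed_direct_sum C \<and>
     closed_principal_extension C"

definition closed_contraction :: "'a::infinite setfun set \<Rightarrow> bool" where
  "closed_contraction C \<longleftrightarrow>
     (\<forall>f \<in> C. \<forall>Y \<subseteq> ground f. eff_dom (contraction f Y) \<noteq> {} \<longrightarrow> contraction f Y \<in> C)"

definition closed_truncation :: "'a::infinite setfun set \<Rightarrow> bool" where
  "closed_truncation C \<longleftrightarrow> (\<forall>f \<in> C. eff_dom (truncation f) \<noteq> {} \<longrightarrow> truncation f \<in> C)"

definition closed_union :: "'a::infinite setfun set \<Rightarrow> bool" where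
  "closed_union C \<longleftrightarrow> (\<forall>f \<in> C. \<forall>g \<in> C. eff_dom (vunion f g) \<noteq> {} \<longrightarrow> vunion f g \<in> C)"

definition closed_bipartite_induction :: "'a::infinite setfun set \<Rightarrow> bool" where
  "closed_bipartite_induction C \<longleftrightarrow>
     (\<forall>g \<in> C. \<forall>V E c. bipartite_graph V (ground g) E \<and>
        eff_dom (bipartite_induction V E c g) \<noteq> {} \<longrightarrow> bipartite_induction V E c g \<in> C)"

definition closed_network_induction :: "'a::infinite setfun set \<Rightarrow> bool" where
  "closed_network_induction C \<longleftrightarrow>
     (\<forall>g \<in> C. \<forall>T A c V. directed_network T A V (ground g) \<and>
        no_positive_cycle T A c V (ground g) \<and>
        eff_dom (network_induction T A c V g) \<noteq> {} \<longrightarrow> network_induction T A c V g \<in> C)"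

end

theory Submission
  imports Defs "HOL-Library.FuncSet"
begin

text \<open>
  All constructions are reduced to one operation, \<open>induced\<close>.  Given g on U and weights w(x,y) in
  \<open>ereal\<close> without \<open>\<infinity>\<close>, the induced function on V maps X to the largest total weight of an injection
  of X into U plus the value of g at its image.  Weight \<open>-\<infinity>\<close> means that an edge is missing, and V and U
  may overlap.  Relabelling, restriction and principal extension are instances with weights 0 and \<open>-\<infinity>\<close>
  on the diagonal.  Conversely, a complete class is closed under it (\<open>complete_induced\<close>): a fresh copy of V
  is added to U point by point by principal extensions, then U is deleted and the copy is renamed.

  The five closure properties follow.  Contraction is deletion in the dual, and truncation is the
  principal extension with all weights 0 followed by contraction of the new point.  A union is induced
  from the direct sum of disjoint copies.  For a directed network let M be the set of nodes outside V
  and U.  Given a linking of X to Y, every node of X and M chooses its successor; an inner node that is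
  not on a path chooses itself with weight 0, and so does a node that forms a path on its own.  The
  linking thus becomes a bijection from X together with M to Y together with M, so the network induction is the contraction by M of a function induced from
  the direct sum of g and the free matroid on M (\<open>network_induction_eq\<close>).  Such a bijection may also
  contain cycles inside M; they have weight at most 0 and can be dropped (\<open>path_decomposition\<close>).
  A bipartite graph is a network without inner nodes.

  A valuated gammoid is presented by the weights of a bipartite graph with sides V + W and U, where W
  and U may be sets of any types (\<open>gammoid\<close>).  Exchange holds since two perfect matchings can be
  switched along the alternating path that starts at the exchanged element (\<open>matching_exchange\<close>).
  A matching of X + W onto U, read backwards and completed by matching each element of V - X to itself,
  is a matching of (V - X) + U onto V + W, so duals are gammoids again (\<open>dual_gammoid\<close>).
  A function induced from a gammoid is a gammoid, because the old ground set can serve as a layer of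
  inner nodes (\<open>induced_gammoid\<close>); this covers relabelling, restriction and principal extension.
  Direct sums are block matrices of weights (\<open>vunion_gammoid\<close>).

  Minimality holds because every nonempty complete class contains all trivially valuated free
  matroids (\<open>complete_free_vm\<close>) and is closed under the two operations that define gammoids.
\<close>

section \<open>Values of the operations\<close>

text \<open>The exchange axiom and the nonempty domain are left out, so that the identities below also hold for
  results of operations that are \<open>-\<infinity>\<close> everywhere.\<close>

definition setfun_wf :: "'a setfun \<Rightarrow> bool" where
  "setfun_wf f \<longleftrightarrow> finite (ground f) \<and> (\<forall>X. val f X \<noteq> \<infinity>) \<and>
     (\<forall>X. X \<notin> ksubsets (ground f) (rnk f) \<longrightarrow> val f X = -\<infinity>)"

lemma setfun_wfD:
  assumes "setfun_wf f"
  shows "finite (ground f)" "val f X \<noteq> \<infinity>" "val f X \<noteq> -\<infinity> \<Longrightarrow> X \<subseteq> ground f"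
    "val f X \<noteq> -\<infinity> \<Longrightarrow> card X = rnk f"
  using assms unfolding setfun_wf_def ksubsets_def by blast+

lemma eff_dom_iff: "setfun_wf f \<Longrightarrow> X \<in> eff_dom f \<longleftrightarrow> val f X \<noteq> -\<infinity>"
  unfolding eff_dom_def ksubsets_def using setfun_wfD(3,4)[of f X] by auto

lemma valuated_matroid_wf: "valuated_matroid f \<Longrightarrow> setfun_wf f"
  unfolding valuated_matroid_def setfun_wf_def by blast

lemma setfun_eqI:
  assumes "ground f = ground g" "rnk f = rnk g" "\<And>X. val f X = val g X"
  shows "f = g"
  using assms by (intro setfun.expand) auto

lemma setfun_wfI:
  assumes "finite (ground f)" "\<And>X. val f X \<noteq> \<infinity>"
    "\<And>X. val f X \<noteq> -\<infinity> \<Longrightarrow> X \<subseteq> ground f \<and> card X = rnk f"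
  shows "setfun_wf f"
  using assms unfolding setfun_wf_def ksubsets_def by blast

lemma eff_dom_nonempty_iff: "setfun_wf f \<Longrightarrow> eff_dom f \<noteq> {} \<longleftrightarrow> (\<exists>X. val f X \<noteq> -\<infinity>)"
  using eff_dom_iff by blast

lemma rnk_le_card_ground:
  assumes "setfun_wf f" "eff_dom f \<noteq> {}"
  shows "rnk f \<le> card (ground f)"
proof -
  obtain X where "X \<subseteq> ground f" "card X = rnk f" using assms(2) unfolding eff_dom_def ksubsets_def by auto
  then show ?thesis using assms(1) by (metis card_mono setfun_wfD(1))
qed

lemma ground_deletion [simp]: "ground (deletion f Y) = ground f - Y"
  and rnk_deletion [simp]: "rnk (deletion f Y) = rnk f"
  and ground_contraction [simp]: "ground (contraction f Y) = ground f - Y"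
  and rnk_contraction [simp]: "rnk (contraction f Y) = rnk f - card Y"
  and ground_dual [simp]: "ground (dual f) = ground f"
  and rnk_dual [simp]: "rnk (dual f) = card (ground f) - rnk f"
  and ground_truncation [simp]: "ground (truncation f) = ground f"
  and rnk_truncation [simp]: "rnk (truncation f) = rnk f - 1"
  and ground_principal_extension [simp]: "ground (principal_extension f p u) = insert p (ground f)"
  and rnk_principal_extension [simp]: "rnk (principal_extension f p u) = rnk f"
  and ground_vunion [simp]: "ground (vunion f g) = ground f \<union> ground g"
  and rnk_vunion [simp]: "rnk (vunion f g) = rnk f + rnk g"
  and ground_relabel [simp]: "ground (relabel \<phi> f) = \<phi> ` ground f"
  and rnk_relabel [simp]: "rnk (relabel \<phi> f) = rnk f"
  and ground_free_vm [simp]: "ground (free_vm U) = U"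
  and rnk_free_vm [simp]: "rnk (free_vm U) = card U"
  and val_free_vm [simp]: "val (free_vm U) X = (if X = U then 0 else -\<infinity>)"
  by (simp_all add: deletion_def contraction_def dual_def truncation_def principal_extension_def
      vunion_def relabel_def free_vm_def)

text \<open>A set with a value other than \<open>-\<infinity>\<close> is a basis that witnesses full rank, and sets of the wrong
  size have value \<open>-\<infinity>\<close> on both sides.  Contraction, dual and truncation are treated in the same way.\<close>

lemma val_deletion:
  assumes "setfun_wf f"
  shows "val (deletion f Y) X = (if X \<subseteq> ground f - Y then val f X else -\<infinity>)"
proof (cases "val f X = -\<infinity> \<or> \<not> X \<subseteq> ground f - Y")
  case False
  then have "X \<in> eff_dom f" "card X = rnk f"
    using setfun_wfD(4)[OF assms, of X] by (simp_all add: eff_dom_iff[OF assms])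
  with False have "full_rank f (ground f - Y)" "card X = rnk f" unfolding full_rank_def by blast+
  with False show ?thesis by (simp add: deletion_def ksubsets_def)
qed (auto simp: deletion_def ksubsets_def)

lemma val_contraction:
  assumes "setfun_wf f" "Y \<subseteq> ground f"
  shows "val (contraction f Y) X = (if X \<subseteq> ground f - Y then val f (X \<union> Y) else -\<infinity>)"
proof (cases "val f (X \<union> Y) = -\<infinity> \<or> \<not> X \<subseteq> ground f - Y")
  case False
  then have "X \<union> Y \<in> eff_dom f" and card: "card (X \<union> Y) = rnk f"
    using setfun_wfD(4)[OF assms(1), of "X \<union> Y"] by (simp_all add: eff_dom_iff[OF assms(1)])
  then have indep: "indep_set f Y" unfolding indep_set_def by blast
  have "finite X" "finite Y" "X \<inter> Y = {}"
    using False assms(2) setfun_wfD(1)[OF assms(1)] by (auto intro: finite_subset)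
  then have "card X + card Y = rnk f" using card by (simp add: card_Un_disjoint)
  with False indep show ?thesis by (simp add: contraction_def)
qed (auto simp: contraction_def)

lemma val_dual:
  assumes "setfun_wf f" "eff_dom f \<noteq> {}"
  shows "val (dual f) X = (if X \<subseteq> ground f then val f (ground f - X) else -\<infinity>)"
proof (cases "val f (ground f - X) = -\<infinity> \<or> \<not> X \<subseteq> ground f")
  case False
  then have "card (ground f - X) = rnk f" using assms(1) setfun_wfD(4) by blast
  moreover have "finite (ground f)" "finite X"
    using setfun_wfD(1)[OF assms(1)] False by (auto intro: finite_subset)
  then have "card (ground f - X) = card (ground f) - card X" "card X \<le> card (ground f)"
    using False by (auto simp: card_Diff_subset card_mono)
  ultimately have "card X = card (ground f) - rnk f" by linarith
  with False show ?thesis by (simp add: dual_def ksubsets_def)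
qed (auto simp: dual_def ksubsets_def)

lemma val_truncation:
  assumes "setfun_wf f"
  shows "val (truncation f) X = (if X \<subseteq> ground f then SUP v\<in>ground f - X. val f (insert v X) else -\<infinity>)"
proof (cases "X \<subseteq> ground f \<and> card X + 1 \<noteq> rnk f")
  case True
  then have "finite X" using setfun_wfD(1)[OF assms] by (auto intro: finite_subset)
  then have "val f (insert v X) = -\<infinity>" if "v \<in> ground f - X" for v
    using that True setfun_wfD(4)[OF assms, of "insert v X"] by auto
  then have "(SUP v\<in>ground f - X. val f (insert v X)) \<le> -\<infinity>" by (intro SUP_least) simp
  then show ?thesis using True by (simp add: truncation_def)
qed (auto simp: truncation_def)

lemma wf_deletion: "setfun_wf f \<Longrightarrow> setfun_wf (deletion f Y)"
  by (rule setfun_wfI) (auto simp: val_deletion setfun_wfD split: if_splits)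

lemma wf_contraction:
  assumes "setfun_wf f" "Y \<subseteq> ground f"
  shows "setfun_wf (contraction f Y)"
proof (rule setfun_wfI)
  fix X assume "val (contraction f Y) X \<noteq> -\<infinity>"
  then show "X \<subseteq> ground (contraction f Y) \<and> card X = rnk (contraction f Y)"
    by (auto simp: contraction_def split: if_splits)
qed (use assms in \<open>auto simp: val_contraction setfun_wfD\<close>)

lemma wf_dual: "setfun_wf f \<Longrightarrow> setfun_wf (dual f)"
  by (auto simp: setfun_wf_def dual_def)

lemma wf_free_vm: "finite U \<Longrightarrow> setfun_wf (free_vm U)"
  by (auto simp: setfun_wf_def free_vm_def ksubsets_def)

section \<open>Induction by injections of maximum weight\<close>

definition max_induced :: "('b \<Rightarrow> 'a \<Rightarrow> ereal) \<Rightarrow> 'a setfun \<Rightarrow> 'b set \<Rightarrow> ereal" where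
  "max_induced w g A =
     (SUP \<sigma>\<in>{\<sigma>. inj_on \<sigma> A \<and> \<sigma> ` A \<subseteq> ground g}. (\<Sum>x\<in>A. w x (\<sigma> x)) + val g (\<sigma> ` A))"

definition induced :: "'b set \<Rightarrow> ('b \<Rightarrow> 'a \<Rightarrow> ereal) \<Rightarrow> 'a setfun \<Rightarrow> 'b setfun" where
  "induced V w g = Setfun V (rnk g) (\<lambda>X. if X \<subseteq> V then max_induced w g X else -\<infinity>)"

lemma ground_induced [simp]: "ground (induced V w g) = V"
  and rnk_induced [simp]: "rnk (induced V w g) = rnk g"
  and val_induced: "val (induced V w g) X = (if X \<subseteq> V then max_induced w g X else -\<infinity>)"
  by (simp_all add: induced_def)

text \<open>In \<open>ereal\<close> the sum of \<open>-\<infinity>\<close> and \<open>\<infinity>\<close> is \<open>\<infinity>\<close>; this is why all weights are required to be less than \<open>\<infinity>\<close>.\<close>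

lemma add_MInf_le:
  fixes a b :: ereal
  assumes "a = -\<infinity> \<or> b = -\<infinity>" "a \<noteq> \<infinity>" "b \<noteq> \<infinity>"
  shows "a + b \<le> K"
  using assms by (cases a; cases b) auto

lemma sum_not_PInf:
  fixes h :: "'b \<Rightarrow> ereal"
  assumes "\<And>x. x \<in> A \<Longrightarrow> h x \<noteq> \<infinity>"
  shows "sum h A \<noteq> \<infinity>"
  using assms by (simp add: sum_Pinfty)

lemma sum_not_MInf:
  fixes h :: "'b \<Rightarrow> ereal"
  assumes "\<And>x. x \<in> A \<Longrightarrow> h x \<noteq> \<infinity>" "finite A" "sum h A \<noteq> -\<infinity>" "x \<in> A"
  shows "h x \<noteq> -\<infinity>"
proof
  assume "h x = -\<infinity>"
  moreover have "sum h (A - {x}) \<noteq> \<infinity>" using assms(1) by (intro sum_not_PInf) auto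
  ultimately have "sum h A = -\<infinity>" using assms(2,4) by (simp add: sum.remove)
  then show False using assms(3) by simp
qed

lemma max_induced_ge:
  assumes "inj_on \<sigma> A" "\<sigma> ` A \<subseteq> ground g"
  shows "(\<Sum>x\<in>A. w x (\<sigma> x)) + val g (\<sigma> ` A) \<le> max_induced w g A"
  unfolding max_induced_def using assms by (intro SUP_upper) auto

text \<open>Only injections whose total is not \<open>-\<infinity>\<close> have to be bounded, that is, those that use actual edges and
  whose image lies in the effective domain of g.\<close>

lemma max_induced_le:
  assumes "setfun_wf g" "finite A" "\<And>x y. x \<in> A \<Longrightarrow> y \<in> ground g \<Longrightarrow> w x y \<noteq> \<infinity>"
    and le: "\<And>\<sigma>. inj_on \<sigma> A \<Longrightarrow> \<sigma> ` A \<subseteq> ground g \<Longrightarrow> (\<And>x. x \<in> A \<Longrightarrow> w x (\<sigma> x) \<noteq> -\<infinity>) \<Longrightarrow>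
        val g (\<sigma> ` A) \<noteq> -\<infinity> \<Longrightarrow> (\<Sum>x\<in>A. w x (\<sigma> x)) + val g (\<sigma> ` A) \<le> K"
  shows "max_induced w g A \<le> K"
  unfolding max_induced_def
proof (rule SUP_least)
  fix \<sigma> assume \<sigma>: "\<sigma> \<in> {\<sigma>. inj_on \<sigma> A \<and> \<sigma> ` A \<subseteq> ground g}"
  have fin: "w x (\<sigma> x) \<noteq> \<infinity>" if "x \<in> A" for x using assms(3) that \<sigma> by auto
  have v: "val g (\<sigma> ` A) \<noteq> \<infinity>" using assms(1) by (rule setfun_wfD)
  show "(\<Sum>x\<in>A. w x (\<sigma> x)) + val g (\<sigma> ` A) \<le> K"
  proof (cases "val g (\<sigma> ` A) = -\<infinity> \<or> (\<Sum>x\<in>A. w x (\<sigma> x)) = -\<infinity>")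
    case True
    have "(\<Sum>x\<in>A. w x (\<sigma> x)) \<noteq> \<infinity>" using fin by (rule sum_not_PInf)
    with True v show ?thesis by (intro add_MInf_le) auto
  next
    case False
    then have "w x (\<sigma> x) \<noteq> -\<infinity>" if "x \<in> A" for x
      using sum_not_MInf[of A "\<lambda>x. w x (\<sigma> x)" x, OF fin assms(2)] that by blast
    then show ?thesis using \<sigma> False by (intro le) auto
  qed
qed

text \<open>An injection matters only through its restriction to A, so the supremum is a maximum over a finite set.\<close>

lemma max_induced_attained:
  assumes "setfun_wf g" "finite A" "\<And>x y. x \<in> A \<Longrightarrow> y \<in> ground g \<Longrightarrow> w x y \<noteq> \<infinity>"
    and "max_induced w g A \<noteq> -\<infinity>"
  obtains \<sigma> where "inj_on \<sigma> A" "\<sigma> ` A \<subseteq> ground g" "\<And>x. x \<in> A \<Longrightarrow> w x (\<sigma> x) \<noteq> -\<infinity>"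
    "val g (\<sigma> ` A) \<noteq> -\<infinity>" "max_induced w g A = (\<Sum>x\<in>A. w x (\<sigma> x)) + val g (\<sigma> ` A)"
proof -
  define F where "F \<sigma> = (\<Sum>x\<in>A. w x (\<sigma> x)) + val g (\<sigma> ` A)" for \<sigma>
  define S where "S = {\<sigma>. inj_on \<sigma> A \<and> \<sigma> ` A \<subseteq> ground g}"
  have "F ` S \<subseteq> F ` (A \<rightarrow>\<^sub>E ground g)"
  proof
    fix r assume "r \<in> F ` S"
    then obtain \<sigma> where \<sigma>: "\<sigma> \<in> S" "r = F \<sigma>" by blast
    have "(\<lambda>x. if x \<in> A then \<sigma> x else undefined) ` A = \<sigma> ` A" by auto
    then have "F (restrict \<sigma> A) = F \<sigma>" unfolding F_def restrict_def by (simp cong: sum.cong)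
    moreover have "restrict \<sigma> A \<in> A \<rightarrow>\<^sub>E ground g" using \<sigma> unfolding S_def by auto
    ultimately show "r \<in> F ` (A \<rightarrow>\<^sub>E ground g)" using \<sigma>(2) by (metis image_eqI)
  qed
  moreover have "finite (A \<rightarrow>\<^sub>E ground g)" using assms(1,2) by (intro finite_PiE) (auto dest: setfun_wfD(1))
  ultimately have finS: "finite (F ` S)" using finite_subset by blast
  have max: "max_induced w g A = Sup (F ` S)" unfolding max_induced_def F_def S_def by simp
  then have ne: "F ` S \<noteq> {}" using assms(4) by (metis Sup_empty bot_ereal_def)
  have "Sup (F ` S) \<in> F ` S" using finS ne by (metis Max_Sup Max_in)
  then obtain \<sigma> where \<sigma>: "\<sigma> \<in> S" "max_induced w g A = F \<sigma>" using max by auto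
  have fin: "w x (\<sigma> x) \<noteq> \<infinity>" if "x \<in> A" for x using assms(3) that \<sigma> unfolding S_def by auto
  have "(\<Sum>x\<in>A. w x (\<sigma> x)) \<noteq> \<infinity>" using fin by (rule sum_not_PInf)
  moreover have "val g (\<sigma> ` A) \<noteq> \<infinity>" using assms(1) by (rule setfun_wfD)
  ultimately have "(\<Sum>x\<in>A. w x (\<sigma> x)) \<noteq> -\<infinity>" "val g (\<sigma> ` A) \<noteq> -\<infinity>"
    using assms(4) \<sigma>(2) unfolding F_def by auto
  moreover have "w x (\<sigma> x) \<noteq> -\<infinity>" if "x \<in> A" for x
    using sum_not_MInf[of A "\<lambda>x. w x (\<sigma> x)" x, OF fin assms(2)] that calculation(1) by blast
  ultimately show ?thesis using that \<sigma> unfolding S_def F_def by blast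
qed

lemma max_induced_cong:
  assumes "\<And>x y. x \<in> A \<Longrightarrow> y \<in> ground g \<Longrightarrow> w x y = w' x y"
  shows "max_induced w g A = max_induced w' g A"
  unfolding max_induced_def
  by (rule SUP_cong) (use assms in \<open>auto simp: image_subset_iff intro!: arg_cong2[where f="(+)"] sum.cong\<close>)

lemma induced_cong:
  assumes "\<And>x y. x \<in> V \<Longrightarrow> y \<in> ground g \<Longrightarrow> w x y = w' x y"
  shows "induced V w g = induced V w' g"
  using assms by (intro setfun_eqI) (auto simp: val_induced intro!: max_induced_cong)

lemma wf_induced:
  assumes "setfun_wf g" "finite V" "\<And>x y. x \<in> V \<Longrightarrow> y \<in> ground g \<Longrightarrow> w x y \<noteq> \<infinity>"
  shows "setfun_wf (induced V w g)"
proof -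
  have "max_induced w g X \<noteq> \<infinity> \<and> card X = rnk g" if X: "X \<subseteq> V" "max_induced w g X \<noteq> -\<infinity>" for X
  proof -
    have "finite X" using X(1) assms(2) by (rule finite_subset)
    moreover have fin: "w x y \<noteq> \<infinity>" if "x \<in> X" "y \<in> ground g" for x y using assms(3) that X(1) by blast
    ultimately obtain \<sigma> where \<sigma>: "inj_on \<sigma> X" "\<sigma> ` X \<subseteq> ground g" "val g (\<sigma> ` X) \<noteq> -\<infinity>"
       "max_induced w g X = (\<Sum>x\<in>X. w x (\<sigma> x)) + val g (\<sigma> ` X)"
      using max_induced_attained[OF assms(1) _ _ X(2)] by metis
    have "(\<Sum>x\<in>X. w x (\<sigma> x)) \<noteq> \<infinity>" using fin \<sigma>(2) by (intro sum_not_PInf) auto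
    moreover have "val g (\<sigma> ` X) \<noteq> \<infinity>" using assms(1) by (rule setfun_wfD)
    moreover have "card X = rnk g" using card_image[OF \<sigma>(1)] setfun_wfD(4)[OF assms(1) \<sigma>(3)] by simp
    ultimately show ?thesis using \<sigma>(4) by simp
  qed
  then have "max_induced w g X \<noteq> \<infinity>" "card X \<noteq> rnk g \<Longrightarrow> max_induced w g X = -\<infinity>" if "X \<subseteq> V" for X
    using that by (metis MInfty_neq_PInfty(1), blast)
  then show ?thesis using assms(2) unfolding setfun_wf_def ksubsets_def by (auto simp: val_induced)
qed

text \<open>The edge weights of the identity matching.\<close>

definition diag :: "'a \<Rightarrow> 'a \<Rightarrow> ereal" where
  "diag x y = (if x = y then 0 else -\<infinity>)"

lemma diag_not_PInf [simp]: "diag x y \<noteq> \<infinity>"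
  and diag_eq_MInf [simp]: "diag x y = -\<infinity> \<longleftrightarrow> x \<noteq> y"
  and diag_same [simp]: "diag x x = 0"
  by (simp_all add: diag_def)

lemma induced_diag:
  assumes "setfun_wf f"
  shows "induced (ground f) diag f = f"
proof (rule setfun_eqI)
  fix X
  show "val (induced (ground f) diag f) X = val f X"
  proof (cases "X \<subseteq> ground f")
    case True
    have "max_induced diag f X \<le> val f X"
    proof (rule max_induced_le[OF assms])
      show "finite X" using True assms by (meson finite_subset setfun_wfD(1))
      fix \<sigma> :: "'a \<Rightarrow> 'a" assume "\<And>x. x \<in> X \<Longrightarrow> diag x (\<sigma> x) \<noteq> -\<infinity>"
      then have "\<And>x. x \<in> X \<Longrightarrow> \<sigma> x = x" by (metis diag_eq_MInf)
      then show "(\<Sum>x\<in>X. diag x (\<sigma> x)) + val f (\<sigma> ` X) \<le> val f X" by simp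
    qed simp
    moreover have "val f X \<le> max_induced diag f X"
      using max_induced_ge[of "\<lambda>x. x" X f diag] True by simp
    ultimately show ?thesis using True by (simp add: val_induced)
  next
    case False
    then show ?thesis using assms by (metis setfun_wfD(3) val_induced)
  qed
qed simp_all

lemma deletion_induced:
  assumes "setfun_wf (induced V w g)"
  shows "deletion (induced V w g) Y = induced (V - Y) w g"
  by (rule setfun_eqI) (auto simp: val_deletion[OF assms] val_induced)

lemma relabel_induced:
  assumes "inj_on \<phi> V" "\<And>x y. x \<in> V \<Longrightarrow> y \<in> ground g \<Longrightarrow> w' x y = w (\<phi> x) y"
  shows "relabel \<phi> (induced V w' g) = induced (\<phi> ` V) w g"
proof (rule setfun_eqI)
  fix Z
  show "val (relabel \<phi> (induced V w' g)) Z = val (induced (\<phi> ` V) w g) Z"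
  proof (cases "Z \<subseteq> \<phi> ` V")
    case True
    define X where "X = {v \<in> V. \<phi> v \<in> Z}"
    have X: "X \<subseteq> V" "\<phi> ` X = Z" "inj_on \<phi> X" using True assms(1) unfolding X_def by (auto intro: inj_on_subset)
    have inv: "the_inv_into X \<phi> ` Z = X" using X(2,3) by (metis the_inv_into_onto)
    have "max_induced w' g X = max_induced w g Z"
    proof (rule antisym)
      show "max_induced w' g X \<le> max_induced w g Z" unfolding max_induced_def[of w']
      proof (rule SUP_least, clarify)
        fix \<sigma> assume \<sigma>: "inj_on \<sigma> X" "\<sigma> ` X \<subseteq> ground g"
        define \<tau> where "\<tau> = \<sigma> \<circ> the_inv_into X \<phi>"
        have im: "\<tau> ` Z = \<sigma> ` X" unfolding \<tau>_def image_comp[symmetric] inv ..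
        have "inj_on \<tau> Z" unfolding \<tau>_def using X \<sigma>(1) inv inj_on_the_inv_into[OF X(3)]
          by (auto intro!: comp_inj_on)
        moreover have "(\<Sum>z\<in>Z. w z (\<tau> z)) = (\<Sum>x\<in>X. w' x (\<sigma> x))"
          unfolding X(2)[symmetric] sum.reindex[OF X(3)] \<tau>_def
          using X(1,3) \<sigma>(2) by (intro sum.cong) (auto simp: the_inv_into_f_f image_subset_iff assms(2) subset_iff)
        ultimately show "(\<Sum>x\<in>X. w' x (\<sigma> x)) + val g (\<sigma> ` X) \<le> max_induced w g Z"
          using max_induced_ge[of \<tau> Z g w] \<sigma>(2) by (simp add: im)
      qed
      show "max_induced w g Z \<le> max_induced w' g X" unfolding max_induced_def[of w]
      proof (rule SUP_least, clarify)
        fix \<tau> assume \<tau>: "inj_on \<tau> Z" "\<tau> ` Z \<subseteq> ground g"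
        have im: "(\<lambda>x. \<tau> (\<phi> x)) ` X = \<tau> ` Z" using X(2) by auto
        have "inj_on (\<lambda>x. \<tau> (\<phi> x)) X" using comp_inj_on[OF X(3), of \<tau>] X(2) \<tau>(1) by (simp add: comp_def)
        moreover have "(\<Sum>z\<in>Z. w z (\<tau> z)) = (\<Sum>x\<in>X. w' x (\<tau> (\<phi> x)))"
          unfolding X(2)[symmetric] sum.reindex[OF X(3)]
          using X(1) \<tau>(2) unfolding X(2)[symmetric]
          by (intro sum.cong) (auto simp: image_subset_iff assms(2) subset_iff)
        ultimately show "(\<Sum>z\<in>Z. w z (\<tau> z)) + val g (\<tau> ` Z) \<le> max_induced w' g X"
          using max_induced_ge[of "\<lambda>x. \<tau> (\<phi> x)" X g w'] \<tau>(2) by (simp add: im)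
      qed
    qed
    then show ?thesis using True X(1) unfolding X_def by (simp add: relabel_def val_induced)
  next
    case False
    then show ?thesis by (simp add: relabel_def val_induced)
  qed
qed (simp_all add: relabel_def)

text \<open>The elements of ground g can be matched only to themselves.  So if p is matched to v, then v does not
  lie in the rest X of the set: otherwise v would be used twice.  Replacing the edge from p to v by the
  edge from v to itself therefore translates injections of X + p into injections of X + v, and this is
  reversible.\<close>

lemma principal_extension_induced:
  assumes g: "setfun_wf g" and V: "finite V" "ground g \<subseteq> V" "p \<notin> V"
    and diag: "\<And>x y. x \<in> ground g \<Longrightarrow> y \<in> ground g \<Longrightarrow> w x y = diag x y"
    and fin: "\<And>x y. w x y \<noteq> \<infinity>"
  shows "principal_extension (induced V w g) p (\<lambda>v. if v \<in> ground g then w p v else -\<infinity>)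
         = induced (insert p V) w g" (is "?L = ?R")
proof (rule setfun_eqI)
  have wfV: "setfun_wf (induced V w g)" and wf: "setfun_wf ?R"
    using g V(1) fin by (auto intro: wf_induced)
  fix Z
  consider "Z \<notin> ksubsets (insert p V) (rnk g)" | "p \<notin> Z" "Z \<in> ksubsets (insert p V) (rnk g)"
    | "p \<in> Z" "Z \<in> ksubsets (insert p V) (rnk g)" by blast
  then show "val ?L Z = val ?R Z"
  proof cases
    case 1
    then have "val ?R Z = -\<infinity>" using wf unfolding setfun_wf_def by simp
    then show ?thesis using 1 by (simp add: principal_extension_def)
  next
    case 2
    then have "Z \<subseteq> V" unfolding ksubsets_def by auto
    then show ?thesis using 2 by (auto simp: principal_extension_def val_induced)
  next
    case 3
    define X where "X = Z - {p}"
    have X: "X \<subseteq> V" "p \<notin> X" "Z = insert p X" "finite X"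
      using 3 V(1) unfolding X_def ksubsets_def by (auto intro: finite_subset)
    let ?w = "\<lambda>v. if v \<in> ground g then w p v else -\<infinity>"
    have L: "val ?L Z = (SUP v\<in>V - X. val (induced V w g) (insert v X) + ?w v)"
      using 3 unfolding X_def by (simp add: principal_extension_def)
    have "(SUP v\<in>V - X. val (induced V w g) (insert v X) + ?w v) \<le> max_induced w g Z"
    proof (rule SUP_least)
      fix v assume v: "v \<in> V - X"
      have nP: "val (induced V w g) (insert v X) \<noteq> \<infinity>" using wfV by (rule setfun_wfD)
      show "val (induced V w g) (insert v X) + ?w v \<le> max_induced w g Z"
      proof (cases "v \<in> ground g \<and> max_induced w g (insert v X) \<noteq> -\<infinity>")
        case False
        then have "val (induced V w g) (insert v X) = -\<infinity> \<or> ?w v = -\<infinity>" by (auto simp: val_induced)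
        then show ?thesis using nP fin by (intro add_MInf_le) auto
      next
        case True
        then obtain \<sigma> where \<sigma>: "inj_on \<sigma> (insert v X)" "\<sigma> ` insert v X \<subseteq> ground g"
            "\<And>x. x \<in> insert v X \<Longrightarrow> w x (\<sigma> x) \<noteq> -\<infinity>" "val g (\<sigma> ` insert v X) \<noteq> -\<infinity>"
            "max_induced w g (insert v X) = (\<Sum>x\<in>insert v X. w x (\<sigma> x)) + val g (\<sigma> ` insert v X)"
          using X(4) fin True max_induced_attained[OF g, of "insert v X" w thesis]
          by (auto simp del: image_insert)
        have "\<sigma> v \<in> ground g" "w v (\<sigma> v) \<noteq> -\<infinity>" using \<sigma>(2,3) by auto
        then have sv: "\<sigma> v = v" "w v (\<sigma> v) = 0" using diag[of v "\<sigma> v"] True by (auto simp: diag_def split: if_splits)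
        define \<tau> where "\<tau> = \<sigma>(p := v)"
        have agree: "\<tau> x = \<sigma> x" if "x \<in> X" for x using that X(2) unfolding \<tau>_def by auto
        have imX: "\<tau> ` X = \<sigma> ` X" using agree by (rule image_cong[OF refl])
        then have im: "\<tau> ` Z = \<sigma> ` insert v X" unfolding X(3) image_insert using sv(1) by (simp add: \<tau>_def)
        have "inj_on \<sigma> X" "v \<notin> \<sigma> ` X" using \<sigma>(1) sv(1) v by (auto simp: inj_on_insert)
        then have "inj_on \<tau> Z" using inj_on_cong[of X \<tau> \<sigma>, OF agree] X(2) imX
          unfolding X(3) inj_on_insert by (simp add: \<tau>_def)
        then have "(\<Sum>x\<in>Z. w x (\<tau> x)) + val g (\<tau> ` Z) \<le> max_induced w g Z"
          using \<sigma>(2) im by (intro max_induced_ge) auto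
        moreover have "(\<Sum>x\<in>X. w x (\<tau> x)) = (\<Sum>x\<in>X. w x (\<sigma> x))"
          using agree by (intro sum.cong) auto
        then have "(\<Sum>x\<in>Z. w x (\<tau> x)) = w p v + (\<Sum>x\<in>X. w x (\<sigma> x))"
          using X(2-4) by (simp add: \<tau>_def)
        moreover have "(\<Sum>x\<in>insert v X. w x (\<sigma> x)) = (\<Sum>x\<in>X. w x (\<sigma> x))" using sv v X(4) by simp
        ultimately show ?thesis using True \<sigma>(5) im v X(1) by (simp add: val_induced ac_simps)
      qed
    qed
    moreover have "max_induced w g Z \<le> (SUP v\<in>V - X. val (induced V w g) (insert v X) + ?w v)"
    proof (rule max_induced_le[OF g])
      fix \<sigma> assume \<sigma>: "inj_on \<sigma> Z" "\<sigma> ` Z \<subseteq> ground g" "\<And>x. x \<in> Z \<Longrightarrow> w x (\<sigma> x) \<noteq> -\<infinity>"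
        "val g (\<sigma> ` Z) \<noteq> -\<infinity>"
      define v where "v = \<sigma> p"
      have v: "v \<in> ground g" "v \<in> V" using \<sigma>(2) V(2) X(3) unfolding v_def by auto
      have vX: "v \<notin> X"
      proof
        assume "v \<in> X"
        then have "\<sigma> v \<in> ground g" "w v (\<sigma> v) \<noteq> -\<infinity>" using \<sigma> X(3) by auto
        then have "\<sigma> v = \<sigma> p" using diag[of v "\<sigma> v"] v by (auto simp: v_def)
        then show False using \<sigma>(1) \<open>v \<in> X\<close> X(2,3) by (metis inj_onD insertCI)
      qed
      define \<tau> where "\<tau> = \<sigma>(v := v)"
      have agree: "\<tau> x = \<sigma> x" if "x \<in> X" for x using that vX unfolding \<tau>_def by auto
      have imX: "\<tau> ` X = \<sigma> ` X" using agree by (rule image_cong[OF refl])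
      then have im: "\<tau> ` insert v X = \<sigma> ` Z" unfolding X(3) image_insert by (simp add: \<tau>_def v_def)
      have "inj_on \<sigma> X" "v \<notin> \<sigma> ` X" using \<sigma>(1) X(2) unfolding X(3) inj_on_insert by (auto simp: v_def)
      then have "inj_on \<tau> (insert v X)" using inj_on_cong[of X \<tau> \<sigma>, OF agree] vX imX
        unfolding inj_on_insert by (simp add: \<tau>_def)
      then have "(\<Sum>x\<in>insert v X. w x (\<tau> x)) + val g (\<tau> ` insert v X) \<le> max_induced w g (insert v X)"
        using \<sigma>(2) im by (intro max_induced_ge) auto
      moreover have "(\<Sum>x\<in>X. w x (\<tau> x)) = (\<Sum>x\<in>X. w x (\<sigma> x))"
        using agree by (intro sum.cong) auto
      then have "(\<Sum>x\<in>insert v X. w x (\<tau> x)) = (\<Sum>x\<in>X. w x (\<sigma> x))"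
        using vX X(4) v diag[of v v] by (simp add: \<tau>_def)
      moreover have "(\<Sum>x\<in>Z. w x (\<sigma> x)) = (\<Sum>x\<in>X. w x (\<sigma> x)) + w p v"
        using X(2-4) by (simp add: v_def ac_simps)
      ultimately have "(\<Sum>x\<in>Z. w x (\<sigma> x)) + val g (\<sigma> ` Z) \<le> max_induced w g (insert v X) + w p v"
        using im add_left_mono[of "val g (\<sigma> ` Z) + (\<Sum>x\<in>X. w x (\<sigma> x))" "max_induced w g (insert v X)" "w p v"]
        by (simp add: ac_simps)
      also have "\<dots> = val (induced V w g) (insert v X) + ?w v" using v X(1) by (simp add: val_induced)
      also have "\<dots> \<le> (SUP v\<in>V - X. val (induced V w g) (insert v X) + ?w v)"
        using v vX by (intro SUP_upper) auto
      finally show "(\<Sum>x\<in>Z. w x (\<sigma> x)) + val g (\<sigma> ` Z) \<le> (SUP v\<in>V - X. val (induced V w g) (insert v X) + ?w v)" .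
    qed (use X fin in auto)
    moreover have "Z \<subseteq> insert p V" using X by auto
    ultimately show ?thesis using L by (simp add: val_induced)
  qed
qed (simp_all add: principal_extension_def)

lemma relabel_eq_induced:
  assumes "setfun_wf f" "inj_on \<phi> (ground f)"
  shows "relabel \<phi> f = induced (\<phi> ` ground f) (\<lambda>x y. diag x (\<phi> y)) f"
proof -
  have "relabel \<phi> (induced (ground f) diag f) = induced (\<phi> ` ground f) (\<lambda>x y. diag x (\<phi> y)) f"
    using assms(2) by (intro relabel_induced) (auto simp: diag_def inj_on_eq_iff)
  then show ?thesis by (simp add: induced_diag[OF assms(1)])
qed

lemma deletion_eq_induced:
  assumes "setfun_wf f"
  shows "deletion f Y = induced (ground f - Y) diag f"
  using deletion_induced[of "ground f" diag f Y] assms by (simp add: induced_diag)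

text \<open>Outside the ground set w may take the value \<open>\<infinity>\<close>, so the weights there are replaced by \<open>-\<infinity>\<close>.\<close>

lemma principal_extension_eq_induced:
  assumes "setfun_wf f" "p \<notin> ground f" "\<And>v. v \<in> ground f \<Longrightarrow> w v \<noteq> \<infinity>"
  shows "principal_extension f p w =
         induced (insert p (ground f)) (\<lambda>x y. if x = p then if y \<in> ground f then w y else -\<infinity> else diag x y) f"
    (is "_ = induced _ ?w _")
proof -
  have "induced (ground f) ?w f = f"
    using assms(1,2) by (subst induced_cong[where w'=diag]) (auto simp: induced_diag)
  moreover have "principal_extension f p w =
      principal_extension f p (\<lambda>v. if v \<in> ground f then ?w p v else -\<infinity>)"
    unfolding principal_extension_def by (auto intro!: ext SUP_cong)
  moreover have "principal_extension (induced (ground f) ?w f) p (\<lambda>v. if v \<in> ground f then ?w p v else -\<infinity>)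
      = induced (insert p (ground f)) ?w f"
    using assms by (intro principal_extension_induced) (auto simp: setfun_wfD(1))
  ultimately show ?thesis by simp
qed

section \<open>Operations inside a complete class\<close>

lemma ex_fresh_injection:
  fixes F :: "'a::infinite set"
  assumes "finite S" "finite F"
  obtains \<psi> where "inj_on \<psi> S" "\<psi> ` S \<inter> F = {}"
proof -
  have "infinite (UNIV - F)" using assms(2) infinite_UNIV by (simp add: Diff_infinite_finite)
  then obtain T where T: "T \<subseteq> UNIV - F" "finite T" "card T = card S"
    using infinite_arbitrarily_large by metis
  then obtain \<psi> where "bij_betw \<psi> S T" using assms(1) finite_same_card_bij by metis
  then have "inj_on \<psi> S" "\<psi> ` S \<inter> F = {}" using T(1) unfolding bij_betw_def by auto
  then show ?thesis by (rule that)
qed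

lemma complete_valuated_matroid: "complete_class C \<Longrightarrow> f \<in> C \<Longrightarrow> valuated_matroid f"
  unfolding complete_class_def vm_class_def by blast

lemma complete_wf: "complete_class C \<Longrightarrow> f \<in> C \<Longrightarrow> setfun_wf f"
  by (rule valuated_matroid_wf[OF complete_valuated_matroid])

lemma complete_eff_dom: "complete_class C \<Longrightarrow> f \<in> C \<Longrightarrow> eff_dom f \<noteq> {}"
  using complete_valuated_matroid unfolding valuated_matroid_def by blast

lemma complete_relabel:
  "complete_class C \<Longrightarrow> f \<in> C \<Longrightarrow> inj_on \<phi> (ground f) \<Longrightarrow> relabel \<phi> f \<in> C"
  unfolding complete_class_def vm_class_def by blast

lemma complete_deletion:
  "complete_class C \<Longrightarrow> f \<in> C \<Longrightarrow> Y \<subseteq> ground f \<Longrightarrow> eff_dom (deletion f Y) \<noteq> {} \<Longrightarrow> deletion f Y \<in> C"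
  unfolding complete_class_def closed_restriction_def by blast

lemma complete_direct_sum:
  "complete_class C \<Longrightarrow> f \<in> C \<Longrightarrow> g \<in> C \<Longrightarrow> ground f \<inter> ground g = {} \<Longrightarrow>
      eff_dom (vunion f g) \<noteq> {} \<Longrightarrow> vunion f g \<in> C"
  unfolding complete_class_def closed_direct_sum_def by blast

lemma complete_dual:
  assumes "complete_class C" "f \<in> C"
  shows "dual f \<in> C"
proof -
  have wf: "setfun_wf f" and "eff_dom f \<noteq> {}" using assms by (simp_all add: complete_wf complete_eff_dom)
  then obtain X where X: "X \<subseteq> ground f" "val f X \<noteq> -\<infinity>" by (metis eff_dom_nonempty_iff setfun_wfD(3))
  then have "val (dual f) (ground f - X) \<noteq> -\<infinity>"
    by (simp add: val_dual[OF wf \<open>eff_dom f \<noteq> {}\<close>] double_diff)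
  then have "eff_dom (dual f) \<noteq> {}" using eff_dom_nonempty_iff[OF wf_dual[OF wf]] by blast
  then show ?thesis using assms unfolding complete_class_def closed_dual_def by blast
qed

lemma complete_principal_extension:
  assumes "complete_class C" "f \<in> C" "p \<notin> ground f" "\<And>v. v \<in> ground f \<Longrightarrow> u v \<noteq> \<infinity>"
  shows "principal_extension f p u \<in> C"
proof -
  obtain X where "X \<in> eff_dom f" using complete_eff_dom[OF assms(1,2)] by blast
  then have "X \<in> eff_dom (principal_extension f p u)"
    using assms(3) by (auto simp: eff_dom_def ksubsets_def principal_extension_def)
  then have "eff_dom (principal_extension f p u) \<noteq> {}" by blast
  then show ?thesis
    using assms unfolding complete_class_def closed_principal_extension_def by blast
qed

text \<open>A set X avoiding Y has complement V - Y - X in the ground set V - Y, and the complement of that set in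
  V is the union of X and Y.\<close>

lemma contraction_eq_dual_deletion_dual:
  assumes wf: "setfun_wf f" and Y: "Y \<subseteq> ground f" and ne: "eff_dom (contraction f Y) \<noteq> {}"
  shows "eff_dom (deletion (dual f) Y) \<noteq> {}" "contraction f Y = dual (deletion (dual f) Y)"
proof -
  obtain X where X: "X \<subseteq> ground f - Y" "val f (X \<union> Y) \<noteq> -\<infinity>"
    using ne eff_dom_nonempty_iff[OF wf_contraction[OF wf Y]] by (auto simp: val_contraction[OF wf Y] split: if_splits)
  then have nf: "eff_dom f \<noteq> {}" using eff_dom_nonempty_iff[OF wf] by blast
  note wfd = wf_dual[OF wf]
  have co: "ground f - (ground f - Y - Z) = Z \<union> Y" if "Z \<subseteq> ground f - Y" for Z using that Y by blast
  have "val (deletion (dual f) Y) (ground f - Y - X) \<noteq> -\<infinity>"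
    using X by (auto simp: val_deletion[OF wfd] val_dual[OF wf nf] co)
  then show ne': "eff_dom (deletion (dual f) Y) \<noteq> {}"
    using eff_dom_nonempty_iff[OF wf_deletion[OF wfd]] by blast
  have fin: "finite (ground f)" "finite Y" using setfun_wfD(1)[OF wf] Y by (auto intro: finite_subset)
  have "card (X \<union> Y) = rnk f" using setfun_wfD(4)[OF wf X(2)] .
  then have "card Y \<le> rnk f" using fin X(1) by (metis Un_upper2 card_mono finite_Diff finite_UnI finite_subset)
  then have "rnk (contraction f Y) = rnk (dual (deletion (dual f) Y))"
    using rnk_le_card_ground[OF wf nf] Y fin by (simp add: card_Diff_subset card_mono)
  then show "contraction f Y = dual (deletion (dual f) Y)"
    by (intro setfun_eqI)
      (auto simp: val_contraction[OF wf Y] val_dual[OF wf_deletion[OF wfd] ne'] val_deletion[OF wfd] val_dual[OF wf nf] co)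
qed

lemma complete_contraction:
  assumes "complete_class C" "f \<in> C" "Y \<subseteq> ground f" "eff_dom (contraction f Y) \<noteq> {}"
  shows "contraction f Y \<in> C"
proof -
  note eq = contraction_eq_dual_deletion_dual[OF complete_wf[OF assms(1,2)] assms(3,4)]
  have "deletion (dual f) Y \<in> C"
    using assms(1,2,3) complete_dual eq(1) by (intro complete_deletion) auto
  then show ?thesis unfolding eq(2) by (rule complete_dual[OF assms(1)])
qed

lemma wf_principal_extension:
  assumes "setfun_wf f" "p \<notin> ground f" "\<And>v. v \<in> ground f \<Longrightarrow> u v \<noteq> \<infinity>"
  shows "setfun_wf (principal_extension f p u)"
  using assms principal_extension_eq_induced[of f p u]
  by (auto simp: setfun_wfD(1) intro!: wf_induced split: if_splits)

lemma truncation_eq_contraction: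
  assumes wf: "setfun_wf f" and p: "p \<notin> ground f"
  shows "truncation f = contraction (principal_extension f p (\<lambda>_. 0)) {p}" (is "_ = contraction ?h _")
proof (rule setfun_eqI)
  have wfh: "setfun_wf ?h" using assms by (intro wf_principal_extension) auto
  fix X
  show "val (truncation f) X = val (contraction ?h {p}) X"
  proof (cases "X \<subseteq> ground f")
    case True
    then have X: "finite X" "p \<notin> X" using setfun_wfD(1)[OF wf] p by (auto intro: finite_subset)
    have "(SUP v\<in>ground f - X. val f (insert v X)) = -\<infinity>" if "card X + 1 \<noteq> rnk f"
    proof -
      have "val f (insert v X) = -\<infinity>" if "v \<in> ground f - X" for v
        using that \<open>card X + 1 \<noteq> rnk f\<close> X(1) setfun_wfD(4)[OF wf, of "insert v X"] by auto
      then have "(SUP v\<in>ground f - X. val f (insert v X)) \<le> -\<infinity>" by (intro SUP_least) simp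
      then show ?thesis by simp
    qed
    then have "val ?h (X \<union> {p}) = (SUP v\<in>ground f - X. val f (insert v X))"
      using True X by (auto simp: principal_extension_def ksubsets_def)
    then show ?thesis using True p
      by (simp add: val_truncation[OF wf] val_contraction[OF wfh])
  next
    case False
    then show ?thesis using p by (simp add: val_truncation[OF wf] val_contraction[OF wfh])
  qed
qed (use p in auto)

lemma complete_truncation:
  assumes "complete_class (C :: 'a::infinite setfun set)" "f \<in> C" "eff_dom (truncation f) \<noteq> {}"
  shows "truncation f \<in> C"
proof -
  note wf = complete_wf[OF assms(1,2)]
  obtain p where p: "p \<notin> ground f" using setfun_wfD(1)[OF wf] by (metis ex_new_if_finite infinite_UNIV)
  have "principal_extension f p (\<lambda>_. 0) \<in> C"
    using p by (intro complete_principal_extension[OF assms(1,2)]) auto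
  then show ?thesis
    using assms(3) complete_contraction[OF assms(1), of "principal_extension f p (\<lambda>_. 0)" "{p}"]
    unfolding truncation_eq_contraction[OF wf p] by simp
qed

text \<open>S is attached point by point: by \<open>principal_extension_induced\<close> each step is a principal extension whose
  weights are supported on the original ground set.\<close>

lemma complete_induced_extension:
  assumes C: "complete_class C" "g \<in> C" and S: "finite S" "S \<inter> ground g = {}"
    and w: "\<And>x y. w x y \<noteq> \<infinity>" "\<And>x y. x \<in> ground g \<Longrightarrow> y \<in> ground g \<Longrightarrow> w x y = diag x y"
  shows "induced (ground g \<union> S) w g \<in> C"
  using S
proof (induction S)
  case empty
  then show ?case using C induced_cong[of "ground g" g w diag] w(2) by (simp add: induced_diag complete_wf)
next
  case (insert p S)
  note g = complete_wf[OF C]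
  have "principal_extension (induced (ground g \<union> S) w g) p (\<lambda>v. if v \<in> ground g then w p v else -\<infinity>) \<in> C"
    using insert w by (intro complete_principal_extension[OF C(1)]) auto
  also have "principal_extension (induced (ground g \<union> S) w g) p (\<lambda>v. if v \<in> ground g then w p v else -\<infinity>)
      = induced (insert p (ground g \<union> S)) w g"
    using insert w setfun_wfD(1)[OF g] by (intro principal_extension_induced[OF g]) auto
  finally show ?case by simp
qed

text \<open>V may meet the ground set of g, so the extension is carried out with a fresh copy of V.  After deletion
  of the old ground set the copy is renamed back.\<close>

lemma complete_induced:
  fixes g :: "'a::infinite setfun"
  assumes C: "complete_class C" "g \<in> C" and V: "finite V"
    and w: "\<And>x y. x \<in> V \<Longrightarrow> y \<in> ground g \<Longrightarrow> w x y \<noteq> \<infinity>" and ne: "eff_dom (induced V w g) \<noteq> {}"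
  shows "induced V w g \<in> C"
proof -
  note g = complete_wf[OF C]
  obtain \<psi> :: "'a \<Rightarrow> 'a" where \<psi>: "inj_on \<psi> V" "\<psi> ` V \<inter> ground g = {}"
    using ex_fresh_injection[OF V setfun_wfD(1)[OF g]] .
  define S where "S = \<psi> ` V"
  define \<chi> where "\<chi> = the_inv_into V \<psi>"
  define w' where "w' x y = (if x \<in> S then if y \<in> ground g then w (\<chi> x) y else -\<infinity> else diag x y)" for x y
  have \<chi>: "inj_on \<chi> S" "\<chi> ` S = V" unfolding \<chi>_def S_def using \<psi>(1)
    by (simp_all add: inj_on_the_inv_into the_inv_into_onto)
  have S: "finite S" "S \<inter> ground g = {}" using \<psi>(2) V unfolding S_def by auto
  have w': "w' x y \<noteq> \<infinity>" for x y unfolding w'_def using w \<chi>(2) by auto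
  have h: "induced (ground g \<union> S) w' g \<in> C"
    using S w' by (intro complete_induced_extension[OF C]) (auto simp: w'_def)
  have del: "deletion (induced (ground g \<union> S) w' g) (ground g) = induced S w' g"
  proof -
    have "ground g \<union> S - ground g = S" using S(2) by blast
    then show ?thesis using deletion_induced[OF complete_wf[OF C(1) h], of "ground g"] by simp
  qed
  have rel: "relabel \<chi> (induced S w' g) = induced V w g"
    using relabel_induced[OF \<chi>(1), of g w' w] unfolding \<chi>(2) by (auto simp: w'_def)
  obtain X where "val (induced V w g) X \<noteq> -\<infinity>"
    using ne eff_dom_nonempty_iff wf_induced[of g V w] g V w by blast
  then have "\<exists>X. val (induced S w' g) X \<noteq> -\<infinity>"
    unfolding rel[symmetric] relabel_def by (auto split: if_splits)
  then have "eff_dom (induced S w' g) \<noteq> {}"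
    using eff_dom_nonempty_iff wf_induced[of g S w'] g S(1) w' by blast
  then have "induced S w' g \<in> C"
    using complete_deletion[OF C(1) h, of "ground g"] by (simp add: del)
  then show ?thesis unfolding rel[symmetric] using \<chi>(1) by (intro complete_relabel[OF C(1)]) auto
qed

section \<open>Union and direct sum\<close>

lemma vunion_ge:
  assumes "Y \<subseteq> X" "X \<subseteq> ground f \<union> ground g" "card X = rnk f + rnk g"
    "Y \<in> ksubsets (ground f) (rnk f)" "X - Y \<in> ksubsets (ground g) (rnk g)"
  shows "val f Y + val g (X - Y) \<le> val (vunion f g) X"
proof -
  have "val f Y + val g (X - Y) \<le> Sup {val f Y + val g (X - Y) | Y.
     Y \<subseteq> X \<and> Y \<in> ksubsets (ground f) (rnk f) \<and> X - Y \<in> ksubsets (ground g) (rnk g)}"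
    using assms by (intro Sup_upper) blast
  then show ?thesis using assms(2,3) by (simp add: vunion_def ksubsets_def)
qed

lemma vunion_val_ge:
  assumes f: "setfun_wf f" and g: "setfun_wf g" and "A \<inter> B = {}"
  shows "val f A + val g B \<le> val (vunion f g) (A \<union> B)"
proof (cases "val f A = -\<infinity> \<or> val g B = -\<infinity>")
  case True
  then show ?thesis using setfun_wfD(2)[OF f] setfun_wfD(2)[OF g] by (intro add_MInf_le) auto
next
  case False
  then have A: "A \<subseteq> ground f" "card A = rnk f" and B: "B \<subseteq> ground g" "card B = rnk g"
    using setfun_wfD(3,4)[OF f, of A] setfun_wfD(3,4)[OF g, of B] by auto
  have "finite A" "finite B" using A B setfun_wfD(1)[OF f] setfun_wfD(1)[OF g] by (auto intro: finite_subset)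
  then have "card (A \<union> B) = rnk f + rnk g" using A B assms(3) by (simp add: card_Un_disjoint)
  moreover have "A \<union> B - A = B" using assms(3) by blast
  ultimately show ?thesis using vunion_ge[of A "A \<union> B" f g] A B by (auto simp: ksubsets_def)
qed

text \<open>Together with \<open>vunion_val_ge\<close> and \<open>vunion_attained\<close> this replaces the sets of prescribed size in the
  definition by arbitrary partitions of X: parts of the wrong size have value \<open>-\<infinity>\<close>.\<close>

lemma vunion_le:
  assumes f: "setfun_wf f" and g: "setfun_wf g"
    and le: "\<And>A B. X = A \<union> B \<Longrightarrow> A \<inter> B = {} \<Longrightarrow> val f A \<noteq> -\<infinity> \<Longrightarrow> val g B \<noteq> -\<infinity> \<Longrightarrow> val f A + val g B \<le> K"
  shows "val (vunion f g) X \<le> K"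
proof -
  have "val f Y + val g (X - Y) \<le> K" if "Y \<subseteq> X" for Y
  proof (cases "val f Y = -\<infinity> \<or> val g (X - Y) = -\<infinity>")
    case True
    then show ?thesis using setfun_wfD(2)[OF f] setfun_wfD(2)[OF g] by (intro add_MInf_le) auto
  next
    case False
    then show ?thesis using that by (intro le) auto
  qed
  then show ?thesis by (auto simp: vunion_def intro!: Sup_least)
qed

lemma vunion_attained:
  assumes f: "setfun_wf f" and g: "setfun_wf g" and "val (vunion f g) X \<noteq> -\<infinity>"
  obtains A B where "X = A \<union> B" "A \<inter> B = {}" "val f A \<noteq> -\<infinity>" "val g B \<noteq> -\<infinity>"
    "val (vunion f g) X = val f A + val g B"
proof -
  define S where "S = {val f Y + val g (X - Y) | Y. Y \<subseteq> X \<and> Y \<in> ksubsets (ground f) (rnk f) \<and> X - Y \<in> ksubsets (ground g) (rnk g)}"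
  have v: "val (vunion f g) X = Sup S"
    using assms(3) unfolding vunion_def S_def by (auto split: if_splits)
  have "S \<subseteq> (\<lambda>Y. val f Y + val g (X - Y)) ` Pow (ground f)" unfolding S_def ksubsets_def by auto
  then have "finite S" using setfun_wfD(1)[OF f] by (meson finite_Pow_iff finite_imageI finite_subset)
  moreover have "S \<noteq> {}" using assms(3) v by (metis Sup_empty bot_ereal_def)
  ultimately have "Sup S \<in> S" by (metis Max_Sup Max_in)
  then obtain Y where Y: "Y \<subseteq> X" "val (vunion f g) X = val f Y + val g (X - Y)" unfolding v S_def by blast
  moreover have "val f Y \<noteq> \<infinity>" "val g (X - Y) \<noteq> \<infinity>" using f g by (auto simp: setfun_wfD)
  ultimately have "val f Y \<noteq> -\<infinity>" "val g (X - Y) \<noteq> -\<infinity>" using assms(3) by (auto simp: plus_ereal.simps)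
  with Y show ?thesis by (intro that[of Y "X - Y"]) auto
qed

lemma wf_vunion:
  assumes f: "setfun_wf f" and g: "setfun_wf g"
  shows "setfun_wf (vunion f g)"
proof (rule setfun_wfI)
  show "finite (ground (vunion f g))" using setfun_wfD(1)[OF f] setfun_wfD(1)[OF g] by simp
  fix X
  show "val (vunion f g) X \<noteq> \<infinity>"
  proof (cases "val (vunion f g) X = -\<infinity>")
    case False
    then obtain A B where "val (vunion f g) X = val f A + val g B" using vunion_attained[OF f g] by metis
    then show ?thesis using setfun_wfD(2)[OF f] setfun_wfD(2)[OF g] by simp
  qed simp
qed (auto simp: vunion_def ksubsets_def split: if_splits)

lemma vunion_free_vm:
  assumes g: "setfun_wf g" and M: "finite M" "M \<inter> ground g = {}"
  shows "val (vunion g (free_vm M)) Z = (if M \<subseteq> Z then val g (Z - M) else -\<infinity>)"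
proof (rule antisym)
  note wM = wf_free_vm[OF M(1)]
  show "val (vunion g (free_vm M)) Z \<le> (if M \<subseteq> Z then val g (Z - M) else -\<infinity>)"
  proof (rule vunion_le[OF g wM])
    fix A B assume AB: "Z = A \<union> B" "A \<inter> B = {}" "val (free_vm M) B \<noteq> -\<infinity>"
    then have "B = M" by (auto split: if_splits)
    moreover from this have "Z - M = A" using AB by blast
    ultimately show "val g A + val (free_vm M) B \<le> (if M \<subseteq> Z then val g (Z - M) else -\<infinity>)" using AB by simp
  qed
  show "(if M \<subseteq> Z then val g (Z - M) else -\<infinity>) \<le> val (vunion g (free_vm M)) Z"
    using vunion_val_ge[OF g wM, of "Z - M" M] by (auto simp: Un_absorb2 Int_commute)
qed

text \<open>Each element of the union may be matched to its copy in the ground set of f or to its copy in that of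
  the relabelled g.  As these two sets are disjoint, an injection is the same as a choice of which
  elements go to f and which go to g.\<close>

lemma vunion_eq_induced:
  assumes f: "setfun_wf f" and g: "setfun_wf g"
    and \<phi>: "inj_on \<phi> (ground g)" "\<phi> ` ground g \<inter> ground f = {}"
  shows "vunion f g = induced (ground f \<union> ground g)
     (\<lambda>x y. if y = x \<and> x \<in> ground f \<or> y = \<phi> x \<and> x \<in> ground g then 0 else -\<infinity>)
     (vunion f (relabel \<phi> g))" (is "_ = induced ?V ?w ?h")
proof (rule setfun_eqI)
  have wr: "setfun_wf (relabel \<phi> g)" unfolding relabel_eq_induced[OF g \<phi>(1)]
    using setfun_wfD(1)[OF g] by (intro wf_induced[OF g]) auto
  note h = wf_vunion[OF f wr]
  have vr: "val (relabel \<phi> g) (\<phi> ` B) = val g B" if "B \<subseteq> ground g" for B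
  proof -
    have "{v \<in> ground g. \<phi> v \<in> \<phi> ` B} = B" using that \<phi>(1) by (auto dest: inj_onD)
    then show ?thesis using that by (auto simp: relabel_def)
  qed
  note wU = wf_vunion[OF f g]
  fix X
  show "val (vunion f g) X = val (induced ?V ?w ?h) X"
  proof (cases "X \<subseteq> ?V")
    case False
    then show ?thesis using setfun_wfD(3)[OF wU, of X] by (auto simp: val_induced)
  next
    case True
    have "val (vunion f g) X \<le> max_induced ?w ?h X"
    proof (rule vunion_le[OF f g])
      fix A B assume AB: "X = A \<union> B" "A \<inter> B = {}" "val f A \<noteq> -\<infinity>" "val g B \<noteq> -\<infinity>"
      have sub: "A \<subseteq> ground f" "B \<subseteq> ground g" using AB(3,4) f g by (auto dest: setfun_wfD(3))
      define \<sigma> where "\<sigma> x = (if x \<in> A then x else \<phi> x)" for x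
      have dis: "A \<inter> \<phi> ` B = {}" using sub \<phi>(2) by blast
      have im: "\<sigma> ` X = A \<union> \<phi> ` B"
      proof -
        have "\<sigma> ` A = A" "\<sigma> ` B = \<phi> ` B" using AB(2) unfolding \<sigma>_def by (auto intro!: image_cong)
        then show ?thesis unfolding AB(1) by blast
      qed
      have "inj_on \<phi> B" using \<phi>(1) sub(2) by (rule inj_on_subset)
      then have "inj_on \<sigma> X" using dis unfolding \<sigma>_def AB(1) inj_on_def by auto
      then have "(\<Sum>x\<in>X. ?w x (\<sigma> x)) + val ?h (\<sigma> ` X) \<le> max_induced ?w ?h X"
        using sub im by (intro max_induced_ge) auto
      moreover have "?w x (\<sigma> x) = 0" if "x \<in> X" for x using that sub AB(1) unfolding \<sigma>_def by auto
      then have "(\<Sum>x\<in>X. ?w x (\<sigma> x)) = 0" by (intro sum.neutral) blast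
      moreover have "val f A + val g B \<le> val ?h (\<sigma> ` X)"
        using vunion_val_ge[OF f wr dis] vr[OF sub(2)] im by simp
      ultimately show "val f A + val g B \<le> max_induced ?w ?h X" by simp
    qed
    moreover have "max_induced ?w ?h X \<le> val (vunion f g) X"
    proof (rule max_induced_le[OF h])
      show "finite X" using True setfun_wfD(1)[OF f] setfun_wfD(1)[OF g] by (auto intro: finite_subset)
      fix \<sigma> assume \<sigma>: "inj_on \<sigma> X" "\<And>x. x \<in> X \<Longrightarrow> ?w x (\<sigma> x) \<noteq> -\<infinity>" "val ?h (\<sigma> ` X) \<noteq> -\<infinity>"
      have "?w x (\<sigma> x) = 0" if "x \<in> X" for x using \<sigma>(2)[OF that] by presburger
      then have s: "(\<Sum>x\<in>X. ?w x (\<sigma> x)) = 0" by (intro sum.neutral) blast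
      have "val ?h (\<sigma> ` X) \<le> val (vunion f g) X"
      proof (rule vunion_le[OF f wr])
        fix A B' assume AB: "\<sigma> ` X = A \<union> B'" "A \<inter> B' = {}" "val f A \<noteq> -\<infinity>" "val (relabel \<phi> g) B' \<noteq> -\<infinity>"
        have sub: "A \<subseteq> ground f" "B' \<subseteq> \<phi> ` ground g" using AB(3,4) setfun_wfD(3)[OF f, of A]
          by (auto simp: relabel_def split: if_splits)
        define B where "B = X - A"
        have cs: "\<sigma> x = x \<and> x \<in> ground f \<or> \<sigma> x = \<phi> x \<and> x \<in> ground g" if "x \<in> X" for x
          using \<sigma>(2)[OF that] by (auto split: if_splits)
        have AX: "x \<in> X \<and> \<sigma> x = x" if x: "x \<in> A" for x
        proof -
          obtain z where "z \<in> X" "x = \<sigma> z" using AB(1) x by blast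
          then show ?thesis using cs[of z] sub(1) x \<phi>(2) by auto
        qed
        have Bs: "\<sigma> x = \<phi> x \<and> x \<in> ground g" if "x \<in> B" for x
        proof -
          have "\<sigma> x \<notin> A" using \<sigma>(1) AX[of "\<sigma> x"] that unfolding B_def by (metis DiffD1 DiffD2 inj_onD)
          then have "\<sigma> x \<in> B'" using AB(1) that unfolding B_def by blast
          then show ?thesis using cs[of x] sub(2) that \<phi>(2) unfolding B_def by auto
        qed
        have "B' = \<phi> ` B"
        proof -
          have "\<sigma> ` A = A" using AX by force
          moreover have "\<sigma> ` B = \<phi> ` B" using Bs by (intro image_cong) auto
          moreover have "X = A \<union> B" unfolding B_def using AX by blast
          ultimately have "A \<union> B' = A \<union> \<phi> ` B" using AB(1) by (metis image_Un)
          moreover have "A \<inter> \<phi> ` B = {}" using sub(1) Bs \<phi>(2) by blast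
          ultimately show ?thesis using AB(2) by blast
        qed
        moreover have "B \<subseteq> ground g" using Bs by blast
        ultimately have "val f A + val (relabel \<phi> g) B' = val f A + val g B" using vr by simp
        also have "\<dots> \<le> val (vunion f g) (A \<union> B)" using vunion_val_ge[OF f g] unfolding B_def by blast
        also have "A \<union> B = X" unfolding B_def using AX by blast
        finally show "val f A + val (relabel \<phi> g) B' \<le> val (vunion f g) X" .
      qed
      then show "(\<Sum>x\<in>X. ?w x (\<sigma> x)) + val ?h (\<sigma> ` X) \<le> val (vunion f g) X" unfolding s by simp
    qed auto
    ultimately show ?thesis using True by (simp add: val_induced)
  qed
qed simp_all

lemma complete_vunion:
  fixes f :: "'a::infinite setfun"
  assumes C: "complete_class C" "f \<in> C" "g \<in> C" and ne: "eff_dom (vunion f g) \<noteq> {}"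
  shows "vunion f g \<in> C"
proof -
  note f = complete_wf[OF C(1,2)] and g = complete_wf[OF C(1,3)]
  obtain \<phi> :: "'a \<Rightarrow> 'a" where \<phi>: "inj_on \<phi> (ground g)" "\<phi> ` ground g \<inter> ground f = {}"
    using ex_fresh_injection[OF setfun_wfD(1)[OF g] setfun_wfD(1)[OF f]] .
  have r: "relabel \<phi> g \<in> C" using \<phi>(1) by (rule complete_relabel[OF C(1,3)])
  obtain A B where "A \<in> eff_dom f" "B \<in> eff_dom (relabel \<phi> g)" using C r complete_eff_dom by blast
  then have AB: "val f A \<noteq> -\<infinity>" "val (relabel \<phi> g) B \<noteq> -\<infinity>" "A \<inter> B = {}"
    using \<phi>(2) unfolding eff_dom_def ksubsets_def by auto
  note wr = complete_wf[OF C(1) r]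
  have "val f A + val (relabel \<phi> g) B \<noteq> -\<infinity>" using AB f wr setfun_wfD(2) by (auto simp: plus_ereal.simps)
  then have "val (vunion f (relabel \<phi> g)) (A \<union> B) \<noteq> -\<infinity>" using vunion_val_ge[OF f wr AB(3)] by auto
  then have "eff_dom (vunion f (relabel \<phi> g)) \<noteq> {}" using eff_dom_nonempty_iff[OF wf_vunion[OF f wr]] by blast
  then have "vunion f (relabel \<phi> g) \<in> C" using \<phi>(2) by (intro complete_direct_sum[OF C(1,2) r]) auto
  moreover note eq = vunion_eq_induced[OF f g \<phi>]
  ultimately show ?thesis using ne unfolding eq
    using setfun_wfD(1)[OF f] setfun_wfD(1)[OF g] by (intro complete_induced[OF C(1)]) auto
qed

section \<open>Free matroids in a complete class\<close>

text \<open>Deleting the complement of a basis B and contracting B leaves the empty ground set with some value r.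
  The remaining problem is to change r into 0, which principal extensions can do as soon as there is a
  point to which a weight can be assigned.\<close>

lemma complete_free_vm:
  fixes C :: "'a::infinite setfun set"
  assumes C: "complete_class C" "C \<noteq> {}" and "finite U"
  shows "free_vm U \<in> C"
proof -
  obtain f where f: "f \<in> C" using C(2) by blast
  note wf = complete_wf[OF C(1) f]
  obtain B where B: "B \<subseteq> ground f" "val f B \<noteq> -\<infinity>"
    using complete_eff_dom[OF C(1) f] eff_dom_nonempty_iff[OF wf] setfun_wfD(3)[OF wf] by metis
  then obtain r where r: "val f B = ereal r" using setfun_wfD(2)[OF wf, of B] by (cases "val f B") auto
  have cardB: "card B = rnk f" using setfun_wfD(4)[OF wf B(2)] .
  \<comment> \<open>rank 0 on the empty set with value r\<close>
  define f0 where "f0 = contraction (deletion f (ground f - B)) B"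
  have f0: "f0 \<in> C" "ground f0 = {}" "rnk f0 = 0" "val f0 {} = ereal r"
  proof -
    define d where "d = deletion f (ground f - B)"
    have gd: "ground d = B" "rnk d = card B" "val d B = ereal r" using B(1) cardB r unfolding d_def by (auto simp: val_deletion[OF wf])
    then have "eff_dom d \<noteq> {}" unfolding eff_dom_def ksubsets_def by auto
    then have d: "d \<in> C" unfolding d_def by (intro complete_deletion[OF C(1) f]) auto
    note wd = complete_wf[OF C(1) d]
    show f0': "ground f0 = {}" "rnk f0 = 0" "val f0 {} = ereal r" unfolding f0_def d_def[symmetric]
      using gd by (auto simp: val_contraction[OF wd])
    then have "{} \<in> eff_dom f0" unfolding eff_dom_def ksubsets_def by auto
    then show "f0 \<in> C" unfolding f0_def d_def[symmetric] using gd by (intro complete_contraction[OF C(1) d]) auto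
  qed
  note wf0 = complete_wf[OF C(1) f0(1)]
  have single: "free_vm {q} \<in> C" for q
  proof -
    obtain p where p: "p \<noteq> q" using ex_new_if_finite[of "{q}"] infinite_UNIV by auto
    \<comment> \<open>A point added to rank 0 is a loop, its dual a coloop: rank 1 on p with value r.\<close>
    define f1 where "f1 = dual (principal_extension f0 p (\<lambda>_. 0))"
    have pe: "principal_extension f0 p (\<lambda>_. 0) \<in> C" using f0 by (intro complete_principal_extension[OF C(1)]) auto
    then have f1C: "f1 \<in> C" unfolding f1_def by (rule complete_dual[OF C(1)])
    have f1: "ground f1 = {p}" "rnk f1 = 1" "val f1 {p} = ereal r"
      unfolding f1_def using val_dual[OF complete_wf[OF C(1) pe] complete_eff_dom[OF C(1) pe]] f0
      by (auto simp: principal_extension_def ksubsets_def)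
    \<comment> \<open>The weight -r of p turns the value r at p into the value 0 at q.\<close>
    define f2 where "f2 = principal_extension f1 q (\<lambda>_. ereal (-r))"
    have f2C: "f2 \<in> C" unfolding f2_def using f1 p by (intro complete_principal_extension[OF C(1) f1C]) auto
    note wf2 = complete_wf[OF C(1) f2C]
    have f2: "ground f2 = {p, q}" "rnk f2 = 1" "val f2 {q} = 0"
      unfolding f2_def using f1 p by (auto simp: principal_extension_def ksubsets_def)
    have "free_vm {q} = deletion f2 {p}"
    proof (rule setfun_eqI)
      have "val f2 {} = -\<infinity>" using f2(2) setfun_wfD(4)[OF wf2, of "{}"] by auto
      then show "val (free_vm {q}) X = val (deletion f2 {p}) X" for X
        using f2 p by (auto simp: val_deletion[OF wf2] subset_singleton_iff)
    qed (use f2 p in auto)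
    moreover have "{q} \<in> eff_dom (free_vm {q})" by (simp add: eff_dom_def ksubsets_def)
    ultimately show ?thesis using f2C f2 by (metis complete_deletion[OF C(1)] empty_iff insertI1 subsetI singletonD)
  qed
  show ?thesis using \<open>finite U\<close>
  proof (induction U)
    case empty
    fix q :: 'a
    have eq: "free_vm {} = contraction (free_vm {q}) {q}"
      by (rule setfun_eqI) (auto simp: val_contraction[OF wf_free_vm])
    have "{} \<in> eff_dom (free_vm {})" by (simp add: eff_dom_def ksubsets_def)
    then have "eff_dom (contraction (free_vm {q}) {q}) \<noteq> {}" unfolding eq[symmetric] by blast
    then show ?case unfolding eq using complete_contraction[OF C(1) single[of q], of "{q}"] by simp
  next
    case (insert q U)
    have w: "setfun_wf (free_vm {q})" "setfun_wf (free_vm U)" using insert by (simp_all add: wf_free_vm)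
    have "free_vm (insert q U) = vunion (free_vm {q}) (free_vm U)"
    proof (rule setfun_eqI)
      fix X
      show "val (free_vm (insert q U)) X = val (vunion (free_vm {q}) (free_vm U)) X"
        using insert vunion_free_vm[OF w(1) insert(1), of X] by auto
    qed (use insert in auto)
    moreover have "insert q U \<in> eff_dom (free_vm (insert q U))" by (simp add: eff_dom_def ksubsets_def)
    ultimately show ?case using insert single[of q] by (metis complete_vunion[OF C(1)] empty_iff)
  qed
qed

section \<open>Decomposing arc sets into paths and cycles\<close>

lemma path_arcs_simps [simp]:
  "path_arcs [] = {}" "path_arcs [x] = {}"
  "path_arcs (x # y # p) = insert (x, y) (path_arcs (y # p))"
  by (simp_all add: path_arcs_def)

lemma finite_path_arcs [simp]: "finite (path_arcs p)"
  by (simp add: path_arcs_def)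

lemma path_arcs_append:
  "p \<noteq> [] \<Longrightarrow> q \<noteq> [] \<Longrightarrow> path_arcs (p @ q) = insert (last p, hd q) (path_arcs p \<union> path_arcs q)"
proof (induction p rule: induct_list012)
  case (2 x)
  then show ?case by (cases q) auto
qed auto

lemma successively_iff_path_arcs: "successively (\<lambda>x y. (x, y) \<in> A) p \<longleftrightarrow> path_arcs p \<subseteq> A"
  by (induction p rule: induct_list012) auto

lemma path_arcs_endpoints:
  assumes "distinct p" "p \<noteq> []"
  shows "fst ` path_arcs p = set p - {last p}" "snd ` path_arcs p = set p - {hd p}"
    "inj_on fst (path_arcs p)" "inj_on snd (path_arcs p)"
proof -
  have "fst ` path_arcs p = set p - {last p} \<and> snd ` path_arcs p = set p - {hd p} \<and>
    inj_on fst (path_arcs p) \<and> inj_on snd (path_arcs p)"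
    using assms
  proof (induction p rule: induct_list012)
    case (3 x y p)
    then have IH: "fst ` path_arcs (y # p) = set (y # p) - {last (y # p)}"
      "snd ` path_arcs (y # p) = set (y # p) - {y}"
      "inj_on fst (path_arcs (y # p))" "inj_on snd (path_arcs (y # p))" by simp_all
    have x: "x \<notin> set (y # p)" using 3 by simp
    have "last (y # p) \<in> set (y # p)" by (rule last_in_set) simp
    with x have "x \<noteq> last (y # p)" by metis
    then have "fst ` path_arcs (x # y # p) = set (x # y # p) - {last (x # y # p)}"
      using IH(1) x by auto
    moreover have "snd ` path_arcs (x # y # p) = set (x # y # p) - {x}" using IH(2) x by auto
    moreover have "x \<notin> fst ` path_arcs (y # p)" "y \<notin> snd ` path_arcs (y # p)" using IH(1,2) x by auto
    then have "inj_on fst (path_arcs (x # y # p))" "inj_on snd (path_arcs (x # y # p))"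
      using IH(3,4) unfolding path_arcs_simps(3) inj_on_insert fst_conv snd_conv by blast+
    ultimately show ?case by simp
  qed simp_all
  then show "fst ` path_arcs p = set p - {last p}" "snd ` path_arcs p = set p - {hd p}"
    "inj_on fst (path_arcs p)" "inj_on snd (path_arcs p)" by blast+
qed

text \<open>What remains of a linking if its arcs and its ends are left open.  A list of one node is a path
  without arcs, so isolated nodes are paths.\<close>

definition path_system :: "'a set \<Rightarrow> 'a list set \<Rightarrow> bool" where
  "path_system N P \<longleftrightarrow> (\<forall>p\<in>P. p \<noteq> [] \<and> distinct p \<and> set p \<subseteq> N) \<and>
     (\<forall>p\<in>P. \<forall>q\<in>P. p \<noteq> q \<longrightarrow> set p \<inter> set q = {})"

abbreviation arcs_of :: "'a list set \<Rightarrow> ('a \<times> 'a) set" where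
  "arcs_of P \<equiv> \<Union>p\<in>P. path_arcs p"

lemma path_arcs_subset: "path_arcs p \<subseteq> set p \<times> set p"
  by (induction p rule: induct_list012) auto

lemma path_system_same:
  assumes "path_system N P" "p \<in> P" "q \<in> P" "x \<in> set p" "x \<in> set q"
  shows "p = q"
  using assms unfolding path_system_def by blast

text \<open>Every node of a path except the last has exactly one outgoing arc, and every node except the first
  exactly one incoming arc.\<close>

lemma path_system_arcs:
  assumes P: "path_system N P"
  shows "fst ` arcs_of P = (\<Union>p\<in>P. set p) - last ` P" "snd ` arcs_of P = (\<Union>p\<in>P. set p) - hd ` P"
    "inj_on fst (arcs_of P)" "inj_on snd (arcs_of P)"
proof -
  have p: "p \<noteq> []" "distinct p" "last p \<in> set p" "hd p \<in> set p" if "p \<in> P" for p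
    using P that unfolding path_system_def by auto
  note ends = path_arcs_endpoints[OF p(2) p(1)]
  show "fst ` arcs_of P = (\<Union>p\<in>P. set p) - last ` P"
  proof -
    have "fst ` arcs_of P = (\<Union>p\<in>P. set p - {last p})" using ends(1) by (simp add: image_UN)
    also have "\<dots> = (\<Union>p\<in>P. set p) - last ` P" using p(3) path_system_same[OF P] by blast
    finally show ?thesis .
  qed
  show "snd ` arcs_of P = (\<Union>p\<in>P. set p) - hd ` P"
  proof -
    have "snd ` arcs_of P = (\<Union>p\<in>P. set p - {hd p})" using ends(2) by (simp add: image_UN)
    also have "\<dots> = (\<Union>p\<in>P. set p) - hd ` P" using p(4) path_system_same[OF P] by blast
    finally show ?thesis .
  qed
  have sub: "fst a \<in> set p \<and> snd a \<in> set p" if "a \<in> path_arcs p" for a p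
    using path_arcs_subset[of p] that by auto
  show "inj_on fst (arcs_of P)"
  proof (rule inj_onI)
    fix a b assume "a \<in> arcs_of P" "b \<in> arcs_of P" and eq: "fst a = fst b"
    then obtain p q where pq: "p \<in> P" "a \<in> path_arcs p" "q \<in> P" "b \<in> path_arcs q" by blast
    then have "p = q" using path_system_same[OF P] sub eq by metis
    then show "a = b" using ends(3)[of p] pq eq by (auto dest: inj_onD)
  qed
  show "inj_on snd (arcs_of P)"
  proof (rule inj_onI)
    fix a b assume "a \<in> arcs_of P" "b \<in> arcs_of P" and eq: "snd a = snd b"
    then obtain p q where pq: "p \<in> P" "a \<in> path_arcs p" "q \<in> P" "b \<in> path_arcs q" by blast
    then have "p = q" using path_system_same[OF P] sub eq by metis
    then show "a = b" using ends(4)[of p] pq eq by (auto dest: inj_onD)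
  qed
qed

lemma finite_path_system:
  assumes "path_system N P" "finite N"
  shows "finite P"
proof (rule finite_imageD[of hd])
  have "hd p \<in> set p" if "p \<in> P" for p using assms(1) that unfolding path_system_def by simp
  then show "inj_on hd P" using path_system_same[OF assms(1)] by (metis inj_onI)
  have "hd ` P \<subseteq> N" using assms(1) unfolding path_system_def by (auto simp: subset_iff)
  then show "finite (hd ` P)" using assms(2) by (rule finite_subset)
qed

lemma sum_arcs_of:
  fixes c :: "'a \<times> 'a \<Rightarrow> real"
  assumes P: "path_system N P" "finite N"
  shows "(\<Sum>a\<in>arcs_of P. c a) = (\<Sum>p\<in>P. \<Sum>a\<in>path_arcs p. c a)"
proof (rule sum.UNION_disjoint)
  show "finite P" using P by (rule finite_path_system)
  show "\<forall>p\<in>P. finite (path_arcs p)" by simp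
  show "\<forall>p\<in>P. \<forall>q\<in>P. p \<noteq> q \<longrightarrow> path_arcs p \<inter> path_arcs q = {}"
    using path_arcs_subset path_system_same[OF P(1)] by fastforce
qed

text \<open>Induction on the number of arcs, starting from the isolated nodes of N.  A new arc (x, y) leads from
  the end x of some path to the beginning y of some path, as x has no outgoing and y no incoming arc yet.
  If the two paths differ, they are joined.  If they agree, the arc closes a cycle, which is removed;
  its weight is at most 0, so the remaining paths weigh no less.  In both cases exactly y stops being
  a beginning and x stops being an end.\<close>

lemma path_decomposition:
  fixes c :: "'a \<times> 'a \<Rightarrow> real"
  assumes "finite S" "finite N" "S \<subseteq> N \<times> N" "inj_on fst S" "inj_on snd S" "\<forall>(x, y)\<in>S. x \<noteq> y"
    and "\<And>p. distinct p \<Longrightarrow> length p \<ge> 2 \<Longrightarrow> path_arcs p \<subseteq> S \<Longrightarrow> (last p, hd p) \<in> S \<Longrightarrow>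
           (\<Sum>a\<in>path_arcs p. c a) + c (last p, hd p) \<le> 0"
  shows "\<exists>P. path_system N P \<and> arcs_of P \<subseteq> S \<and> hd ` P = N - snd ` S \<and> last ` P = N - fst ` S \<and>
           (\<Sum>a\<in>S. c a) \<le> (\<Sum>a\<in>arcs_of P. c a)"
  using assms
proof (induction S)
  case empty
  have "path_system N ((\<lambda>x. [x]) ` N)" unfolding path_system_def by auto
  moreover have "hd ` (\<lambda>x. [x]) ` N = N" "last ` (\<lambda>x. [x]) ` N = N" by (simp_all add: image_image)
  moreover have "arcs_of ((\<lambda>x. [x]) ` N) = {}" by simp
  ultimately show ?case by (intro exI[of _ "(\<lambda>x. [x]) ` N"]) simp
next
  case (insert a S)
  obtain x y where a: "a = (x, y)" by (cases a)
  note prems = insert.prems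
  have "\<exists>P. path_system N P \<and> arcs_of P \<subseteq> S \<and> hd ` P = N - snd ` S \<and> last ` P = N - fst ` S \<and>
           (\<Sum>a\<in>S. c a) \<le> (\<Sum>a\<in>arcs_of P. c a)"
  proof (rule insert.IH)
    fix p assume "distinct p" "length p \<ge> 2" "path_arcs p \<subseteq> S" "(last p, hd p) \<in> S"
    then show "(\<Sum>a\<in>path_arcs p. c a) + c (last p, hd p) \<le> 0" by (intro prems(6)) auto
  qed (use prems in auto)
  then obtain P where P: "path_system N P" "arcs_of P \<subseteq> S" "hd ` P = N - snd ` S" "last ` P = N - fst ` S"
    "(\<Sum>a\<in>S. c a) \<le> (\<Sum>a\<in>arcs_of P. c a)" by blast
  have xy: "x \<in> N" "y \<in> N" "x \<notin> fst ` S" "y \<notin> snd ` S" "x \<noteq> y"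
    using prems(2-5) insert.hyps(2) unfolding a inj_on_insert by auto
  obtain p where p: "p \<in> P" "last p = x" using P(4) xy by (metis DiffI imageE)
  obtain q where q: "q \<in> P" "hd q = y" using P(3) xy by (metis DiffI imageE)
  have el: "r \<noteq> []" "distinct r" "set r \<subseteq> N" "last r \<in> set r" "hd r \<in> set r" if "r \<in> P" for r
    using P(1) that unfolding path_system_def by auto
  note same = path_system_same[OF P(1)]
  have inj: "inj_on hd P" "inj_on last P" using el same by (metis inj_onI)+
  note finP = finite_path_system[OF P(1) prems(1)]
  note sumP = sum_arcs_of[OF P(1) prems(1)]
  have new: "N - snd ` insert a S = hd ` P - {y}" "N - fst ` insert a S = last ` P - {x}"
    unfolding P(3,4) a by auto
  have sumS: "(\<Sum>a\<in>insert a S. c a) = c (x, y) + (\<Sum>a\<in>S. c a)" using insert.hyps by (simp add: a)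
  show ?case
  proof (cases "p = q")
    case True
    \<comment> \<open>The arc closes p to a cycle.\<close>
    define P' where "P' = P - {p}"
    have sys: "path_system N P'" using P(1) unfolding P'_def path_system_def by blast
    have "length p \<ge> 2"
    proof (rule ccontr)
      assume "\<not> length p \<ge> 2"
      then obtain z where "p = [z]" using el(1)[OF p(1)] by (cases p; cases "tl p") auto
      then show False using p q True xy(5) by simp
    qed
    moreover have "path_arcs p \<subseteq> insert a S" using P(2) p(1) by blast
    ultimately have cyc: "(\<Sum>a\<in>path_arcs p. c a) + c (x, y) \<le> 0"
      using prems(6)[of p] el(2)[OF p(1)] p q True a by simp
    have "(\<Sum>a\<in>arcs_of P. c a) = (\<Sum>a\<in>path_arcs p. c a) + (\<Sum>a\<in>arcs_of P'. c a)"
      unfolding sumP sum_arcs_of[OF sys prems(1)] unfolding P'_def by (rule sum.remove[OF finP p(1)])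
    then have "(\<Sum>a\<in>insert a S. c a) \<le> (\<Sum>a\<in>arcs_of P'. c a)" using cyc P(5) sumS by simp
    moreover have "hd ` P' = hd ` P - {y}" "last ` P' = last ` P - {x}"
      using p q True inj unfolding P'_def by (auto dest: inj_onD)
    moreover have "arcs_of P' \<subseteq> insert a S" using P(2) unfolding P'_def by blast
    ultimately show ?thesis using sys new by (intro exI[of _ P']) simp
  next
    case False
    \<comment> \<open>The arc joins p and q.\<close>
    define R where "R = P - {p, q}"
    define P' where "P' = insert (p @ q) R"
    have dis: "set p \<inter> set q = {}" using P(1) p q False unfolding path_system_def by blast
    have disR: "set r \<inter> set (p @ q) = {}" if "r \<in> R" for r
      using P(1) p q that unfolding path_system_def R_def by auto
    have sys: "path_system N P'"
      unfolding path_system_def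
    proof (intro conjI ballI impI)
      fix r assume "r \<in> P'"
      then show "r \<noteq> []" "distinct r" "set r \<subseteq> N"
        using el(1,2) p(1) q(1) dis unfolding P'_def R_def by (auto dest: el(3)[THEN subsetD])
    next
      fix r s assume rs: "r \<in> P'" "s \<in> P'" "r \<noteq> s"
      show "set r \<inter> set s = {}"
      proof (cases "r = p @ q \<or> s = p @ q")
        case True
        then show ?thesis using rs disR unfolding P'_def by blast
      next
        case False
        then have "r \<in> P" "s \<in> P" using rs unfolding P'_def R_def by auto
        then show ?thesis using rs(3) P(1) unfolding path_system_def by blast
      qed
    qed
    have pq: "p \<noteq> []" "q \<noteq> []" using el p q by auto
    have arcs: "path_arcs (p @ q) = insert (x, y) (path_arcs p \<union> path_arcs q)"
      using path_arcs_append[OF pq] p q by simp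
    have notR: "p @ q \<notin> R" using disR[of "p @ q"] pq by auto
    have dpq: "path_arcs p \<inter> path_arcs q = {}" using path_arcs_subset[of p] path_arcs_subset[of q] dis by fastforce
    have nxy: "(x, y) \<notin> path_arcs p \<union> path_arcs q"
      using P(2) p(1) q(1) insert.hyps(2) unfolding a by blast
    have "(\<Sum>a\<in>arcs_of P. c a) = (\<Sum>a\<in>path_arcs p. c a) + ((\<Sum>a\<in>path_arcs q. c a) + (\<Sum>p\<in>R. \<Sum>a\<in>path_arcs p. c a))"
    proof -
      have "R = P - {p} - {q}" unfolding R_def by blast
      then show ?thesis unfolding sumP
        using sum.remove[OF finP p(1), of "\<lambda>r. sum c (path_arcs r)"]
          sum.remove[of "P - {p}" q "\<lambda>r. sum c (path_arcs r)"] finP q(1) False by simp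
    qed
    moreover have "(\<Sum>a\<in>arcs_of P'. c a) = (\<Sum>a\<in>path_arcs (p @ q). c a) + (\<Sum>p\<in>R. \<Sum>a\<in>path_arcs p. c a)"
      unfolding sum_arcs_of[OF sys prems(1)] unfolding P'_def using notR finP by (simp add: R_def)
    moreover have "(\<Sum>a\<in>path_arcs (p @ q). c a) = c (x, y) + ((\<Sum>a\<in>path_arcs p. c a) + (\<Sum>a\<in>path_arcs q. c a))"
      unfolding arcs using nxy dpq by (simp add: sum.union_disjoint)
    ultimately have "(\<Sum>a\<in>insert a S. c a) \<le> (\<Sum>a\<in>arcs_of P'. c a)" using P(5) sumS by simp
    moreover have "hd ` P' = hd ` P - {y}"
    proof -
      have "hd ` P' = insert (hd p) (hd ` R)" unfolding P'_def using pq by simp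
      also have "\<dots> = hd ` (P - {q})" using p(1) False unfolding R_def by auto
      also have "\<dots> = hd ` P - {y}" using q inj(1) by (auto dest: inj_onD)
      finally show ?thesis .
    qed
    moreover have "last ` P' = last ` P - {x}"
    proof -
      have "last ` P' = insert (last q) (last ` R)" unfolding P'_def using pq by simp
      also have "\<dots> = last ` (P - {p})" using q(1) False unfolding R_def by auto
      also have "\<dots> = last ` P - {x}" using p inj(2) by (auto dest: inj_onD)
      finally show ?thesis .
    qed
    moreover have "arcs_of P' \<subseteq> insert a S"
      using P(2) p(1) q(1) arcs unfolding P'_def R_def a by auto
    ultimately show ?thesis using sys new by (intro exI[of _ P']) simp
  qed
qed

section \<open>Network induction\<close>

text \<open>The weight of choosing y as the successor of x.  No arc leaves U and none enters V, because a linking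
  meets these sets only at its ends.  The diagonal has weight 0: x = y stands for an unused inner node
  or for a path that consists of a single node in both V and U.\<close>

definition arc_weight :: "('a \<times> 'a) set \<Rightarrow> ('a \<times> 'a \<Rightarrow> real) \<Rightarrow> 'a set \<Rightarrow> 'a set \<Rightarrow> 'a \<Rightarrow> 'a \<Rightarrow> ereal" where
  "arc_weight A c V U x y =
     (if x = y then 0 else if (x, y) \<in> A \<and> x \<notin> U \<and> y \<notin> V then ereal (c (x, y)) else -\<infinity>)"

lemma arc_weight_not_PInf [simp]: "arc_weight A c V U x y \<noteq> \<infinity>"
  by (simp add: arc_weight_def)

lemma linking_path_system:
  assumes "linking T A V U P X Y"
  shows "path_system T P" "arcs_of P \<subseteq> A"
  using assms unfolding linking_def dpath_def path_system_def successively_iff_path_arcs by blast+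

text \<open>The bijection sends each node to its successor on its path, and a node without successor to itself.
  The latter nodes are the unused inner nodes and the ends in Y; an end of a path can lie in X
  only if its path is a single node.\<close>

lemma matching_of_linking:
  assumes net: "directed_network T A V U" and l: "linking T A V U P X Y" and M: "M = T - (V \<union> U)"
  obtains \<sigma> where "bij_betw \<sigma> (X \<union> M) (Y \<union> M)"
    "(\<Sum>x\<in>X \<union> M. arc_weight A c V U x (\<sigma> x)) = ereal (\<Sum>a\<in>arcs_of P. c a)"
proof -
  note sys = linking_path_system(1)[OF l]
  define S where "S = arcs_of P"
  define N where "N = (\<Union>p\<in>P. set p)"
  have l': "hd ` P = X" "last ` P = Y" "V \<inter> N = X" "U \<inter> N = Y"
    using l unfolding linking_def N_def by auto
  have T: "finite T" "V \<subseteq> T" "U \<subseteq> T" using net unfolding directed_network_def by auto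
  have NT: "N \<subseteq> T" using sys unfolding path_system_def N_def by blast
  have S: "fst ` S = N - Y" "snd ` S = N - X" "inj_on fst S" "inj_on snd S"
    using path_system_arcs[OF sys] l' unfolding S_def N_def by auto
  define \<sigma> where "\<sigma> x = (if x \<in> fst ` S then snd (the_inv_into S fst x) else x)" for x
  have \<sigma>S: "\<sigma> (fst a) = snd a" if "a \<in> S" for a
    using that unfolding \<sigma>_def by (simp add: the_inv_into_f_f[OF S(3)])
  have \<sigma>1: "(x, \<sigma> x) \<in> S" if "x \<in> N - Y" for x
  proof -
    have "x \<in> fst ` S" using that S(1) by blast
    then obtain a where "a \<in> S" "x = fst a" by blast
    then show ?thesis using \<sigma>S[of a] by (cases a) simp
  qed
  have \<sigma>2: "\<sigma> x = x" if "x \<notin> N - Y" for x using that unfolding \<sigma>_def S(1) by auto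
  have SN: "x \<in> N - Y" "y \<in> N - X" if "(x, y) \<in> S" for x y
    using that S(1,2) by force+
  have bij: "bij_betw \<sigma> (X \<union> M) (Y \<union> M)"
    unfolding bij_betw_def
  proof
    have mix: "x' \<in> N - Y" if "x \<in> N - Y" "x' \<in> X \<union> M" "\<sigma> x = x'" for x x'
    proof -
      have "x' \<in> N - X" using \<sigma>1[OF that(1)] SN(2) that(3) by blast
      then show ?thesis using that(2) l'(4) M by blast
    qed
    show "inj_on \<sigma> (X \<union> M)"
    proof (rule inj_onI)
      fix x x' assume x: "x \<in> X \<union> M" "x' \<in> X \<union> M" "\<sigma> x = \<sigma> x'"
      show "x = x'"
      proof (cases "x \<in> N - Y")
        case True
        have "x' \<in> N - Y"
        proof (rule ccontr)
          assume "x' \<notin> N - Y"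
          then show False using mix[OF True x(2)] x(3) \<sigma>2 by metis
        qed
        then show ?thesis using \<sigma>1[OF True] \<sigma>1[of x'] x(3) S(4) by (metis inj_onD prod.inject snd_conv)
      next
        case False
        then have "x' \<notin> N - Y" using mix[of x' x] x \<sigma>2 by metis
        then show ?thesis using False x(3) \<sigma>2 by metis
      qed
    qed
    show "\<sigma> ` (X \<union> M) = Y \<union> M"
    proof (intro equalityI subsetI)
      fix y assume "y \<in> \<sigma> ` (X \<union> M)"
      then obtain x where x: "x \<in> X \<union> M" "y = \<sigma> x" by blast
      show "y \<in> Y \<union> M"
      proof (cases "x \<in> N - Y")
        case True
        then have "y \<in> N - X" using \<sigma>1 SN(2) x(2) by blast
        then show ?thesis using NT l'(3,4) M by blast
      next
        case False
        then show ?thesis using x \<sigma>2[OF False] l'(3) by auto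
      qed
    next
      fix y assume y: "y \<in> Y \<union> M"
      show "y \<in> \<sigma> ` (X \<union> M)"
      proof (cases "y \<in> snd ` S")
        case True
        then obtain x where x: "(x, y) \<in> S" by force
        then have "\<sigma> x = y" using \<sigma>S[OF x] by simp
        moreover have "x \<in> N - Y" using SN(1)[OF x] .
        then have "x \<in> X \<union> M" using NT l'(3,4) M by blast
        ultimately show ?thesis by blast
      next
        case False
        then have "y \<notin> N - Y \<and> y \<in> X \<union> M" using y S(2) l'(3,4) M by auto
        then show ?thesis using \<sigma>2[of y] by (metis image_eqI)
      qed
    qed
  qed
  have "finite (X \<union> M)" using T NT l'(3) M by (auto intro: finite_subset)
  moreover have sub: "fst ` S \<subseteq> X \<union> M" using S(1) NT l'(3,4) M by blast
  ultimately have "(\<Sum>x\<in>X \<union> M. arc_weight A c V U x (\<sigma> x)) = (\<Sum>x\<in>fst ` S. arc_weight A c V U x (\<sigma> x))"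
    using \<sigma>2 S(1) by (intro sum.mono_neutral_right) (auto simp: arc_weight_def)
  also have "\<dots> = (\<Sum>a\<in>S. arc_weight A c V U (fst a) (\<sigma> (fst a)))" by (simp add: sum.reindex[OF S(3)])
  also have "\<dots> = (\<Sum>a\<in>S. ereal (c a))"
  proof (rule sum.cong[OF refl])
    fix a assume a: "a \<in> S"
    obtain p where p: "p \<in> P" "a \<in> path_arcs p" using a unfolding S_def by blast
    have "fst a \<noteq> snd a"
    proof
      assume eq: "fst a = snd a"
      have d: "distinct p" "p \<noteq> []" using sys p(1) unfolding path_system_def by auto
      then show False using p(2) eq
        by (induction p rule: induct_list012) auto
    qed
    moreover have "a \<in> A" using linking_path_system(2)[OF l] a unfolding S_def by blast
    moreover have "fst a \<notin> U" "snd a \<notin> V" using SN[of "fst a" "snd a"] a l'(3,4) by auto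
    ultimately show "arc_weight A c V U (fst a) (\<sigma> (fst a)) = ereal (c a)"
      using \<sigma>S[OF a] by (simp add: arc_weight_def)
  qed
  also have "\<dots> = ereal (\<Sum>a\<in>arcs_of P. c a)" unfolding S_def by simp
  finally show ?thesis using bij that by blast
qed

text \<open>The pairs of distinct nodes x and \<open>\<sigma> x\<close> form an arc set to which \<open>path_decomposition\<close> applies.  Each
  node of a cycle has an outgoing and an incoming arc, so the cycle avoids U and V and the condition on
  positive cycles bounds its weight.\<close>

lemma linking_of_matching:
  assumes net: "directed_network T A V U" and cyc: "no_positive_cycle T A c V U"
    and M: "M = T - (V \<union> U)" and XY: "X \<subseteq> V" "Y \<subseteq> U"
    and \<sigma>: "bij_betw \<sigma> (X \<union> M) (Y \<union> M)" "\<And>x. x \<in> X \<union> M \<Longrightarrow> arc_weight A c V U x (\<sigma> x) \<noteq> -\<infinity>"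
  obtains P where "linking T A V U P X Y"
    "(\<Sum>x\<in>X \<union> M. arc_weight A c V U x (\<sigma> x)) \<le> ereal (\<Sum>a\<in>arcs_of P. c a)"
proof -
  have T: "finite T" "V \<subseteq> T" "U \<subseteq> T" "A \<subseteq> T \<times> T" using net unfolding directed_network_def by auto
  \<comment> \<open>Unused inner nodes are removed from N, for they would be isolated paths outside X and Y.\<close>
  define D where "D = {x \<in> X \<union> M. \<sigma> x \<noteq> x}"
  define S where "S = (\<lambda>x. (x, \<sigma> x)) ` D"
  define N where "N = X \<union> Y \<union> D"
  have \<sigma>i: "inj_on \<sigma> (X \<union> M)" "\<sigma> ` (X \<union> M) = Y \<union> M" using \<sigma>(1) unfolding bij_betw_def by auto
  have DT: "D \<subseteq> X \<union> M" "X \<union> M \<subseteq> T" unfolding D_def using M T(2) XY(1) by auto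
  have arc: "(x, \<sigma> x) \<in> A" "x \<notin> U" "\<sigma> x \<notin> V" "arc_weight A c V U x (\<sigma> x) = ereal (c (x, \<sigma> x))" if "x \<in> D" for x
    using \<sigma>(2)[of x] that unfolding D_def by (auto simp: arc_weight_def split: if_splits)
  have fstS: "fst ` S = D" unfolding S_def by (simp add: image_image)
  have sndS: "snd ` S = \<sigma> ` D" unfolding S_def by (simp add: image_image)
  have NT: "N \<subseteq> T" unfolding N_def using DT XY T by blast
  have \<sigma>D: "\<sigma> x \<in> N" if "x \<in> D" for x
  proof -
    have xm: "x \<in> X \<union> M" "\<sigma> x \<noteq> x" using that unfolding D_def by auto
    then have "\<sigma> x \<in> Y \<union> M" using \<sigma>i(2) by blast
    moreover have "\<sigma> (\<sigma> x) \<noteq> \<sigma> x" if "\<sigma> x \<in> M"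
      using inj_onD[OF \<sigma>i(1), of "\<sigma> x" x] xm that by auto
    ultimately show ?thesis unfolding N_def D_def by blast
  qed
  have "finite D" using DT T(1) by (meson finite_subset)
  then have finS: "finite S" unfolding S_def by simp
  have "\<exists>P. path_system N P \<and> arcs_of P \<subseteq> S \<and> hd ` P = N - snd ` S \<and> last ` P = N - fst ` S \<and>
           (\<Sum>a\<in>S. c a) \<le> (\<Sum>a\<in>arcs_of P. c a)"
  proof (rule path_decomposition[OF finS])
    show "finite N" using NT T(1) by (rule finite_subset)
    show "S \<subseteq> N \<times> N" unfolding S_def using \<sigma>D unfolding N_def by blast
    show "inj_on fst S" unfolding S_def by (auto simp: inj_on_def)
    show "inj_on snd S" unfolding S_def using \<sigma>i(1) DT(1) by (auto simp: inj_on_def)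
    show "\<forall>(x, y)\<in>S. x \<noteq> y" unfolding S_def D_def by auto
    fix p assume p: "distinct p" "length p \<ge> 2" "path_arcs p \<subseteq> S" "(last p, hd p) \<in> S"
    have ne: "p \<noteq> []" using p(2) by auto
    have SA: "S \<subseteq> A" unfolding S_def using arc(1) by blast
    have nU: "fst a \<notin> U" and nV: "snd a \<notin> V" if "a \<in> S" for a using that arc(2,3) unfolding S_def by auto
    have "last p \<in> fst ` S" "hd p \<in> snd ` S" using p(4) by (metis fst_conv imageI, metis snd_conv imageI)
    then have sub: "insert (last p) (fst ` path_arcs p) \<subseteq> fst ` S" "insert (hd p) (snd ` path_arcs p) \<subseteq> snd ` S"
      using image_mono[OF p(3)] by (simp_all only: insert_subset simp_thms)
    have "x \<notin> U \<and> x \<notin> V" if "x \<in> set p" for x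
    proof -
      have "x \<in> insert (last p) (fst ` path_arcs p)" using path_arcs_endpoints(1)[OF p(1) ne] that by auto
      then have 1: "x \<in> fst ` S" by (rule subsetD[OF sub(1)])
      have "x \<in> insert (hd p) (snd ` path_arcs p)" using path_arcs_endpoints(2)[OF p(1) ne] that by auto
      then have 2: "x \<in> snd ` S" by (rule subsetD[OF sub(2)])
      show ?thesis using 1 2 nU nV by (metis imageE)
    qed
    then have "set p \<inter> (V \<union> U) = {}" by blast
    moreover have "set p \<subseteq> T"
    proof -
      have "set p \<subseteq> insert (last p) (fst ` path_arcs p)" using path_arcs_endpoints(1)[OF p(1) ne] by auto
      also note sub(1)
      also have "fst ` S \<subseteq> T" using fstS DT by auto
      finally show ?thesis .
    qed
    then have "dpath T A p" unfolding dpath_def successively_iff_path_arcs using p ne SA by blast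
    ultimately show "(\<Sum>a\<in>path_arcs p. c a) + c (last p, hd p) \<le> 0"
      using cyc p SA unfolding no_positive_cycle_def by blast
  qed
  then obtain P where P: "path_system N P" "arcs_of P \<subseteq> S" "hd ` P = N - \<sigma> ` D" "last ` P = N - D"
    "(\<Sum>a\<in>S. c a) \<le> (\<Sum>a\<in>arcs_of P. c a)" unfolding fstS sndS by blast
  have XU: "x \<in> Y" "\<sigma> x = x" if "x \<in> X" "x \<in> U" for x
  proof -
    show "\<sigma> x = x" using arc(2)[of x] that unfolding D_def by blast
    moreover have "\<sigma> x \<in> Y \<union> M" using \<sigma>i(2) that by blast
    moreover have "x \<notin> M" using that M by blast
    ultimately show "x \<in> Y" by simp
  qed
  have YV: "y \<in> X" "\<sigma> y = y" if "y \<in> Y" "y \<in> V" for y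
  proof -
    have "y \<in> \<sigma> ` (X \<union> M)" unfolding \<sigma>i(2) using that by simp
    then obtain x where x: "x \<in> X \<union> M" "\<sigma> x = y" by (metis imageE)
    have xy: "x = y"
    proof (rule ccontr)
      assume "x \<noteq> y"
      then have "x \<in> D" using x unfolding D_def by simp
      then show False using arc(3)[of x] x(2) that(2) by simp
    qed
    have "y \<notin> M" using that M by blast
    then show "y \<in> X" "\<sigma> y = y" using x unfolding xy by blast+
  qed
  have lastP: "N - D = Y"
  proof
    show "N - D \<subseteq> Y"
    proof
      fix x assume x: "x \<in> N - D"
      show "x \<in> Y"
      proof (cases "x \<in> Y")
        case False
        then have "x \<in> X" "\<sigma> x = x" using x unfolding N_def D_def by auto
        moreover from this have "x \<in> Y \<union> M" using \<sigma>i(2) by (metis UnI1 imageI)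
        moreover have "x \<notin> M" using \<open>x \<in> X\<close> XY(1) M by blast
        ultimately show ?thesis by simp
      qed
    qed
    show "Y \<subseteq> N - D" using arc(2) XY unfolding N_def by blast
  qed
  have hdP: "N - \<sigma> ` D = X"
  proof
    show "X \<subseteq> N - \<sigma> ` D" using arc(3) XY unfolding N_def by blast
    show "N - \<sigma> ` D \<subseteq> X"
    proof
      fix y assume y: "y \<in> N - \<sigma> ` D"
      show "y \<in> X"
      proof (rule ccontr)
        assume "y \<notin> X"
        then have "y \<in> \<sigma> ` (X \<union> M)" unfolding \<sigma>i(2) using y DT(1) unfolding N_def by auto
        then obtain x where x: "x \<in> X \<union> M" "y = \<sigma> x" by (rule imageE)
        then have "\<sigma> y = y" "y \<in> X \<union> M" using y unfolding D_def by auto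
        then have "y \<in> M" "y \<notin> D" using \<open>y \<notin> X\<close> unfolding D_def by auto
        then show False using y \<open>y \<notin> X\<close> XY(2) M unfolding N_def by blast
      qed
    qed
  qed
  have NP: "(\<Union>p\<in>P. set p) \<subseteq> N" using P(1) unfolding path_system_def by blast
  have ends: "hd p \<in> set p" "last p \<in> set p" if "p \<in> P" for p using P(1) that unfolding path_system_def by auto
  have "linking T A V U P X Y"
    unfolding linking_def
  proof (intro conjI)
    have "S \<subseteq> A" unfolding S_def using arc(1) by blast
    then have arcsA: "path_arcs p \<subseteq> A" if "p \<in> P" for p using P(2) that by blast
    show "\<forall>p\<in>P. dpath T A p"
    proof
      fix p assume p: "p \<in> P"
      then have "p \<noteq> []" "distinct p" "set p \<subseteq> N" using P(1) unfolding path_system_def by auto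
      then show "dpath T A p" unfolding dpath_def successively_iff_path_arcs using arcsA[OF p] NT by simp
    qed
    show "\<forall>p\<in>P. \<forall>q\<in>P. p \<noteq> q \<longrightarrow> set p \<inter> set q = {}" using P(1) unfolding path_system_def by blast
    show X: "hd ` P = X" and Y: "last ` P = Y" using P(3,4) hdP lastP by auto
    have "X \<subseteq> (\<Union>p\<in>P. set p)" "Y \<subseteq> (\<Union>p\<in>P. set p)" using ends X Y by blast+
    moreover have "V \<inter> N \<subseteq> X" using YV(1) DT(1) M unfolding N_def by blast
    moreover have "U \<inter> N \<subseteq> Y" using XU(1) DT(1) M unfolding N_def by blast
    ultimately show "V \<inter> (\<Union>p\<in>P. set p) = X" "U \<inter> (\<Union>p\<in>P. set p) = Y" using NP XY by blast+
  qed
  moreover have "(\<Sum>x\<in>X \<union> M. arc_weight A c V U x (\<sigma> x)) = (\<Sum>x\<in>D. arc_weight A c V U x (\<sigma> x))"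
    using finite_subset[OF DT(2) T(1)] DT(1)
    by (intro sum.mono_neutral_right) (auto simp: D_def arc_weight_def)
  moreover have "(\<Sum>x\<in>D. arc_weight A c V U x (\<sigma> x)) = ereal (\<Sum>x\<in>D. c (x, \<sigma> x))"
    using arc(4) by (simp flip: sum_ereal)
  moreover have "(\<Sum>x\<in>D. c (x, \<sigma> x)) = (\<Sum>a\<in>S. c a)"
    unfolding S_def by (subst sum.reindex) (auto simp: inj_on_def)
  ultimately show ?thesis using P(5) that by simp
qed

text \<open>The free matroid on M forces all of M to be covered on the right, and the contraction forces all of M
  to be matched on the left.\<close>

lemma network_induction_eq:
  assumes net: "directed_network T A V (ground g)" and cyc: "no_positive_cycle T A c V (ground g)"
    and M: "M = T - (V \<union> ground g)" and g: "setfun_wf g"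
  shows "network_induction T A c V g =
    contraction (induced (V \<union> M) (arc_weight A c V (ground g)) (vunion g (free_vm M))) M"
    (is "?L = contraction (induced _ ?w ?h) M")
proof (rule setfun_eqI)
  have T: "finite T" "V \<subseteq> T" using net unfolding directed_network_def by auto
  have MV: "finite M" "M \<inter> ground g = {}" "M \<inter> V = {}" using T M by auto
  note h = wf_vunion[OF g wf_free_vm[OF MV(1)]]
  have fV: "finite (V \<union> M)" using T MV by (auto intro: finite_subset)
  have wfI: "setfun_wf (induced (V \<union> M) ?w ?h)" using fV by (intro wf_induced[OF h]) auto
  show "ground ?L = ground (contraction (induced (V \<union> M) ?w ?h) M)"
    using MV(3) by (auto simp: network_induction_def)
  show "rnk ?L = rnk (contraction (induced (V \<union> M) ?w ?h) M)" by (simp add: network_induction_def)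
  fix X
  show "val ?L X = val (contraction (induced (V \<union> M) ?w ?h) M) X"
  proof (cases "X \<subseteq> V")
    case False
    then show ?thesis using MV(3)
      by (auto simp: network_induction_def ksubsets_def val_contraction[OF wfI])
  next
    case True
    then have R: "val (contraction (induced (V \<union> M) ?w ?h) M) X = max_induced ?w ?h (X \<union> M)"
      using MV(3) by (auto simp: val_contraction[OF wfI] val_induced)
    define Q where "Q = {ereal (\<Sum>a\<in>arcs_of P. c a) + val g Y | P Y.
                      Y \<in> ksubsets (ground g) (rnk g) \<and> linking T A V (ground g) P X Y}"
    have L: "val ?L X = (if X \<in> ksubsets V (rnk g) then Sup Q else -\<infinity>)"
      unfolding network_induction_def Q_def by simp
    have vh: "val ?h (Y \<union> M) = val g Y" if "Y \<subseteq> ground g" for Y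
    proof -
      have "Y \<union> M - M = Y" using that MV(2) by blast
      then show ?thesis using vunion_free_vm[OF g MV(1,2), of "Y \<union> M"] by simp
    qed
    have "Sup Q \<le> max_induced ?w ?h (X \<union> M)"
    proof (rule Sup_least)
      fix r assume "r \<in> Q"
      then obtain P Y where PY: "r = ereal (\<Sum>a\<in>arcs_of P. c a) + val g Y" "Y \<subseteq> ground g"
        "linking T A V (ground g) P X Y" unfolding Q_def ksubsets_def by blast
      obtain \<sigma> where \<sigma>: "bij_betw \<sigma> (X \<union> M) (Y \<union> M)"
        "(\<Sum>x\<in>X \<union> M. ?w x (\<sigma> x)) = ereal (\<Sum>a\<in>arcs_of P. c a)"
        using matching_of_linking[OF net PY(3) M] by metis
      have im: "\<sigma> ` (X \<union> M) = Y \<union> M" and inj: "inj_on \<sigma> (X \<union> M)" using \<sigma>(1) unfolding bij_betw_def by auto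
      have "(\<Sum>x\<in>X \<union> M. ?w x (\<sigma> x)) + val ?h (\<sigma> ` (X \<union> M)) \<le> max_induced ?w ?h (X \<union> M)"
        using PY(2) by (intro max_induced_ge[OF inj]) (auto simp: im)
      then show "r \<le> max_induced ?w ?h (X \<union> M)" unfolding PY(1) \<sigma>(2) im vh[OF PY(2)] .
    qed
    moreover have "max_induced ?w ?h (X \<union> M) \<le> val ?L X"
    proof (rule max_induced_le[OF h])
      show finXM: "finite (X \<union> M)" using fV True by (auto intro: finite_subset)
      fix \<sigma> assume \<sigma>: "inj_on \<sigma> (X \<union> M)" "\<And>x. x \<in> X \<union> M \<Longrightarrow> ?w x (\<sigma> x) \<noteq> -\<infinity>"
        "val ?h (\<sigma> ` (X \<union> M)) \<noteq> -\<infinity>"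
      define Y where "Y = \<sigma> ` (X \<union> M) - M"
      have "M \<subseteq> \<sigma> ` (X \<union> M)" and vY: "val ?h (\<sigma> ` (X \<union> M)) = val g Y" "val g Y \<noteq> -\<infinity>"
        using \<sigma>(3) unfolding vunion_free_vm[OF g MV(1,2)] Y_def by (auto split: if_splits)
      then have im: "\<sigma> ` (X \<union> M) = Y \<union> M" unfolding Y_def by blast
      have Y: "Y \<subseteq> ground g" "card Y = rnk g" using setfun_wfD(3,4)[OF g vY(2)] .
      have bij: "bij_betw \<sigma> (X \<union> M) (Y \<union> M)" using \<sigma>(1) im unfolding bij_betw_def by simp
      obtain P where P: "linking T A V (ground g) P X Y" "(\<Sum>x\<in>X \<union> M. ?w x (\<sigma> x)) \<le> ereal (\<Sum>a\<in>arcs_of P. c a)"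
        using linking_of_matching[OF net cyc M True Y(1) bij \<sigma>(2)] by blast
      have "X \<inter> M = {}" "Y \<inter> M = {}" using True MV Y(1) by auto
      moreover have "finite X" "finite Y" using finXM Y(1) setfun_wfD(1)[OF g] by (auto intro: finite_subset)
      ultimately have "card X = card Y" using bij_betw_same_card[OF bij] MV(1) by (simp add: card_Un_disjoint)
      then have X: "X \<in> ksubsets V (rnk g)" using True Y(2) by (simp add: ksubsets_def)
      have "ereal (\<Sum>a\<in>arcs_of P. c a) + val g Y \<le> Sup Q"
        using P(1) Y unfolding Q_def ksubsets_def by (intro Sup_upper) blast
      then show "(\<Sum>x\<in>X \<union> M. ?w x (\<sigma> x)) + val ?h (\<sigma> ` (X \<union> M)) \<le> val ?L X"
        unfolding vY(1) using L X P(2) by (auto intro: order_trans add_right_mono)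
    qed simp
    ultimately show ?thesis using L R by (auto intro!: antisym split: if_splits)
  qed
qed

text \<open>In a bipartite graph there are no inner nodes, and the direct sum and the contraction in
  \<open>network_induction_eq\<close> disappear.\<close>

lemma bipartite_induction_eq:
  assumes G: "bipartite_graph V (ground g) E" and g: "setfun_wf g"
  shows "bipartite_induction V E c g =
    induced V (\<lambda>x y. if (x, y) \<in> E then ereal (c (x, y)) else -\<infinity>) g"
proof -
  have net: "directed_network (V \<union> ground g) E V (ground g)" and dis: "V \<inter> ground g = {}"
    using G unfolding bipartite_graph_def by auto
  have fin: "finite V" using net unfolding directed_network_def by auto
  have "no_positive_cycle (V \<union> ground g) E c V (ground g)"
    unfolding no_positive_cycle_def dpath_def by (auto simp: Int_absorb2)
  then have eq: "bipartite_induction V E c g =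
      contraction (induced V (arc_weight E c V (ground g)) (vunion g (free_vm {}))) {}"
    using network_induction_eq[OF net _ _ g, of c "{}"] unfolding bipartite_induction_def by simp
  have h: "vunion g (free_vm {}) = g"
    using vunion_free_vm[OF g, of "{}"] by (intro setfun_eqI) auto
  have w: "induced V (arc_weight E c V (ground g)) g = induced V (\<lambda>x y. if (x, y) \<in> E then ereal (c (x, y)) else -\<infinity>) g"
    using dis by (intro induced_cong) (auto simp: arc_weight_def)
  have "setfun_wf (induced V (arc_weight E c V (ground g)) g)" using fin by (intro wf_induced[OF g]) auto
  then show ?thesis unfolding eq h w[symmetric]
    by (intro setfun_eqI) (auto simp: val_contraction val_induced)
qed

lemma complete_network_induction:
  fixes g :: "'a::infinite setfun"
  assumes C: "complete_class C" "g \<in> C"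
    and net: "directed_network T A V (ground g)" "no_positive_cycle T A c V (ground g)"
    and ne: "eff_dom (network_induction T A c V g) \<noteq> {}"
  shows "network_induction T A c V g \<in> C"
proof -
  note g = complete_wf[OF C]
  define M where "M = T - (V \<union> ground g)"
  have T: "finite T" "V \<subseteq> T" using net unfolding directed_network_def by auto
  have M: "finite M" "M \<inter> ground g = {}" "finite (V \<union> M)" using T unfolding M_def by (auto intro: finite_subset)
  let ?h = "vunion g (free_vm M)" and ?w = "arc_weight A c V (ground g)"
  note eq = network_induction_eq[OF net M_def g]
  obtain B where B: "val g B \<noteq> -\<infinity>" using complete_eff_dom[OF C] eff_dom_nonempty_iff[OF g] by blast
  have "B \<union> M - M = B" using setfun_wfD(3)[OF g B] M(2) by blast
  then have "val ?h (B \<union> M) \<noteq> -\<infinity>" using vunion_free_vm[OF g M(1,2), of "B \<union> M"] B by simp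
  then have "eff_dom ?h \<noteq> {}" using eff_dom_nonempty_iff wf_vunion[OF g wf_free_vm[OF M(1)]] by blast
  moreover have "free_vm M \<in> C" using complete_free_vm[OF C(1) _ M(1)] C(2) by blast
  ultimately have h: "?h \<in> C" using M(2) by (intro complete_direct_sum[OF C]) auto
  have wfI: "setfun_wf (induced (V \<union> M) ?w ?h)" using M(3) by (intro wf_induced complete_wf[OF C(1) h]) auto
  have MV: "M \<subseteq> V \<union> M" by blast
  obtain X where "val (contraction (induced (V \<union> M) ?w ?h) M) X \<noteq> -\<infinity>"
    using ne eff_dom_nonempty_iff[OF wf_contraction[OF wfI]] MV unfolding eq by auto
  then have "val (induced (V \<union> M) ?w ?h) (X \<union> M) \<noteq> -\<infinity>"
    using MV by (simp add: val_contraction[OF wfI] split: if_splits)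
  then have "eff_dom (induced (V \<union> M) ?w ?h) \<noteq> {}" using eff_dom_nonempty_iff[OF wfI] by blast
  then have "induced (V \<union> M) ?w ?h \<in> C" using M(3) by (intro complete_induced[OF C(1) h]) auto
  then show ?thesis using ne unfolding eq by (intro complete_contraction[OF C(1)]) auto
qed

lemma complete_bipartite_induction:
  fixes g :: "'a::infinite setfun"
  assumes C: "complete_class C" "g \<in> C" and G: "bipartite_graph V (ground g) E"
    and ne: "eff_dom (bipartite_induction V E c g) \<noteq> {}"
  shows "bipartite_induction V E c g \<in> C"
proof -
  have "finite V" using G unfolding bipartite_graph_def directed_network_def by auto
  then show ?thesis using ne unfolding bipartite_induction_eq[OF G complete_wf[OF C]]
    by (intro complete_induced[OF C]) auto
qed

section \<open>Presentations of valuated gammoids\<close>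

lemma max_free_ge:
  assumes "bij_betw \<sigma> A U"
  shows "(\<Sum>x\<in>A. w x (\<sigma> x)) \<le> max_induced w (free_vm U) A"
  using max_induced_ge[of \<sigma> A "free_vm U" w] assms by (simp add: bij_betw_def)

lemma max_free_le:
  assumes "finite A" "finite U" "\<And>x y. w x y \<noteq> \<infinity>"
    and le: "\<And>\<sigma>. bij_betw \<sigma> A U \<Longrightarrow> (\<And>x. x \<in> A \<Longrightarrow> w x (\<sigma> x) \<noteq> -\<infinity>) \<Longrightarrow> (\<Sum>x\<in>A. w x (\<sigma> x)) \<le> K"
  shows "max_induced w (free_vm U) A \<le> K"
proof (rule max_induced_le[OF wf_free_vm[OF assms(2)] assms(1)])
  fix \<sigma> assume \<sigma>: "inj_on \<sigma> A" "\<And>x. x \<in> A \<Longrightarrow> w x (\<sigma> x) \<noteq> -\<infinity>" "val (free_vm U) (\<sigma> ` A) \<noteq> -\<infinity>"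
  then have "\<sigma> ` A = U" by (auto split: if_splits)
  then show "(\<Sum>x\<in>A. w x (\<sigma> x)) + val (free_vm U) (\<sigma> ` A) \<le> K"
    using le[of \<sigma>] \<sigma>(1,2) by (simp add: bij_betw_def)
qed (rule assms(3))

lemma max_free_attained:
  assumes "finite A" "finite U" "\<And>x y. w x y \<noteq> \<infinity>" "max_induced w (free_vm U) A \<noteq> -\<infinity>"
  obtains \<sigma> where "bij_betw \<sigma> A U" "max_induced w (free_vm U) A = (\<Sum>x\<in>A. w x (\<sigma> x))"
proof (rule max_induced_attained[OF wf_free_vm[OF assms(2)] assms(1) _ assms(4)])
  fix \<sigma> assume \<sigma>: "inj_on \<sigma> A" "val (free_vm U) (\<sigma> ` A) \<noteq> -\<infinity>"
    and eq: "max_induced w (free_vm U) A = (\<Sum>x\<in>A. w x (\<sigma> x)) + val (free_vm U) (\<sigma> ` A)"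
  have "\<sigma> ` A = U" using \<sigma>(2) by (auto split: if_splits)
  then show thesis using that[of \<sigma>] \<sigma>(1) eq by (simp add: bij_betw_def)
qed (rule assms(3))

text \<open>Maximum matchings do not depend on the names of the nodes.  This is used to move between
  presentations over sum types and bipartite graphs inside one infinite type.\<close>

lemma max_free_transport:
  assumes fin: "finite A" "finite U" and w: "\<And>x y. w x y \<noteq> \<infinity>" and w': "\<And>x y. w' x y \<noteq> \<infinity>"
    and inj: "inj_on e A" "inj_on d U"
    and eq: "\<And>x y. x \<in> A \<Longrightarrow> y \<in> U \<Longrightarrow> w' (e x) (d y) = w x y"
  shows "max_induced w' (free_vm (d ` U)) (e ` A) = max_induced w (free_vm U) A"
proof (rule antisym)
  have be: "bij_betw e A (e ` A)" and bd: "bij_betw d U (d ` U)" using inj by (simp_all add: inj_on_imp_bij_betw)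
  show "max_induced w' (free_vm (d ` U)) (e ` A) \<le> max_induced w (free_vm U) A"
  proof (rule max_free_le)
    fix \<tau> assume \<tau>: "bij_betw \<tau> (e ` A) (d ` U)"
    define \<sigma> where "\<sigma> x = the_inv_into U d (\<tau> (e x))" for x
    have "bij_betw (the_inv_into U d \<circ> (\<tau> \<circ> e)) A U"
      using bij_betw_trans[OF bij_betw_trans[OF be \<tau>] bij_betw_the_inv_into[OF bd]] .
    then have \<sigma>: "bij_betw \<sigma> A U" unfolding \<sigma>_def comp_def .
    have "w' (e x) (\<tau> (e x)) = w x (\<sigma> x)" if "x \<in> A" for x
    proof -
      have "\<tau> (e x) \<in> d ` U" using \<tau> that unfolding bij_betw_def by blast
      then have "d (\<sigma> x) = \<tau> (e x)" unfolding \<sigma>_def using inj(2) by (rule f_the_inv_into_f[rotated])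
      moreover have "\<sigma> x \<in> U" using \<sigma> that by (metis bij_betwE)
      ultimately show ?thesis using eq[OF that] by metis
    qed
    then have "(\<Sum>x\<in>e ` A. w' x (\<tau> x)) = (\<Sum>x\<in>A. w x (\<sigma> x))"
      unfolding sum.reindex[OF inj(1)] comp_def by (rule sum.cong[OF refl])
    also have "\<dots> \<le> max_induced w (free_vm U) A" using \<sigma> by (rule max_free_ge)
    finally show "(\<Sum>x\<in>e ` A. w' x (\<tau> x)) \<le> max_induced w (free_vm U) A" .
  qed (use fin w' in auto)
  show "max_induced w (free_vm U) A \<le> max_induced w' (free_vm (d ` U)) (e ` A)"
  proof (rule max_free_le[OF fin w])
    fix \<sigma> assume \<sigma>: "bij_betw \<sigma> A U"
    define \<tau> where "\<tau> y = d (\<sigma> (the_inv_into A e y))" for y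
    have "bij_betw (d \<circ> (\<sigma> \<circ> the_inv_into A e)) (e ` A) (d ` U)"
      using bij_betw_trans[OF bij_betw_trans[OF bij_betw_the_inv_into[OF be] \<sigma>] bd] .
    then have \<tau>: "bij_betw \<tau> (e ` A) (d ` U)" unfolding \<tau>_def comp_def .
    have "w x (\<sigma> x) = w' (e x) (\<tau> (e x))" if "x \<in> A" for x
    proof -
      have "\<tau> (e x) = d (\<sigma> x)" unfolding \<tau>_def using that by (simp add: the_inv_into_f_f[OF inj(1)])
      moreover have "\<sigma> x \<in> U" using \<sigma> that by (metis bij_betwE)
      ultimately show ?thesis using eq[OF that] by metis
    qed
    then have "(\<Sum>x\<in>A. w x (\<sigma> x)) = (\<Sum>x\<in>e ` A. w' x (\<tau> x))"
      unfolding sum.reindex[OF inj(1)] comp_def by (rule sum.cong[OF refl])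
    also have "\<dots> \<le> max_induced w' (free_vm (d ` U)) (e ` A)" using \<tau> by (rule max_free_ge)
    finally show "(\<Sum>x\<in>A. w x (\<sigma> x)) \<le> max_induced w' (free_vm (d ` U)) (e ` A)" .
  qed
qed

text \<open>The side sets W and U may have any types, so that new nodes can be formed by disjoint sums without a
  choice of fresh elements.\<close>

definition gammoid :: "'a set \<Rightarrow> 'b set \<Rightarrow> 'c set \<Rightarrow> ('a + 'b \<Rightarrow> 'c \<Rightarrow> ereal) \<Rightarrow> 'a setfun" where
  "gammoid V W U w = Setfun V (card U - card W)
     (\<lambda>X. if X \<subseteq> V then max_induced w (free_vm U) (X <+> W) else -\<infinity>)"

definition presentation :: "'a set \<Rightarrow> 'b set \<Rightarrow> 'c set \<Rightarrow> ('a + 'b \<Rightarrow> 'c \<Rightarrow> ereal) \<Rightarrow> bool" where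
  "presentation V W U w \<longleftrightarrow> finite V \<and> finite W \<and> finite U \<and> (\<forall>x y. w x y \<noteq> \<infinity>)"

lemma ground_gammoid [simp]: "ground (gammoid V W U w) = V"
  and rnk_gammoid [simp]: "rnk (gammoid V W U w) = card U - card W"
  and val_gammoid: "val (gammoid V W U w) X =
      (if X \<subseteq> V then max_induced w (free_vm U) (X <+> W) else -\<infinity>)"
  by (simp_all add: gammoid_def)

lemma presentationD:
  assumes "presentation V W U w"
  shows "finite V" "finite W" "finite U" "w x y \<noteq> \<infinity>" "X \<subseteq> V \<Longrightarrow> finite X" "X \<subseteq> V \<Longrightarrow> finite (X <+> W)"
  using assms unfolding presentation_def by (auto intro: finite_subset)

lemma gammoid_attained:
  assumes P: "presentation V W U w" and ne: "val (gammoid V W U w) X \<noteq> -\<infinity>"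
  obtains \<sigma> where "X \<subseteq> V" "bij_betw \<sigma> (X <+> W) U" "val (gammoid V W U w) X = (\<Sum>x\<in>X <+> W. w x (\<sigma> x))"
proof -
  have X: "X \<subseteq> V" "max_induced w (free_vm U) (X <+> W) \<noteq> -\<infinity>"
    using ne by (auto simp: val_gammoid split: if_splits)
  show ?thesis using that X
    by (auto simp: val_gammoid intro: max_free_attained[OF presentationD(6,3,4)[OF P], OF X(1) X(2)])
qed

lemma gammoid_ge:
  assumes "X \<subseteq> V" "bij_betw \<sigma> (X <+> W) U"
  shows "(\<Sum>x\<in>X <+> W. w x (\<sigma> x)) \<le> val (gammoid V W U w) X"
  using max_free_ge[OF assms(2), of w] assms(1) by (simp add: val_gammoid)

lemma wf_gammoid:
  assumes P: "presentation V W U w"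
  shows "setfun_wf (gammoid V W U w)"
proof (rule setfun_wfI)
  show "finite (ground (gammoid V W U w))" using presentationD(1)[OF P] by simp
  fix X
  show "val (gammoid V W U w) X \<noteq> \<infinity>"
  proof (cases "val (gammoid V W U w) X = -\<infinity>")
    case False
    then obtain \<sigma> where "val (gammoid V W U w) X = (\<Sum>x\<in>X <+> W. w x (\<sigma> x))"
      using gammoid_attained[OF P] by metis
    then show ?thesis using presentationD(4)[OF P] by (simp add: sum_not_PInf)
  qed simp
  assume "val (gammoid V W U w) X \<noteq> -\<infinity>"
  then obtain \<sigma> where \<sigma>: "X \<subseteq> V" "bij_betw \<sigma> (X <+> W) U" using gammoid_attained[OF P] by metis
  then have "card X + card W = card U"
    using bij_betw_same_card[OF \<sigma>(2)] presentationD(2,5)[OF P] by (simp add: card_Plus)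
  then show "X \<subseteq> ground (gammoid V W U w) \<and> card X = rnk (gammoid V W U w)" using \<sigma>(1) by simp
qed

section \<open>The exchange axiom for gammoids\<close>

lemma bij_betw_insert_new:
  assumes "bij_betw f A U" "b \<notin> A" "u \<notin> U" "finite A"
  shows "bij_betw (f(b := u)) (insert b A) (insert u U)"
    "(\<Sum>x\<in>insert b A. w x ((f(b := u)) x)) = (w b u + (\<Sum>x\<in>A. w x (f x)) :: ereal)"
proof -
  have agree: "(f(b := u)) x = f x" if "x \<in> A" for x using that assms(2) by auto
  have "bij_betw (f(b := u)) A U" using assms(1) agree bij_betw_cong by metis
  then show "bij_betw (f(b := u)) (insert b A) (insert u U)"
    using notIn_Un_bij_betw[of b A "f(b := u)" U] assms(2,3) by simp
  have "(\<Sum>x\<in>A. w x ((f(b := u)) x)) = (\<Sum>x\<in>A. w x (f x))" using agree by (intro sum.cong) simp_all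
  then show "(\<Sum>x\<in>insert b A. w x ((f(b := u)) x)) = w b u + (\<Sum>x\<in>A. w x (f x))"
    using assms(2,4) by simp
qed

lemma bij_betw_remove_one:
  assumes "bij_betw f A U" "i \<in> A"
  shows "bij_betw f (A - {i}) (U - {f i})"
  using assms unfolding bij_betw_def by (auto simp: inj_on_image_set_diff intro: inj_on_subset dest: inj_onD)

text \<open>The alternating path from i: i is matched to u by \<open>\<sigma>\<close>, and u is matched to some b by \<open>\<tau>\<close>.  If b is
  not in A, the two edges at u are swapped and b is the element sought.  Otherwise u, i in A and b in B
  are removed, and the path continues at b in the smaller instance; afterwards \<open>\<sigma>\<close> gets the edge from b
  to u and \<open>\<tau>\<close> the edge from i to u.  Only the assignment of edges to the two matchings changes, so the
  total weight is kept.\<close>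

lemma matching_exchange:
  fixes w :: "'b \<Rightarrow> 'c \<Rightarrow> ereal"
  assumes "finite A" "finite B" "bij_betw \<sigma> A U" "bij_betw \<tau> B U" "i \<in> A - B"
  shows "\<exists>j\<in>B - A. \<exists>\<sigma>' \<tau>'. bij_betw \<sigma>' (insert j (A - {i})) U \<and> bij_betw \<tau>' (insert i (B - {j})) U \<and>
     (\<Sum>x\<in>A. w x (\<sigma> x)) + (\<Sum>x\<in>B. w x (\<tau> x)) =
     (\<Sum>x\<in>insert j (A - {i}). w x (\<sigma>' x)) + (\<Sum>x\<in>insert i (B - {j}). w x (\<tau>' x))"
  using assms
proof (induction "card A" arbitrary: A B U \<sigma> \<tau> i rule: less_induct)
  case less
  note fin = less.prems(1,2) and \<sigma> = less.prems(3) and \<tau> = less.prems(4) and i = less.prems(5)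
  define u where "u = \<sigma> i"
  have u: "u \<in> U" using \<sigma> i unfolding u_def bij_betw_def by blast
  have "u \<in> \<tau> ` B" using u \<tau> unfolding bij_betw_def by simp
  then obtain b where b: "b \<in> B" "\<tau> b = u" by (metis imageE)
  have \<sigma>0: "bij_betw \<sigma> (A - {i}) (U - {u})" and \<tau>0: "bij_betw \<tau> (B - {b}) (U - {u})"
    using bij_betw_remove_one[OF \<sigma>, of i] bij_betw_remove_one[OF \<tau> b(1)] i b(2) unfolding u_def by auto
  have U: "insert u (U - {u}) = U" using u by (rule insert_Diff)
  have sums: "(\<Sum>x\<in>A. w x (\<sigma> x)) = w i u + (\<Sum>x\<in>A - {i}. w x (\<sigma> x))"
    "(\<Sum>x\<in>B. w x (\<tau> x)) = w b u + (\<Sum>x\<in>B - {b}. w x (\<tau> x))"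
    using sum.remove[OF fin(1), of i "\<lambda>x. w x (\<sigma> x)"] sum.remove[OF fin(2) b(1), of "\<lambda>x. w x (\<tau> x)"] i b(2)
    unfolding u_def by auto
  show ?case
  proof (cases "b \<in> A")
    case False
    have nb: "b \<notin> A - {i}" "i \<notin> B - {b}" using False i by auto
    note \<sigma>' = bij_betw_insert_new(1)[OF \<sigma>0 nb(1), where u=u, unfolded U]
      bij_betw_insert_new(2)[OF \<sigma>0 nb(1), where u=u and w=w, unfolded U]
    note \<tau>' = bij_betw_insert_new(1)[OF \<tau>0 nb(2), where u=u, unfolded U]
      bij_betw_insert_new(2)[OF \<tau>0 nb(2), where u=u and w=w, unfolded U]
    have "(\<Sum>x\<in>A. w x (\<sigma> x)) + (\<Sum>x\<in>B. w x (\<tau> x)) =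
      (\<Sum>x\<in>insert b (A - {i}). w x ((\<sigma>(b := u)) x)) + (\<Sum>x\<in>insert i (B - {b}). w x ((\<tau>(i := u)) x))"
      unfolding sums using \<sigma>'(2) \<tau>'(2) fin by (simp add: ac_simps del: fun_upd_apply)
    moreover have "bij_betw (\<sigma>(b := u)) (insert b (A - {i})) U" "bij_betw (\<tau>(i := u)) (insert i (B - {b})) U"
      using \<sigma>'(1) \<tau>'(1) fin by auto
    ultimately show ?thesis using False b(1) by blast
  next
    case True
    have "card (A - {i}) < card A" using fin(1) i by (meson DiffD1 card_Diff1_less)
    moreover have "b \<in> (A - {i}) - (B - {b})" using True i b(1) by auto
    ultimately obtain j \<sigma>1 \<tau>1 where j: "j \<in> (B - {b}) - (A - {i})"
      and \<sigma>1: "bij_betw \<sigma>1 (insert j (A - {i} - {b})) (U - {u})"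
      and \<tau>1: "bij_betw \<tau>1 (insert b (B - {b} - {j})) (U - {u})"
      and eq: "(\<Sum>x\<in>A - {i}. w x (\<sigma> x)) + (\<Sum>x\<in>B - {b}. w x (\<tau> x)) =
         (\<Sum>x\<in>insert j (A - {i} - {b}). w x (\<sigma>1 x)) + (\<Sum>x\<in>insert b (B - {b} - {j}). w x (\<tau>1 x))"
      using less.hyps[of "A - {i}" "B - {b}" \<sigma> "U - {u}" \<tau> b] fin \<sigma>0 \<tau>0 by auto
    have jA: "j \<in> B - A" using j i by auto
    have nb: "b \<notin> insert j (A - {i} - {b})" "i \<notin> insert b (B - {b} - {j})" using j i b(1) by auto
    have sets: "insert b (insert j (A - {i} - {b})) = insert j (A - {i})"
      "insert i (insert b (B - {b} - {j})) = insert i (B - {j})" using True i j b(1) by auto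
    note \<sigma>' = bij_betw_insert_new(1)[OF \<sigma>1 nb(1), where u=u, unfolded U sets]
      bij_betw_insert_new(2)[OF \<sigma>1 nb(1), where u=u and w=w, unfolded U sets]
    note \<tau>' = bij_betw_insert_new(1)[OF \<tau>1 nb(2), where u=u, unfolded U sets]
      bij_betw_insert_new(2)[OF \<tau>1 nb(2), where u=u and w=w, unfolded U sets]
    have "(\<Sum>x\<in>A. w x (\<sigma> x)) + (\<Sum>x\<in>B. w x (\<tau> x)) =
        w i u + w b u + ((\<Sum>x\<in>A - {i}. w x (\<sigma> x)) + (\<Sum>x\<in>B - {b}. w x (\<tau> x)))"
      unfolding sums by (simp only: ac_simps)
    also have "\<dots> = (\<Sum>x\<in>insert j (A - {i}). w x ((\<sigma>1(b := u)) x)) + (\<Sum>x\<in>insert i (B - {j}). w x ((\<tau>1(i := u)) x))"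
      unfolding eq using \<sigma>'(2) \<tau>'(2) fin by (simp add: ac_simps del: fun_upd_apply)
    finally have "(\<Sum>x\<in>A. w x (\<sigma> x)) + (\<Sum>x\<in>B. w x (\<tau> x)) =
       (\<Sum>x\<in>insert j (A - {i}). w x ((\<sigma>1(b := u)) x)) + (\<Sum>x\<in>insert i (B - {j}). w x ((\<tau>1(i := u)) x))" .
    moreover have "bij_betw (\<sigma>1(b := u)) (insert j (A - {i})) U" "bij_betw (\<tau>1(i := u)) (insert i (B - {j})) U"
      using \<sigma>'(1) \<tau>'(1) fin by auto
    ultimately show ?thesis using jA by blast
  qed
qed

lemma valuated_matroid_gammoid:
  assumes P: "presentation V W U w" and ne: "eff_dom (gammoid V W U w) \<noteq> {}"
  shows "valuated_matroid (gammoid V W U w)"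
proof -
  let ?f = "gammoid V W U w"
  note wf = wf_gammoid[OF P]
  have "val ?f X + val ?f Y \<le> (SUP j\<in>Y - X. val ?f (insert j (X - {i})) + val ?f (insert i (Y - {j})))"
    if i: "i \<in> X - Y" for X Y i
  proof (cases "val ?f X = -\<infinity> \<or> val ?f Y = -\<infinity>")
    case True
    then show ?thesis using setfun_wfD(2)[OF wf] by (intro add_MInf_le) auto
  next
    case False
    obtain \<sigma> where \<sigma>: "X \<subseteq> V" "bij_betw \<sigma> (X <+> W) U" "val ?f X = (\<Sum>x\<in>X <+> W. w x (\<sigma> x))"
      using gammoid_attained[OF P] False by metis
    obtain \<tau> where \<tau>: "Y \<subseteq> V" "bij_betw \<tau> (Y <+> W) U" "val ?f Y = (\<Sum>x\<in>Y <+> W. w x (\<tau> x))"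
      using gammoid_attained[OF P] False by metis
    have i': "Inl i \<in> (X <+> W) - (Y <+> W)" using i by auto
    obtain k \<sigma>' \<tau>' where k: "k \<in> (Y <+> W) - (X <+> W)"
      and m: "bij_betw \<sigma>' (insert k ((X <+> W) - {Inl i})) U" "bij_betw \<tau>' (insert (Inl i) ((Y <+> W) - {k})) U"
      "(\<Sum>x\<in>X <+> W. w x (\<sigma> x)) + (\<Sum>x\<in>Y <+> W. w x (\<tau> x)) =
        (\<Sum>x\<in>insert k ((X <+> W) - {Inl i}). w x (\<sigma>' x)) +
          (\<Sum>x\<in>insert (Inl i) ((Y <+> W) - {k}). w x (\<tau>' x))"
      using matching_exchange[OF presentationD(6)[OF P \<sigma>(1)] presentationD(6)[OF P \<tau>(1)] \<sigma>(2) \<tau>(2) i', of w]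
      by (elim bexE exE conjE) (rule that)
    obtain j where j: "k = Inl j" "j \<in> Y - X" using k by (cases k) auto
    have sets: "insert k ((X <+> W) - {Inl i}) = insert j (X - {i}) <+> W"
      "insert (Inl i) ((Y <+> W) - {k}) = insert i (Y - {j}) <+> W" unfolding j(1) by auto
    have "val ?f X + val ?f Y \<le> val ?f (insert j (X - {i})) + val ?f (insert i (Y - {j}))"
    proof -
      note m' = m[unfolded sets]
      have "insert j (X - {i}) \<subseteq> V" "insert i (Y - {j}) \<subseteq> V" using \<sigma>(1) \<tau>(1) i j(2) by auto
      then show ?thesis unfolding \<sigma>(3) \<tau>(3) m'(3) by (intro add_mono gammoid_ge m'(1,2))
    qed
    also have "\<dots> \<le> (SUP j\<in>Y - X. val ?f (insert j (X - {i})) + val ?f (insert i (Y - {j})))"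
      using j(2) by (intro SUP_upper)
    finally show ?thesis .
  qed
  then show ?thesis using wf ne unfolding valuated_matroid_def setfun_wf_def by blast
qed

section \<open>Duals of gammoids\<close>

lemma bij_betw_case_sum:
  assumes "bij_betw f A C" "bij_betw g B D" "C \<inter> D = {}"
  shows "bij_betw (case_sum f g) (A <+> B) (C \<union> D)"
proof (rule bij_betw_imageI)
  have inj: "inj_on f A" "inj_on g B" and im: "f ` A = C" "g ` B = D" using assms unfolding bij_betw_def by auto
  have ne: "f a \<noteq> g b" if "a \<in> A" "b \<in> B" for a b using that im assms(3) by (metis IntI empty_iff imageI)
  show "inj_on (case_sum f g) (A <+> B)"
  proof (rule inj_onI)
    fix x y assume "x \<in> A <+> B" "y \<in> A <+> B" "case_sum f g x = case_sum f g y"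
    then show "x = y" using inj ne ne[symmetric] by (cases x; cases y) (auto dest: inj_onD)
  qed
  show "case_sum f g ` (A <+> B) = C \<union> D"
    unfolding Plus_def image_Un image_image using im by simp
qed

text \<open>On a disjoint sum, a bijection is determined by an injection of the left part and a bijection of the
  right part onto what is left over.\<close>

lemma bij_betw_Plus_split:
  assumes "bij_betw \<tau> (A <+> B) E"
  shows "inj_on (\<lambda>x. \<tau> (Inl x)) A" "bij_betw (\<lambda>y. \<tau> (Inr y)) B (E - (\<lambda>x. \<tau> (Inl x)) ` A)"
proof -
  have inj: "inj_on \<tau> (A <+> B)" and im: "\<tau> ` (A <+> B) = E" using assms unfolding bij_betw_def by auto
  show "inj_on (\<lambda>x. \<tau> (Inl x)) A" using inj by (auto simp: inj_on_def)
  have "\<tau> (Inr y) \<noteq> \<tau> (Inl x)" if "x \<in> A" "y \<in> B" for x y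
    using inj_onD[OF inj _ InlI[OF that(1)] InrI[OF that(2)]] by auto
  then have "(\<lambda>y. \<tau> (Inr y)) ` B = E - (\<lambda>x. \<tau> (Inl x)) ` A"
    unfolding im[symmetric] by (auto simp: Plus_def image_Un image_image)
  moreover have "inj_on (\<lambda>y. \<tau> (Inr y)) B" using inj by (auto simp: inj_on_def)
  ultimately show "bij_betw (\<lambda>y. \<tau> (Inr y)) B (E - (\<lambda>x. \<tau> (Inl x)) ` A)" unfolding bij_betw_def by blast
qed

lemma sum_Plus:
  assumes "finite A" "finite B"
  shows "(\<Sum>x\<in>A <+> B. h x) = (\<Sum>x\<in>A. h (Inl x)) + (\<Sum>x\<in>B. h (Inr x))"
  using sum.Plus[OF assms, of h] by (simp add: comp_def)

text \<open>The transpose of w on the nodes of U, and the identity matching on V.\<close>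

definition dual_weight :: "('a + 'b \<Rightarrow> 'c \<Rightarrow> ereal) \<Rightarrow> 'a + 'c \<Rightarrow> 'a + 'b \<Rightarrow> ereal" where
  "dual_weight w x y = (case x of Inl v \<Rightarrow> diag (Inl v) y | Inr u \<Rightarrow> w y u)"

lemma presentation_dual:
  "presentation V W U w \<Longrightarrow> presentation V U (V <+> W) (dual_weight w)"
  by (auto simp: presentation_def dual_weight_def split: sum.splits)

text \<open>A matching of Z + U onto V + W must match each z in Z to itself.  The rest of it matches U onto X + W
  with X = V - Z, and its inverse is a matching counted for X.\<close>

lemma dual_gammoid:
  assumes P: "presentation V W U w" and ne: "eff_dom (gammoid V W U w) \<noteq> {}"
  shows "dual (gammoid V W U w) = gammoid V U (V <+> W) (dual_weight w)"
proof (rule setfun_eqI)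
  note wf = wf_gammoid[OF P] and P' = presentation_dual[OF P] and fin = presentationD[OF P]
  obtain X \<sigma> where X: "X \<subseteq> V" "bij_betw \<sigma> (X <+> W) U"
    using ne eff_dom_nonempty_iff[OF wf] gammoid_attained[OF P] by metis
  then have "card U = card X + card W"
    using bij_betw_same_card[OF X(2)] fin(2,5) by (simp add: card_Plus)
  then show "rnk (dual (gammoid V W U w)) = rnk (gammoid V U (V <+> W) (dual_weight w))"
    using fin(1,2) by (simp add: card_Plus)
  fix Z
  show "val (dual (gammoid V W U w)) Z = val (gammoid V U (V <+> W) (dual_weight w)) Z"
  proof (cases "Z \<subseteq> V")
    case True
    define X where "X = V - Z"
    have VX: "X \<subseteq> V" "V <+> W - Inl ` Z = X <+> W" "Inl ` Z \<union> (X <+> W) = V <+> W" "Inl ` Z \<inter> (X <+> W) = {}"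
      using True unfolding X_def by auto
    have finZ: "finite Z" using True fin(5) by blast
    have "max_induced w (free_vm U) (X <+> W) \<le> max_induced (dual_weight w) (free_vm (V <+> W)) (Z <+> U)"
    proof (rule max_free_le[OF fin(6)[OF VX(1)] fin(3,4)])
      fix \<sigma> assume \<sigma>: "bij_betw \<sigma> (X <+> W) U"
      define \<rho> where "\<rho> = the_inv_into (X <+> W) \<sigma>"
      have \<rho>: "bij_betw \<rho> U (X <+> W)" unfolding \<rho>_def using \<sigma> by (rule bij_betw_the_inv_into)
      have r: "\<rho> (\<sigma> x) = x" if "x \<in> X <+> W" for x
        unfolding \<rho>_def using \<sigma> that by (auto simp: bij_betw_def intro: the_inv_into_f_f)
      have \<tau>: "bij_betw (case_sum Inl \<rho>) (Z <+> U) (V <+> W)"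
        using bij_betw_case_sum[of Inl Z "Inl ` Z" \<rho> U "X <+> W"] \<rho> VX by (simp add: bij_betw_def)
      have "(\<Sum>x\<in>X <+> W. w x (\<sigma> x)) = (\<Sum>x\<in>X <+> W. w (\<rho> (\<sigma> x)) (\<sigma> x))" using r by (intro sum.cong) auto
      also have "\<dots> = (\<Sum>u\<in>U. w (\<rho> u) u)" using sum.reindex_bij_betw[OF \<sigma>] .
      also have "\<dots> = (\<Sum>x\<in>Z <+> U. dual_weight w x (case_sum Inl \<rho> x))"
        by (simp add: sum_Plus[OF finZ fin(3)] dual_weight_def)
      also have "\<dots> \<le> max_induced (dual_weight w) (free_vm (V <+> W)) (Z <+> U)" using \<tau> by (rule max_free_ge)
      finally show "(\<Sum>x\<in>X <+> W. w x (\<sigma> x)) \<le> max_induced (dual_weight w) (free_vm (V <+> W)) (Z <+> U)" .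
    qed
    moreover have "max_induced (dual_weight w) (free_vm (V <+> W)) (Z <+> U) \<le> max_induced w (free_vm U) (X <+> W)"
    proof (rule max_free_le[OF presentationD(6,3,4)[OF P']])
      fix \<tau> assume \<tau>: "bij_betw \<tau> (Z <+> U) (V <+> W)" "\<And>x. x \<in> Z <+> U \<Longrightarrow> dual_weight w x (\<tau> x) \<noteq> -\<infinity>"
      have \<tau>Z: "\<tau> (Inl z) = Inl z" if "z \<in> Z" for z
        using \<tau>(2)[OF InlI[OF that]] by (auto simp: dual_weight_def)
      then have "(\<lambda>z. \<tau> (Inl z)) ` Z = Inl ` Z" by (intro image_cong) auto
      then have \<rho>: "bij_betw (\<lambda>u. \<tau> (Inr u)) U (X <+> W)"
        using bij_betw_Plus_split(2)[OF \<tau>(1)] VX(2) by simp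
      define \<sigma> where "\<sigma> = the_inv_into U (\<lambda>u. \<tau> (Inr u))"
      have \<sigma>: "bij_betw \<sigma> (X <+> W) U" unfolding \<sigma>_def using \<rho> by (rule bij_betw_the_inv_into)
      have s: "\<sigma> (\<tau> (Inr u)) = u" if "u \<in> U" for u
        unfolding \<sigma>_def using that \<rho> the_inv_into_f_f[of "\<lambda>u. \<tau> (Inr u)" U u] by (simp add: bij_betw_def)
      have "(\<Sum>x\<in>Z <+> U. dual_weight w x (\<tau> x)) = (\<Sum>u\<in>U. w (\<tau> (Inr u)) u)"
        using \<tau>Z by (simp add: sum_Plus[OF finZ fin(3)] dual_weight_def)
      also have "\<dots> = (\<Sum>u\<in>U. w (\<tau> (Inr u)) (\<sigma> (\<tau> (Inr u))))" using s by (intro sum.cong) auto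
      also have "\<dots> = (\<Sum>x\<in>X <+> W. w x (\<sigma> x))"
        using sum.reindex_bij_betw[OF \<rho>, of "\<lambda>x. w x (\<sigma> x)"] .
      also have "\<dots> \<le> max_induced w (free_vm U) (X <+> W)" using \<sigma> by (rule max_free_ge)
      finally show "(\<Sum>x\<in>Z <+> U. dual_weight w x (\<tau> x)) \<le> max_induced w (free_vm U) (X <+> W)" .
    qed (rule True)
    ultimately show ?thesis using True VX(1)
      by (simp add: val_dual[OF wf ne] val_gammoid X_def)
  qed (simp add: val_dual[OF wf ne] val_gammoid)
qed simp

text \<open>Here \<open>\<tau>\<close> is a copy of \<open>\<sigma>\<close> along the embeddings e and d, typically of summands into a disjoint sum.\<close>

lemma bij_betw_image_iff:
  assumes "inj_on e A" "inj d" "\<And>x. x \<in> A \<Longrightarrow> \<tau> (e x) = d (\<sigma> x)"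
  shows "bij_betw \<tau> (e ` A) (d ` U) \<longleftrightarrow> bij_betw \<sigma> A U"
proof -
  have "bij_betw \<tau> (e ` A) (d ` U) \<longleftrightarrow> bij_betw (\<tau> \<circ> e) A (d ` U)"
    using bij_betw_comp_iff[of e A "e ` A" \<tau> "d ` U"] assms(1) by (simp add: inj_on_imp_bij_betw)
  also have "\<dots> \<longleftrightarrow> bij_betw (\<lambda>x. d (\<sigma> x)) A (d ` U)"
    using assms(3) by (intro bij_betw_cong) simp
  also have "\<dots> \<longleftrightarrow> bij_betw \<sigma> A U"
    unfolding bij_betw_def image_image[symmetric, of d \<sigma>] inj_image_eq_iff[OF assms(2)]
    using assms(2) by (auto simp: inj_on_def)
  finally show ?thesis .
qed

section \<open>Functions induced from gammoids\<close>

text \<open>The old ground set appears twice, as a contracted set on the left and as a set to be covered on the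
  right; the two copies are joined by the identity matching.\<close>

definition induced_weight ::
  "('a \<Rightarrow> 'd \<Rightarrow> ereal) \<Rightarrow> ('d + 'b \<Rightarrow> 'c \<Rightarrow> ereal) \<Rightarrow> 'a + ('d + 'b) \<Rightarrow> 'd + 'c \<Rightarrow> ereal" where
  "induced_weight c w x y = (case (x, y) of
      (Inl v, Inl u) \<Rightarrow> c v u
    | (Inr (Inl v), Inl u) \<Rightarrow> diag v u
    | (Inr k, Inr r) \<Rightarrow> w k r
    | _ \<Rightarrow> -\<infinity>)"

lemma induced_weight_simps [simp]:
  "induced_weight c w (Inl v) (Inl u) = c v u"
  "induced_weight c w (Inl v) (Inr r) = -\<infinity>"
  "induced_weight c w (Inr (Inl v')) (Inl u) = diag v' u"
  "induced_weight c w (Inr (Inr m)) (Inl u) = -\<infinity>"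
  "induced_weight c w (Inr k) (Inr r) = w k r"
  by (auto simp: induced_weight_def split: sum.splits)

lemma presentation_induced:
  assumes "presentation V0 W R w" "finite V" "\<And>x y. c x y \<noteq> \<infinity>"
  shows "presentation V (V0 <+> W) (V0 <+> R) (induced_weight c w)"
  using assms by (auto simp: presentation_def induced_weight_def split: sum.splits)

text \<open>In a matching of X + (V0 + W) onto V0 + R, let Y be the set of right copies that are matched to X.  A
  left copy of an element outside Y has to be matched to its right copy, since nothing else can cover
  that; a left copy of an element of Y cannot, and so is matched into R together with W.  Hence such
  a matching consists of a matching of X onto Y and a matching of Y + W onto R.\<close>

lemma induced_gammoid:
  assumes P: "presentation V0 W R w" and V: "finite V" and c: "\<And>x y. c x y \<noteq> \<infinity>"
  shows "induced V c (gammoid V0 W R w) = gammoid V (V0 <+> W) (V0 <+> R) (induced_weight c w)"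
    (is "induced V c ?g = gammoid V ?W ?R ?w")
proof (rule setfun_eqI)
  note g = wf_gammoid[OF P] and fin = presentationD[OF P]
  note P' = presentation_induced[OF P V c]
  show "rnk (induced V c ?g) = rnk (gammoid V ?W ?R ?w)" using fin(1-3) by (simp add: card_Plus)
  fix X
  show "val (induced V c ?g) X = val (gammoid V ?W ?R ?w) X"
  proof (cases "X \<subseteq> V")
    case True
    note finX = presentationD(5)[OF P' True]
    have "max_induced c ?g X \<le> val (gammoid V ?W ?R ?w) X"
    proof (rule max_induced_le[OF g finX])
      fix \<sigma> assume \<sigma>: "inj_on \<sigma> X" "val ?g (\<sigma> ` X) \<noteq> -\<infinity>"
      define Y where "Y = \<sigma> ` X"
      obtain \<rho> where Y: "Y \<subseteq> V0" and \<rho>: "bij_betw \<rho> (Y <+> W) R" "val ?g Y = (\<Sum>x\<in>Y <+> W. w x (\<rho> x))"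
        using gammoid_attained[OF P \<sigma>(2)] unfolding Y_def by metis
      define \<kappa> where "\<kappa> k = (if k \<in> Y <+> W then Inr (\<rho> k) else Inl (projl k))" for k
      have W: "?W = (Y <+> W) \<union> Inl ` (V0 - Y)" "(Y <+> W) \<inter> Inl ` (V0 - Y) = {}" using Y by auto
      have \<kappa>Y: "\<kappa> k = Inr (\<rho> k)" if "k \<in> Y <+> W" for k using that unfolding \<kappa>_def by simp
      have \<kappa>V: "\<kappa> (Inl v) = Inl v" if "v \<in> V0 - Y" for v using that unfolding \<kappa>_def by auto
      have "bij_betw (Inr \<circ> \<rho>) (Y <+> W) (Inr ` R)" using \<rho>(1) by (rule bij_betw_trans) (simp add: bij_betw_def)
      then have b1: "bij_betw \<kappa> (Y <+> W) (Inr ` R)" using bij_betw_cong[of "Y <+> W" \<kappa> "Inr \<circ> \<rho>"] \<kappa>Y by simp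
      have b2: "bij_betw \<kappa> (Inl ` (V0 - Y)) (Inl ` (V0 - Y))"
        using \<kappa>V by (simp add: bij_betw_def inj_on_def image_image cong: image_cong_simp)
      have b3: "bij_betw \<kappa> ?W (Inr ` R \<union> Inl ` (V0 - Y))"
        unfolding W(1) using b1 b2 by (rule bij_betw_combine) auto
      have "bij_betw (\<lambda>x. Inl (\<sigma> x)) X (Inl ` Y)" using \<sigma>(1) unfolding Y_def bij_betw_def inj_on_def by auto
      from bij_betw_case_sum[OF this b3]
      have "bij_betw (case_sum (\<lambda>x. Inl (\<sigma> x)) \<kappa>) (X <+> ?W) (Inl ` Y \<union> (Inr ` R \<union> Inl ` (V0 - Y)))" by auto
      also have "Inl ` Y \<union> (Inr ` R \<union> Inl ` (V0 - Y)) = ?R" using Y by auto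
      finally have \<tau>: "bij_betw (case_sum (\<lambda>x. Inl (\<sigma> x)) \<kappa>) (X <+> ?W) ?R" .
      have "(\<Sum>k\<in>?W. ?w (Inr k) (\<kappa> k)) = (\<Sum>k\<in>Y <+> W. ?w (Inr k) (\<kappa> k)) + (\<Sum>k\<in>Inl ` (V0 - Y). ?w (Inr k) (\<kappa> k))"
        unfolding W(1) using W(2) fin Y by (intro sum.union_disjoint) auto
      also have "(\<Sum>k\<in>Inl ` (V0 - Y). ?w (Inr k) (\<kappa> k)) = 0" using \<kappa>V by (intro sum.neutral) auto
      also have "(\<Sum>k\<in>Y <+> W. ?w (Inr k) (\<kappa> k)) = (\<Sum>k\<in>Y <+> W. w k (\<rho> k))" using \<kappa>Y by (intro sum.cong) auto
      finally have "(\<Sum>k\<in>?W. ?w (Inr k) (\<kappa> k)) = val ?g Y" using \<rho>(2) by simp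
      then have "(\<Sum>x\<in>X. c x (\<sigma> x)) + val ?g (\<sigma> ` X) = (\<Sum>x\<in>X <+> ?W. ?w x (case_sum (\<lambda>x. Inl (\<sigma> x)) \<kappa> x))"
        using fin(1,2) by (simp add: sum_Plus[OF finX] Y_def)
      also have "\<dots> \<le> val (gammoid V ?W ?R ?w) X" using True \<tau> by (rule gammoid_ge)
      finally show "(\<Sum>x\<in>X. c x (\<sigma> x)) + val ?g (\<sigma> ` X) \<le> val (gammoid V ?W ?R ?w) X" .
    qed (rule c)
    moreover have "max_induced ?w (free_vm ?R) (X <+> ?W) \<le> max_induced c ?g X"
    proof (rule max_free_le[OF presentationD(6,3,4)[OF P']])
      fix \<tau> assume \<tau>: "bij_betw \<tau> (X <+> ?W) ?R" and nf: "\<And>x. x \<in> X <+> ?W \<Longrightarrow> ?w x (\<tau> x) \<noteq> -\<infinity>"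
      have inj: "inj_on \<tau> (X <+> ?W)" and im: "\<tau> ` (X <+> ?W) = ?R" using \<tau> unfolding bij_betw_def by auto
      define \<sigma> where "\<sigma> x = projl (\<tau> (Inl x))" for x
      have \<sigma>: "\<tau> (Inl x) = Inl (\<sigma> x)" if "x \<in> X" for x
        using nf[OF InlI[OF that]] unfolding \<sigma>_def by (cases "\<tau> (Inl x)") auto
      define Y where "Y = \<sigma> ` X"
      have Y: "Y \<subseteq> V0"
      proof
        fix y assume "y \<in> Y"
        then obtain x where x: "x \<in> X" "y = \<sigma> x" unfolding Y_def by blast
        have "\<tau> (Inl x) \<in> ?R" using im x(1) by blast
        then show "y \<in> V0" using \<sigma>[OF x(1)] x(2) by auto
      qed
      have \<sigma>i: "inj_on \<sigma> X"
      proof (rule inj_onI)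
        fix x x' assume x: "x \<in> X" "x' \<in> X" "\<sigma> x = \<sigma> x'"
        then show "x = x'" using \<sigma> inj_onD[OF inj _ InlI[OF x(1)] InlI[OF x(2)]] by simp
      qed
      have R: "?R - (\<lambda>x. \<tau> (Inl x)) ` X = Inr ` R \<union> Inl ` (V0 - Y)"
      proof -
        have "(\<lambda>x. \<tau> (Inl x)) ` X = Inl ` Y" unfolding Y_def image_image using \<sigma> by (rule image_cong[OF refl])
        then show ?thesis by auto
      qed
      have b: "bij_betw (\<lambda>k. \<tau> (Inr k)) ?W (Inr ` R \<union> Inl ` (V0 - Y))"
        using bij_betw_Plus_split(2)[OF \<tau>] unfolding R .
      have toV: "\<tau> (Inr (Inl v)) = Inl v" if v: "v \<in> V0 - Y" for v
      proof -
        have "Inl v \<in> (\<lambda>k. \<tau> (Inr k)) ` ?W" using b v unfolding bij_betw_def by auto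
        then obtain k where k: "k \<in> ?W" "\<tau> (Inr k) = Inl v" by (metis imageE)
        then have "?w (Inr k) (Inl v) \<noteq> -\<infinity>" using nf[OF InrI[OF k(1)]] by simp
        then have "k = Inl v" by (cases k) auto
        then show ?thesis using k(2) by simp
      qed
      define \<rho> where "\<rho> k = projr (\<tau> (Inr k))" for k
      have W: "?W = (Y <+> W) \<union> Inl ` (V0 - Y)" "(Y <+> W) \<inter> Inl ` (V0 - Y) = {}" using Y by auto
      have b': "bij_betw (\<lambda>k. \<tau> (Inr k)) (Y <+> W) (Inr ` R)"
      proof -
        have "bij_betw (\<lambda>k. \<tau> (Inr k)) (Inl ` (V0 - Y)) (Inl ` (V0 - Y))"
          unfolding bij_betw_def by (auto simp: toV inj_on_def image_image)
        from bij_betw_partition[OF b[unfolded W(1)] this] show ?thesis using W(2) by auto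
      qed
      have \<rho>: "\<tau> (Inr k) = Inr (\<rho> k)" if "k \<in> Y <+> W" for k
        using bij_betw_apply[OF b' that] unfolding \<rho>_def by auto
      have "bij_betw \<rho> (Y <+> W) R"
        using bij_betw_image_iff[of "\<lambda>k. k" "Y <+> W" Inr "\<lambda>k. \<tau> (Inr k)" \<rho> R] \<rho> b' by simp
      then have "(\<Sum>k\<in>Y <+> W. w k (\<rho> k)) \<le> val ?g Y" using Y by (intro gammoid_ge)
      moreover have "(\<Sum>x\<in>X. c x (\<sigma> x)) + val ?g (\<sigma> ` X) \<le> max_induced c ?g X"
        using \<sigma>i Y unfolding Y_def by (intro max_induced_ge) auto
      moreover have "(\<Sum>k\<in>?W. ?w (Inr k) (\<tau> (Inr k))) = (\<Sum>k\<in>Y <+> W. w k (\<rho> k))"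
      proof -
        have "(\<Sum>k\<in>?W. ?w (Inr k) (\<tau> (Inr k))) = (\<Sum>k\<in>Y <+> W. ?w (Inr k) (\<tau> (Inr k))) + (\<Sum>k\<in>Inl ` (V0 - Y). ?w (Inr k) (\<tau> (Inr k)))"
          unfolding W(1) using W(2) fin Y by (intro sum.union_disjoint) auto
        also have "(\<Sum>k\<in>Inl ` (V0 - Y). ?w (Inr k) (\<tau> (Inr k))) = 0" using toV by (intro sum.neutral) auto
        also have "(\<Sum>k\<in>Y <+> W. ?w (Inr k) (\<tau> (Inr k))) = (\<Sum>k\<in>Y <+> W. w k (\<rho> k))" using \<rho> by (intro sum.cong) auto
        finally show ?thesis by simp
      qed
      moreover have "(\<Sum>x\<in>X. ?w (Inl x) (\<tau> (Inl x))) = (\<Sum>x\<in>X. c x (\<sigma> x))" using \<sigma> by (intro sum.cong) auto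
      ultimately show "(\<Sum>x\<in>X <+> ?W. ?w x (\<tau> x)) \<le> max_induced c ?g X"
        using fin(1,2) unfolding Y_def by (auto simp: sum_Plus[OF finX] intro: order_trans add_left_mono)
    qed (rule True)
    ultimately show ?thesis using True by (simp add: val_induced val_gammoid)
  qed (simp add: val_induced val_gammoid)
qed simp

section \<open>Direct sums of gammoids\<close>

text \<open>A block matrix.  The ground sets are subsets of one type, so membership in V1 or V2 decides to which
  block an element belongs.\<close>

definition sum_weight ::
  "'a set \<Rightarrow> ('a + 'b \<Rightarrow> 'c \<Rightarrow> ereal) \<Rightarrow> 'a set \<Rightarrow> ('a + 'd \<Rightarrow> 'e \<Rightarrow> ereal) \<Rightarrow> 'a + ('b + 'd) \<Rightarrow> 'c + 'e \<Rightarrow> ereal" where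
  "sum_weight V1 w1 V2 w2 x y = (case (x, y) of
      (Inl v, Inl u) \<Rightarrow> if v \<in> V1 then w1 (Inl v) u else -\<infinity>
    | (Inl v, Inr u) \<Rightarrow> if v \<in> V2 then w2 (Inl v) u else -\<infinity>
    | (Inr (Inl k), Inl u) \<Rightarrow> w1 (Inr k) u
    | (Inr (Inr k), Inr u) \<Rightarrow> w2 (Inr k) u
    | _ \<Rightarrow> -\<infinity>)"

lemma presentation_vunion:
  assumes "presentation V1 W1 U1 w1" "presentation V2 W2 U2 w2"
  shows "presentation (V1 \<union> V2) (W1 <+> W2) (U1 <+> U2) (sum_weight V1 w1 V2 w2)"
  using assms by (auto simp: presentation_def sum_weight_def split: sum.splits)

lemma Inl_Inr_Un_eqD:
  assumes "A \<subseteq> range Inl" "B \<subseteq> range Inr" "A \<union> B = Inl ` C \<union> Inr ` D"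
  shows "A = Inl ` C" "B = Inr ` D"
proof -
  have split: "P = (P \<union> Q) \<inter> L" "Q = (P \<union> Q) \<inter> R" if "P \<subseteq> L" "Q \<subseteq> R" "L \<inter> R = {}" for P Q L R :: "('a + 'b) set"
    using that by blast+
  have "range Inl \<inter> range Inr = {}" by auto
  note split = split[OF assms(1,2) this, unfolded assms(3)]
  show "A = Inl ` C" by (subst split(1)) auto
  show "B = Inr ` D" by (subst split(2)) auto
qed

text \<open>With block weights, a matching of finite weight splits into one for each block.  The maps e1 and e2
  embed the left sides of the blocks.\<close>

lemma vunion_gammoid:
  assumes P1: "presentation V1 W1 U1 w1" and P2: "presentation V2 W2 U2 w2" and dis: "V1 \<inter> V2 = {}"
    and ne: "card W1 \<le> card U1" "card W2 \<le> card U2"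
  shows "vunion (gammoid V1 W1 U1 w1) (gammoid V2 W2 U2 w2) =
    gammoid (V1 \<union> V2) (W1 <+> W2) (U1 <+> U2) (sum_weight V1 w1 V2 w2)"
    (is "vunion ?f ?g = gammoid ?V ?W ?U ?w")
proof (rule setfun_eqI)
  note f = wf_gammoid[OF P1] and g = wf_gammoid[OF P2]
  note P = presentation_vunion[OF P1 P2]
  note fin1 = presentationD[OF P1] and fin2 = presentationD[OF P2]
  show "rnk (vunion ?f ?g) = rnk (gammoid ?V ?W ?U ?w)"
    using ne fin1(2,3) fin2(2,3) by (simp add: card_Plus)
  \<comment> \<open>Both embeddings are the identity on the ground sets, which are disjoint.\<close>
  define e1 :: "'a + 'b \<Rightarrow> 'a + ('b + 'd)" where "e1 = map_sum id Inl"
  define e2 :: "'a + 'd \<Rightarrow> 'a + ('b + 'd)" where "e2 = map_sum id Inr"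
  have inj: "inj e1" "inj e2" unfolding e1_def e2_def by (auto intro: sum.inj_map)
  have e1s: "e1 (Inl v) = Inl v" "e1 (Inr k) = Inr (Inl k)" and e2s: "e2 (Inl v) = Inl v" "e2 (Inr k') = Inr (Inr k')" for v k k'
    by (simp_all add: e1_def e2_def)
  have we1: "?w (e1 x) (Inl u) = w1 x u" if "x \<in> V1 <+> W1" for x u
    using that by (auto simp: e1s sum_weight_def)
  have we2: "?w (e2 x) (Inr u) = w2 x u" if "x \<in> V2 <+> W2" for x u
    using that by (auto simp: e2s sum_weight_def)
  have we1': "?w (e1 x) (Inr u) = -\<infinity>" if "x \<in> V1 <+> W1" for x u
    using that dis by (auto simp: e1s sum_weight_def)
  have we2': "?w (e2 x) (Inl u) = -\<infinity>" if "x \<in> V2 <+> W2" for x u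
    using that dis by (auto simp: e2s sum_weight_def)
  have split: "(X1 \<union> X2) <+> ?W = e1 ` (X1 <+> W1) \<union> e2 ` (X2 <+> W2)"
      "e1 ` (X1 <+> W1) \<inter> e2 ` (X2 <+> W2) = {}" if "X1 \<subseteq> V1" "X2 \<subseteq> V2" for X1 X2
    using that dis by (auto simp: Plus_def image_Un image_image e1s e2s)
  have sums: "(\<Sum>x\<in>(X1 \<union> X2) <+> ?W. ?w x (\<tau> x)) = (\<Sum>x\<in>X1 <+> W1. ?w (e1 x) (\<tau> (e1 x))) + (\<Sum>x\<in>X2 <+> W2. ?w (e2 x) (\<tau> (e2 x)))"
    if X: "X1 \<subseteq> V1" "X2 \<subseteq> V2" for X1 X2 \<tau>
    unfolding split(1)[OF X] using split(2)[OF X] fin1(6)[OF X(1)] fin2(6)[OF X(2)]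
    by (simp add: sum.union_disjoint sum.reindex inj_on_subset[OF inj(1)] inj_on_subset[OF inj(2)])
  have Ud: "?U = Inl ` U1 \<union> Inr ` U2" "Inl ` U1 \<inter> Inr ` U2 = {}" by (auto simp: Plus_def)
  fix X
  show "val (vunion ?f ?g) X = val (gammoid ?V ?W ?U ?w) X"
  proof (rule antisym)
    show "val (vunion ?f ?g) X \<le> val (gammoid ?V ?W ?U ?w) X"
    proof (rule vunion_le[OF f g])
      fix X1 X2 assume X: "X = X1 \<union> X2" "val ?f X1 \<noteq> -\<infinity>" "val ?g X2 \<noteq> -\<infinity>"
      obtain \<sigma>1 where 1: "X1 \<subseteq> V1" "bij_betw \<sigma>1 (X1 <+> W1) U1" "val ?f X1 = (\<Sum>x\<in>X1 <+> W1. w1 x (\<sigma>1 x))"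
        using gammoid_attained[OF P1 X(2)] by metis
      obtain \<sigma>2 where 2: "X2 \<subseteq> V2" "bij_betw \<sigma>2 (X2 <+> W2) U2" "val ?g X2 = (\<Sum>x\<in>X2 <+> W2. w2 x (\<sigma>2 x))"
        using gammoid_attained[OF P2 X(3)] by metis
      define \<tau> where "\<tau> x = (if x \<in> e1 ` (X1 <+> W1) then Inl (\<sigma>1 (the_inv e1 x)) else Inr (\<sigma>2 (the_inv e2 x)))" for x
      have \<tau>1: "\<tau> (e1 x) = Inl (\<sigma>1 x)" if "x \<in> X1 <+> W1" for x
        using that unfolding \<tau>_def by (simp add: the_inv_f_f[OF inj(1)])
      have \<tau>2: "\<tau> (e2 x) = Inr (\<sigma>2 x)" if "x \<in> X2 <+> W2" for x
      proof -
        have "e2 x \<notin> e1 ` (X1 <+> W1)" using split(2)[OF 1(1) 2(1)] that by blast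
        then show ?thesis unfolding \<tau>_def by (simp add: the_inv_f_f[OF inj(2)])
      qed
      have "bij_betw \<tau> (e1 ` (X1 <+> W1)) (Inl ` U1)"
        using bij_betw_image_iff[OF inj_on_subset[OF inj(1)] inj_Inl, of "X1 <+> W1" \<tau> \<sigma>1] \<tau>1 1(2) by simp
      moreover have "bij_betw \<tau> (e2 ` (X2 <+> W2)) (Inr ` U2)"
        using bij_betw_image_iff[OF inj_on_subset[OF inj(2)] inj_Inr, of "X2 <+> W2" \<tau> \<sigma>2] \<tau>2 2(2) by simp
      ultimately have "bij_betw \<tau> (X <+> ?W) ?U"
        unfolding X(1) split(1)[OF 1(1) 2(1)] Ud(1) using Ud(2) by (rule bij_betw_combine)
      moreover have "X \<subseteq> ?V" using X(1) 1(1) 2(1) by blast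
      ultimately have "(\<Sum>x\<in>X <+> ?W. ?w x (\<tau> x)) \<le> val (gammoid ?V ?W ?U ?w) X" by (intro gammoid_ge)
      moreover have "(\<Sum>x\<in>X1 <+> W1. ?w (e1 x) (\<tau> (e1 x))) = val ?f X1" unfolding 1(3)
      proof (rule sum.cong[OF refl])
        fix x assume x: "x \<in> X1 <+> W1"
        then have "x \<in> V1 <+> W1" using 1(1) by auto
        then show "?w (e1 x) (\<tau> (e1 x)) = w1 x (\<sigma>1 x)" using \<tau>1[OF x] we1 by simp
      qed
      moreover have "(\<Sum>x\<in>X2 <+> W2. ?w (e2 x) (\<tau> (e2 x))) = val ?g X2" unfolding 2(3)
      proof (rule sum.cong[OF refl])
        fix x assume x: "x \<in> X2 <+> W2"
        then have "x \<in> V2 <+> W2" using 2(1) by auto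
        then show "?w (e2 x) (\<tau> (e2 x)) = w2 x (\<sigma>2 x)" using \<tau>2[OF x] we2 by simp
      qed
      ultimately show "val ?f X1 + val ?g X2 \<le> val (gammoid ?V ?W ?U ?w) X"
        unfolding X(1) sums[OF 1(1) 2(1)] by simp
    qed
    show "val (gammoid ?V ?W ?U ?w) X \<le> val (vunion ?f ?g) X"
    proof (cases "X \<subseteq> ?V")
      case True
      define X1 where "X1 = X \<inter> V1"
      define X2 where "X2 = X \<inter> V2"
      have X: "X1 \<subseteq> V1" "X2 \<subseteq> V2" "X = X1 \<union> X2" "X1 \<inter> X2 = {}" using True dis unfolding X1_def X2_def by auto
      have "max_induced ?w (free_vm ?U) (X <+> ?W) \<le> val (vunion ?f ?g) X"
      proof (rule max_free_le[OF presentationD(6,3,4)[OF P]])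
        fix \<tau> assume \<tau>: "bij_betw \<tau> (X <+> ?W) ?U" and nf: "\<And>x. x \<in> X <+> ?W \<Longrightarrow> ?w x (\<tau> x) \<noteq> -\<infinity>"
        note S = split[OF X(1,2), folded X(3)]
        define \<sigma>1 where "\<sigma>1 x = projl (\<tau> (e1 x))" for x
        define \<sigma>2 where "\<sigma>2 x = projr (\<tau> (e2 x))" for x
        have V1: "x \<in> V1 <+> W1" if "x \<in> X1 <+> W1" for x using that X(1) by auto
        have V2: "x \<in> V2 <+> W2" if "x \<in> X2 <+> W2" for x using that X(2) by auto
        have \<tau>1: "\<tau> (e1 x) = Inl (\<sigma>1 x)" if x: "x \<in> X1 <+> W1" for x
        proof -
          have "e1 x \<in> X <+> ?W" unfolding S(1) using x by blast
          then have "?w (e1 x) (\<tau> (e1 x)) \<noteq> -\<infinity>" by (rule nf)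
          then show ?thesis using we1'[OF V1[OF x]] unfolding \<sigma>1_def by (cases "\<tau> (e1 x)") auto
        qed
        have \<tau>2: "\<tau> (e2 x) = Inr (\<sigma>2 x)" if x: "x \<in> X2 <+> W2" for x
        proof -
          have "e2 x \<in> X <+> ?W" unfolding S(1) using x by blast
          then have "?w (e2 x) (\<tau> (e2 x)) \<noteq> -\<infinity>" by (rule nf)
          then show ?thesis using we2'[OF V2[OF x]] unfolding \<sigma>2_def by (cases "\<tau> (e2 x)") auto
        qed
        have in1: "\<tau> ` e1 ` (X1 <+> W1) \<subseteq> range Inl" and in2: "\<tau> ` e2 ` (X2 <+> W2) \<subseteq> range Inr"
          using \<tau>1 \<tau>2 by auto
        have im: "\<tau> ` e1 ` (X1 <+> W1) \<union> \<tau> ` e2 ` (X2 <+> W2) = Inl ` U1 \<union> Inr ` U2"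
          using \<tau> unfolding S(1) Ud(1) bij_betw_def by (simp add: image_Un)
        note Inl_Inr_Un_eqD[OF in1 in2 im]
        moreover have "inj_on \<tau> (e1 ` (X1 <+> W1))" "inj_on \<tau> (e2 ` (X2 <+> W2))"
          using \<tau> unfolding S(1) bij_betw_def by (auto intro: inj_on_subset)
        ultimately have "bij_betw \<tau> (e1 ` (X1 <+> W1)) (Inl ` U1)" "bij_betw \<tau> (e2 ` (X2 <+> W2)) (Inr ` U2)"
          unfolding bij_betw_def by auto
        then have b: "bij_betw \<sigma>1 (X1 <+> W1) U1" "bij_betw \<sigma>2 (X2 <+> W2) U2"
          using bij_betw_image_iff[OF inj_on_subset[OF inj(1)] inj_Inl, of "X1 <+> W1" \<tau> \<sigma>1] \<tau>1
            bij_betw_image_iff[OF inj_on_subset[OF inj(2)] inj_Inr, of "X2 <+> W2" \<tau> \<sigma>2] \<tau>2 by simp_all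
        have "(\<Sum>x\<in>X1 <+> W1. ?w (e1 x) (\<tau> (e1 x))) = (\<Sum>x\<in>X1 <+> W1. w1 x (\<sigma>1 x))"
          using \<tau>1 we1[OF V1] by (intro sum.cong) auto
        moreover have "(\<Sum>x\<in>X2 <+> W2. ?w (e2 x) (\<tau> (e2 x))) = (\<Sum>x\<in>X2 <+> W2. w2 x (\<sigma>2 x))"
          using \<tau>2 we2[OF V2] by (intro sum.cong) auto
        ultimately have "(\<Sum>x\<in>X <+> ?W. ?w x (\<tau> x)) \<le> val ?f X1 + val ?g X2"
          unfolding X(3) sums[OF X(1,2)] using X(1,2) b by (auto intro!: add_mono gammoid_ge)
        also have "\<dots> \<le> val (vunion ?f ?g) X" unfolding X(3) using X(4) by (rule vunion_val_ge[OF f g])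
        finally show "(\<Sum>x\<in>X <+> ?W. ?w x (\<tau> x)) \<le> val (vunion ?f ?g) X" .
      qed (rule True)
      then show ?thesis using True by (simp add: val_gammoid)
    qed (simp add: val_gammoid)
  qed
qed simp

section \<open>The class of valuated gammoids\<close>

lemma card_le_of_gammoid:
  assumes P: "presentation V W U w" and ne: "eff_dom (gammoid V W U w) \<noteq> {}"
  shows "card W \<le> card U"
proof -
  obtain X \<sigma> where X: "X \<subseteq> V" "bij_betw \<sigma> (X <+> W) U"
    using ne eff_dom_nonempty_iff[OF wf_gammoid[OF P]] gammoid_attained[OF P] by metis
  then show ?thesis using bij_betw_same_card[OF X(2)] presentationD(2,5)[OF P] by (simp add: card_Plus)
qed

text \<open>W and U are replaced by fresh copies inside the type of V, and the edges of the bipartite graph are the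
  pairs of weight other than \<open>-\<infinity>\<close>.  Both sides of a bipartite graph are nonempty by definition.\<close>

lemma gammoid_mem_nonempty:
  fixes V :: "'a::infinite set"
  assumes P: "presentation V W U w" and nonempty: "W \<noteq> {}" "U \<noteq> {}"
    and ne: "eff_dom (gammoid V W U w) \<noteq> {}"
  shows "gammoid V W U w \<in> valuated_gammoids"
proof -
  note fin = presentationD[OF P]
  obtain \<alpha> :: "_ \<Rightarrow> 'a" where \<alpha>: "inj_on \<alpha> W" "\<alpha> ` W \<inter> V = {}"
    using ex_fresh_injection[OF fin(2,1)] .
  define V' where "V' = V \<union> \<alpha> ` W"
  have finV': "finite V'" unfolding V'_def using fin by simp
  obtain \<beta> :: "_ \<Rightarrow> 'a" where \<beta>: "inj_on \<beta> U" "\<beta> ` U \<inter> V' = {}"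
    using ex_fresh_injection[OF fin(3) finV'] .
  define U' where "U' = \<beta> ` U"
  have finU': "finite U'" unfolding U'_def using fin by simp
  define e where "e = case_sum (\<lambda>v. v) \<alpha>"
  have im: "e ` (X <+> W) = X \<union> \<alpha> ` W" for X
    unfolding Plus_def image_Un image_image e_def by simp
  have injV: "inj_on e (V <+> W)"
    using bij_betw_case_sum[of "\<lambda>v. v" V V \<alpha> W "\<alpha> ` W"] \<alpha> unfolding e_def bij_betw_def by auto
  define E where "E = {(e x, \<beta> y) | x y. x \<in> V <+> W \<and> y \<in> U \<and> w x y \<noteq> -\<infinity>}"
  define c where "c a = real_of_ereal (w (the_inv_into (V <+> W) e (fst a)) (the_inv_into U \<beta> (snd a)))" for a
  define \<omega> where "\<omega> a b = (if (a, b) \<in> E then ereal (c (a, b)) else -\<infinity>)" for a b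
  have \<omega>: "\<omega> (e x) (\<beta> y) = w x y" if "x \<in> V <+> W" "y \<in> U" for x y
  proof -
    have "(e x, \<beta> y) \<in> E \<longleftrightarrow> w x y \<noteq> -\<infinity>"
    proof
      assume "(e x, \<beta> y) \<in> E"
      then obtain x' y' where "e x = e x'" "\<beta> y = \<beta> y'" "x' \<in> V <+> W" "y' \<in> U" "w x' y' \<noteq> -\<infinity>"
        unfolding E_def by blast
      then show "w x y \<noteq> -\<infinity>" using inj_onD[OF injV, of x x'] inj_onD[OF \<beta>(1), of y y'] that by simp
    qed (use that in \<open>auto simp: E_def\<close>)
    moreover have "c (e x, \<beta> y) = real_of_ereal (w x y)"
      unfolding c_def using that by (simp add: the_inv_into_f_f[OF injV] the_inv_into_f_f[OF \<beta>(1)])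
    ultimately show ?thesis using fin(4)[of x y] unfolding \<omega>_def by (auto simp: ereal_real)
  qed
  have E: "E \<subseteq> V' \<times> U'"
  proof -
    have "e x \<in> V'" if "x \<in> V <+> W" for x using im[of V] that unfolding V'_def by blast
    then show ?thesis unfolding E_def U'_def by blast
  qed
  have G: "bipartite_graph V' U' E"
    unfolding bipartite_graph_def directed_network_def
    using E \<beta>(2) finV' finU' nonempty unfolding V'_def U'_def by auto
  have bi: "bipartite_induction V' E c (free_vm U') = induced V' \<omega> (free_vm U')"
    using bipartite_induction_eq[OF _ wf_free_vm[OF finU'], of V' E c] G unfolding \<omega>_def by simp
  have \<omega>fin: "\<omega> a b \<noteq> \<infinity>" for a b unfolding \<omega>_def by simp
  have wf: "setfun_wf (induced V' \<omega> (free_vm U'))"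
    using finV' \<omega>fin by (intro wf_induced wf_free_vm finU') auto
  have sub: "\<alpha> ` W \<subseteq> ground (induced V' \<omega> (free_vm U'))" unfolding V'_def by simp
  have "gammoid V W U w = contraction (bipartite_induction V' E c (free_vm U')) (\<alpha> ` W)"
    unfolding bi
  proof (rule setfun_eqI)
    show "ground (gammoid V W U w) = ground (contraction (induced V' \<omega> (free_vm U')) (\<alpha> ` W))"
      using \<alpha>(2) unfolding V'_def by auto
    show "rnk (gammoid V W U w) = rnk (contraction (induced V' \<omega> (free_vm U')) (\<alpha> ` W))"
      by (simp add: U'_def card_image[OF \<alpha>(1)] card_image[OF \<beta>(1)])
    fix X
    have gV: "V' - \<alpha> ` W = V" using \<alpha>(2) unfolding V'_def by auto
    have "max_induced \<omega> (free_vm U') (X \<union> \<alpha> ` W) = max_induced w (free_vm U) (X <+> W)" if X: "X \<subseteq> V"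
      unfolding U'_def im[symmetric]
    proof (rule max_free_transport[OF fin(6)[OF X] fin(3,4) \<omega>fin _ \<beta>(1)])
      show "inj_on e (X <+> W)" using injV by (rule inj_on_subset) (use X in auto)
      show "\<omega> (e x) (\<beta> y) = w x y" if "x \<in> X <+> W" "y \<in> U" for x y
        using that X by (intro \<omega>) auto
    qed
    moreover have "X \<union> \<alpha> ` W \<subseteq> V'" if "X \<subseteq> V" unfolding V'_def using that by blast
    ultimately show "val (gammoid V W U w) X = val (contraction (induced V' \<omega> (free_vm U')) (\<alpha> ` W)) X"
      unfolding val_contraction[OF wf sub] by (simp add: val_gammoid val_induced gV)
  qed
  moreover have "\<alpha> ` W \<subseteq> V'" unfolding V'_def by blast
  ultimately show ?thesis using G ne unfolding valuated_gammoids_def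
    by (intro CollectI exI[of _ V'] exI[of _ U'] exI[of _ E] exI[of _ c] exI[of _ "\<alpha> ` W"]) simp
qed

text \<open>One edge of weight 0 whose left end is contracted: the neutral element of direct sums.\<close>

lemma trivial_gammoid: "gammoid {} {()} {()} (\<lambda>_ _. 0) = free_vm {}"
proof (rule setfun_eqI)
  have b: "bij_betw (\<lambda>_. ()) (({} :: 'a set) <+> {()}) {()}" by (auto simp: bij_betw_def inj_on_def)
  have "max_induced (\<lambda>_ _. 0) (free_vm {()}) (({} :: 'a set) <+> {()}) = 0"
    using max_free_ge[OF b, of "\<lambda>_ _. 0"] by (intro antisym max_free_le) auto
  then show "val (gammoid {} {()} {()} (\<lambda>_ _. 0)) X = val (free_vm {}) X" for X :: "'a set"
    by (auto simp: val_gammoid)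
qed simp_all

text \<open>Adding the trivial gammoid does not change the function but makes both side sets nonempty.\<close>

lemma gammoid_mem:
  fixes V :: "'a::infinite set"
  assumes P: "presentation V W U w" and ne: "eff_dom (gammoid V W U w) \<noteq> {}"
  shows "gammoid V W U w \<in> valuated_gammoids"
proof -
  let ?t = "gammoid {} {()} {()} (\<lambda>_ _. 0) :: 'a setfun"
  have T: "presentation ({} :: 'a set) {()} {()} (\<lambda>_ _. 0)" by (simp add: presentation_def)
  have "vunion (gammoid V W U w) ?t = gammoid V W U w"
    unfolding trivial_gammoid using vunion_free_vm[OF wf_gammoid[OF P], of "{}"]
    by (intro setfun_eqI) auto
  then have eq: "gammoid V W U w = gammoid V (W <+> {()}) (U <+> {()}) (sum_weight V w {} (\<lambda>_ _. 0))"
    using vunion_gammoid[OF P T _ card_le_of_gammoid[OF P ne]] by simp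
  have "presentation V (W <+> {()}) (U <+> {()}) (sum_weight V w {} (\<lambda>_ _. 0))"
    using presentation_vunion[OF P T] by simp
  then show ?thesis using ne unfolding eq by (intro gammoid_mem_nonempty) auto
qed

lemma valuated_gammoid_presentation:
  fixes f :: "'a::infinite setfun"
  assumes "f \<in> valuated_gammoids"
  obtains W U :: "'a set" and w where "presentation (ground f) W U w" "f = gammoid (ground f) W U w"
    "eff_dom f \<noteq> {}"
proof -
  obtain V' U E c W where f: "f = contraction (bipartite_induction V' E c (free_vm U)) W"
    and G: "bipartite_graph V' U E" and W: "W \<subseteq> V'" and ne: "eff_dom f \<noteq> {}"
    using assms unfolding valuated_gammoids_def by blast
  have fin: "finite V'" "finite U" "finite W"
    using G W unfolding bipartite_graph_def directed_network_def by (auto intro: finite_subset)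
  define \<omega> where "\<omega> a b = (if (a, b) \<in> E then ereal (c (a, b)) else -\<infinity>)" for a b
  have bi: "bipartite_induction V' E c (free_vm U) = induced V' \<omega> (free_vm U)"
    using bipartite_induction_eq[OF _ wf_free_vm[OF fin(2)], of V' E c] G unfolding \<omega>_def by simp
  have \<omega>fin: "\<omega> a b \<noteq> \<infinity>" for a b unfolding \<omega>_def by simp
  have wf: "setfun_wf (induced V' \<omega> (free_vm U))"
    using fin \<omega>fin by (intro wf_induced wf_free_vm) auto
  define e where "e = case_sum (\<lambda>v. v :: 'a) (\<lambda>v. v)"
  define w where "w x y = \<omega> (e x) y" for x y
  have gf: "ground f = V' - W" unfolding f bi by simp
  have P: "presentation (ground f) W U w" unfolding presentation_def gf w_def using fin \<omega>fin by simp
  moreover have "f = gammoid (ground f) W U w" unfolding gf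
  proof (rule setfun_eqI)
    fix X
    have "max_induced \<omega> (free_vm ((\<lambda>u. u) ` U)) (e ` (X <+> W)) = max_induced w (free_vm U) (X <+> W)" if X: "X \<subseteq> V' - W"
    proof (rule max_free_transport)
      show "inj_on e (X <+> W)"
        using bij_betw_case_sum[of "\<lambda>v. v" X X "\<lambda>v. v" W W] X unfolding e_def bij_betw_def by auto
      show "finite (X <+> W)" using X fin by (auto intro: finite_subset)
    qed (use fin \<omega>fin in \<open>auto simp: w_def\<close>)
    moreover have "e ` (X <+> W) = X \<union> W" unfolding Plus_def image_Un image_image e_def by simp
    ultimately show "val f X = val (gammoid (V' - W) W U w) X"
      unfolding f bi using W by (auto simp: val_contraction[OF wf] val_gammoid val_induced)
  qed (simp_all add: f bi)
  ultimately show ?thesis using that ne by blast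
qed

text \<open>Since \<open>presentation\<close> demands that no weight at all is \<open>\<infinity>\<close>, the weights outside V and the ground set of
  f are reset to \<open>-\<infinity>\<close>.\<close>

lemma valuated_gammoid_induced:
  fixes f :: "'a::infinite setfun"
  assumes f: "f \<in> valuated_gammoids" and V: "finite V"
    and c: "\<And>x y. x \<in> V \<Longrightarrow> y \<in> ground f \<Longrightarrow> c x y \<noteq> \<infinity>" and ne: "eff_dom (induced V c f) \<noteq> {}"
  shows "induced V c f \<in> valuated_gammoids"
proof -
  obtain W U :: "'a set" and w where P: "presentation (ground f) W U w" "f = gammoid (ground f) W U w"
    using valuated_gammoid_presentation[OF f] .
  define c' where "c' x y = (if x \<in> V \<and> y \<in> ground f then c x y else -\<infinity>)" for x y
  have c': "c' x y \<noteq> \<infinity>" for x y unfolding c'_def using c by auto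
  have "induced V c f = induced V c' f" by (rule induced_cong) (simp add: c'_def)
  also have "\<dots> = induced V c' (gammoid (ground f) W U w)" using P(2) by simp
  also have "\<dots> = gammoid V (ground f <+> W) (ground f <+> U) (induced_weight c' w)"
    using P(1) V c' by (rule induced_gammoid)
  finally have eq: "induced V c f = gammoid V (ground f <+> W) (ground f <+> U) (induced_weight c' w)" .
  show ?thesis using ne unfolding eq by (intro gammoid_mem presentation_induced P(1) V c')
qed

lemma complete_valuated_gammoids: "complete_class (valuated_gammoids :: 'a::infinite setfun set)"
proof -
  let ?G = "valuated_gammoids :: 'a setfun set"
  have vm: "valuated_matroid f" if f: "f \<in> ?G" for f
    using valuated_gammoid_presentation[OF f] valuated_matroid_gammoid by metis
  note wf = valuated_matroid_wf[OF vm] and fin = setfun_wfD(1)[OF valuated_matroid_wf[OF vm]]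
  have "relabel \<phi> f \<in> ?G" if f: "f \<in> ?G" and \<phi>: "inj_on \<phi> (ground f)" for f \<phi>
  proof -
    note eq = relabel_eq_induced[OF wf[OF f] \<phi>]
    have wfr: "setfun_wf (relabel \<phi> f)" unfolding eq using wf[OF f] fin[OF f] by (intro wf_induced) auto
    obtain X where X: "val f X \<noteq> -\<infinity>"
      using vm[OF f] eff_dom_nonempty_iff[OF wf[OF f]] unfolding valuated_matroid_def by blast
    have sub: "X \<subseteq> ground f" using setfun_wfD(3)[OF wf[OF f] X] .
    then have "{v \<in> ground f. \<phi> v \<in> \<phi> ` X} = X" using \<phi> by (auto dest: inj_onD)
    then have "val (relabel \<phi> f) (\<phi> ` X) \<noteq> -\<infinity>" using X sub by (simp add: relabel_def image_mono)
    then have "eff_dom (relabel \<phi> f) \<noteq> {}" using eff_dom_nonempty_iff[OF wfr] by blast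
    then show ?thesis using fin[OF f] unfolding eq by (intro valuated_gammoid_induced[OF f]) auto
  qed
  then have "vm_class ?G" unfolding vm_class_def by (intro conjI ballI allI impI vm)
  moreover have "closed_restriction ?G"
    unfolding closed_restriction_def
  proof (intro ballI allI impI)
    fix f :: "'a setfun" and Y assume f: "f \<in> ?G" and ne: "eff_dom (deletion f Y) \<noteq> {}"
    show "deletion f Y \<in> ?G"
      using ne fin[OF f] unfolding deletion_eq_induced[OF wf[OF f]] by (intro valuated_gammoid_induced[OF f]) auto
  qed
  moreover have "closed_dual ?G"
    unfolding closed_dual_def
  proof (intro ballI impI)
    fix f :: "'a setfun" assume f: "f \<in> ?G" and ne: "eff_dom (dual f) \<noteq> {}"
    obtain W U :: "'a set" and w where P: "presentation (ground f) W U w" "f = gammoid (ground f) W U w" "eff_dom f \<noteq> {}"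
      using valuated_gammoid_presentation[OF f] .
    have eq: "dual f = gammoid (ground f) U (ground f <+> W) (dual_weight w)"
      using dual_gammoid[OF P(1)] P(2,3) by simp
    show "dual f \<in> ?G" using ne unfolding eq by (intro gammoid_mem presentation_dual P(1))
  qed
  moreover have "closed_direct_sum ?G"
    unfolding closed_direct_sum_def
  proof (intro ballI impI)
    fix f g :: "'a setfun" assume f: "f \<in> ?G" and g: "g \<in> ?G"
      and h: "ground f \<inter> ground g = {} \<and> eff_dom (vunion f g) \<noteq> {}"
    obtain W U :: "'a set" and w where P: "presentation (ground f) W U w" "f = gammoid (ground f) W U w" "eff_dom f \<noteq> {}"
      using valuated_gammoid_presentation[OF f] .
    obtain W' U' :: "'a set" and w' where P': "presentation (ground g) W' U' w'" "g = gammoid (ground g) W' U' w'" "eff_dom g \<noteq> {}"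
      using valuated_gammoid_presentation[OF g] .
    have eq: "vunion f g = gammoid (ground f \<union> ground g) (W <+> W') (U <+> U') (sum_weight (ground f) w (ground g) w')"
      using vunion_gammoid[OF P(1) P'(1)] h card_le_of_gammoid[OF P(1)] card_le_of_gammoid[OF P'(1)] P(2,3) P'(2,3) by simp
    show "vunion f g \<in> ?G" using h unfolding eq by (intro gammoid_mem presentation_vunion P(1) P'(1)) auto
  qed
  moreover have "closed_principal_extension ?G"
    unfolding closed_principal_extension_def
  proof (intro ballI allI impI)
    fix f :: "'a setfun" and p :: 'a and u :: "'a \<Rightarrow> ereal"
    assume f: "f \<in> ?G"
      and h: "p \<notin> ground f \<and> (\<forall>v\<in>ground f. u v \<noteq> \<infinity>) \<and> eff_dom (principal_extension f p u) \<noteq> {}"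
    note eq = principal_extension_eq_induced[of f p u]
    show "principal_extension f p u \<in> ?G"
      using h fin[OF f] wf[OF f] by (auto simp: eq intro!: valuated_gammoid_induced[OF f] split: if_splits)
  qed
  ultimately show ?thesis unfolding complete_class_def by blast
qed

lemma valuated_gammoids_least:
  fixes C :: "'a::infinite setfun set"
  assumes C: "complete_class C" "C \<noteq> {}"
  shows "valuated_gammoids \<subseteq> C"
proof
  fix f :: "'a setfun" assume "f \<in> valuated_gammoids"
  then obtain V' U E c W where f: "f = contraction (bipartite_induction V' E c (free_vm U)) W"
    and G: "bipartite_graph V' U E" and W: "W \<subseteq> V'" and ne: "eff_dom f \<noteq> {}"
    unfolding valuated_gammoids_def by blast
  have fin: "finite V'" "finite U"
    using G unfolding bipartite_graph_def directed_network_def by auto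
  let ?h = "bipartite_induction V' E c (free_vm U)"
  have bi: "?h = induced V' (\<lambda>x y. if (x, y) \<in> E then ereal (c (x, y)) else -\<infinity>) (free_vm U)"
    using bipartite_induction_eq[OF _ wf_free_vm[OF fin(2)], of V' E c] G by simp
  have wf: "setfun_wf ?h" unfolding bi using fin by (intro wf_induced wf_free_vm) auto
  have gh: "ground ?h = V'" unfolding bi by simp
  have "\<exists>X. val (contraction ?h W) X \<noteq> -\<infinity>"
    using ne W eff_dom_nonempty_iff[OF wf_contraction[OF wf]] unfolding f gh by blast
  then have "\<exists>X. val ?h X \<noteq> -\<infinity>" using W val_contraction[OF wf, of W] unfolding gh by metis
  then have "eff_dom ?h \<noteq> {}" using eff_dom_nonempty_iff[OF wf] by blast
  then have "?h \<in> C"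
    using G by (intro complete_bipartite_induction[OF C(1) complete_free_vm[OF C fin(2)]]) simp
  then show "f \<in> C" using ne W gh unfolding f by (intro complete_contraction[OF C(1)]) auto
qed

lemma valuated_gammoids_nonempty: "(valuated_gammoids :: 'a::infinite setfun set) \<noteq> {}"
proof -
  have "{} \<in> eff_dom (free_vm ({} :: 'a set))" by (simp add: eff_dom_def ksubsets_def)
  then have "gammoid {} {()} {()} (\<lambda>_ _. 0) \<in> (valuated_gammoids :: 'a setfun set)"
    by (intro gammoid_mem) (auto simp: presentation_def trivial_gammoid)
  then show ?thesis by blast
qed

theorem theorem3p6:
  shows "(\<forall>C :: 'a::infinite setfun set. complete_class C \<longrightarrow>
            closed_contraction C \<and> closed_truncation C \<and> closed_bipartite_induction C \<and>
            closed_network_induction C \<and> closed_union C)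
       \<and> complete_class (valuated_gammoids :: 'a setfun set)
       \<and> (valuated_gammoids :: 'a setfun set) \<noteq> {}
       \<and> (\<forall>C :: 'a setfun set. complete_class C \<and> C \<noteq> {} \<longrightarrow> valuated_gammoids \<subseteq> C)"
proof (intro conjI allI impI)
  fix C :: "'a setfun set" assume C: "complete_class C"
  show "closed_contraction C" unfolding closed_contraction_def using complete_contraction[OF C] by blast
  show "closed_truncation C" unfolding closed_truncation_def using complete_truncation[OF C] by blast
  show "closed_bipartite_induction C"
    unfolding closed_bipartite_induction_def using complete_bipartite_induction[OF C] by blast
  show "closed_network_induction C"
    unfolding closed_network_induction_def using complete_network_induction[OF C] by blast
  show "closed_union C" unfolding closed_union_def using complete_vunion[OF C] by blast
qed (use complete_valuated_gammoids valuated_gammoids_nonempty valuated_gammoids_least in blast)+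

end
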